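(* Let $(A,B,C,H^3,c_2\cdot H,c_3)$ be any one of the 14 rows of the table given in the context, with $(d_1,d_2)$ the corresponding pair listed there, and let $$L=\theta^4-Cz(\theta+A)(\theta+1-A)(\theta+B)(\theta+1-B),\qquad \theta=z\frac{d}{dz}.$$ Let $y_0,y_1,y_2,y_3$ be the Frobenius basis of solutions of $L$ at $z=0$. Then, relative to the ordered basis $$\frac{y_1}{2\pi i},\quad y_0,\quad \frac{H^3}{(2\pi i)^2}y_2+\frac{H^3}{4\pi i}y_1-\frac{c_2\cdot H}{24}y_0,\quad -\frac{H^3}{(2\pi i)^3}y_3-\frac{c_2\cdot H}{48\pi i}y_1-\frac{c_3}{(2\pi i)^3}\zeta(3)\,y_0,$$ the monodromy matrices of $L$ around $z=0$ and around $z=1/C$ are $$\begin{pmatrix} 1 & 1 & 0 & 0 \\ 0 & 1 & 0 & 0 \\ d & d & 1 & 0 \\ 0 & -k & -1 & 1 \end{pmatrix}\quad\text{and}\quad\begin{pmatrix} 1 & 0 & 0 & 0 \\ 0 & 1 & 0 & 1 \\ 0 & 0 & 1 & 0 \\ 0 & 0 & 0 & 1\end{pmatrix},$$ respectively, where $d=H^3$ and $k=H^3/6+(c_2\cdot H)/12$. Moreover, these matrices are contained in the congruence subgroup $\Gamma(d_1,d_2)$ of $\mathrm{Sp}(4,\mathbb{Z})$.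
   Context: The 14 cases (the numbers $H^3$, $c_2\cdot H$, $c_3$ are the degree, second Chern number and Euler number of an associated Calabi-Yau threefold with Picard number one; here they are just the listed integers), each listed as $(A,B;\,C;\,H^3,\,c_2\cdot H,\,c_3;\ d_1,d_2)$: 1. $(1/5,2/5;\ 3125;\ 5,50,-200;\ 5,5)$ 2. $(1/10,3/10;\ 8\cdot 10^5;\ 1,34,-288;\ 1,1)$ 3. $(1/2,1/2;\ 256;\ 16,64,-128;\ 16,8)$ 4. $(1/3,1/3;\ 729;\ 9,54,-144;\ 9,3)$ 5. $(1/3,1/2;\ 432;\ 12,60,-144;\ 12,1)$ 6. $(1/4,1/2;\ 1024;\ 8,56,-176;\ 8,2)$ 7. $(1/8,3/8;\ 65536;\ 2,44,-296;\ 2,2)$ 8. $(1/6,1/3;\ 11664;\ 3,42,-204;\ 3,1)$ 9. $(1/12,5/12;\ 12^6;\ 1,46,-484;\ 1,1)$ 10. $(1/4,1/4;\ 4096;\ 4,40,-144;\ 4,4)$ 11. $(1/4,1/3;\ 1728;\ 6,48,-156;\ 6,1)$ 12. $(1/6,1/4;\ 27648;\ 2,32,-156;\ 2,1)$ 13. $(1/6,1/6;\ 2^8\cdot 3^6;\ 1,22,-120;\ 1,1)$ 14. $(1/6,1/2;\ 6912;\ 4,52,-256;\ 4,1)$ The singular points of $L$ are $0$, $1/C$ and $\infty$. Frobenius basis at $z=0$: the solutions of $Ly=0$ of the form $$y_0=1+\cdots,\quad y_1=y_0\log z+g_1,\quad y_2=\tfrac12 y_0\log^2 z+g_1\log z+g_2,\quad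 y_3=\tfrac16 y_0\log^3 z+\tfrac12 g_1\log^2 z+g_2\log z+g_3,$$ where $y_0$ is holomorphic at $0$ with $y_0(0)=1$ and $g_1,g_2,g_3$ are holomorphic at $z=0$ and vanish there. Monodromy convention: if analytic continuation of the solutions $f_1,\dots,f_n$ along a closed loop $\gamma$ turns $f_i$ into $\sum_j a_{ij}f_j$, then the matrix of the monodromy along $\gamma$ relative to the ordered basis $\{f_1,\dots,f_n\}$ is $(a_{ij})$. Here $\log z$ is the principal branch with cut $(-\infty,0]$, the base point lies in the open interval $(0,1/C)$, the loop around $0$ is a circle centered at $0$ traversed once counterclockwise, and the loop around $1/C$ is a simple loop contained in $\mathbb{C}\setminus(-\infty,0]$ encircling $1/C$ once counterclockwise. $\mathrm{Sp}(4,\mathbb{Z})$ is the group of integral $4\times4$ matrices $\gamma=\begin{pmatrix}P&Q\\R&S\end{pmatrix}$ (with $2\times 2$ blocks) with $\gamma^{-1}=\begin{pmatrix}S^t&-Q^t\\-R^t&P^t\end{pmatrix}$. For positive integers $d_2\mid d_1$, $$\Gamma(d_1,d_2)=\left\{\gamma\in\mathrm{Sp}(4,\mathbb{Z}):\gamma\equiv\begin{pmatrix} 1 & * & * & * \\ 0 & * & * & * \\ 0 & 0 & 1 & 0 \\ 0 & * & * & * \end{pmatrix}\bmod d_1\right\}\cap\left\{\gamma\in\mathrm{Sp}(4,\mathbb{Z}):\gamma\equiv\begin{pmatrix} 1 & * & * & * \\ 0 & 1 & * & * \\ 0 & 0 & 1 & 0 \\ 0 & 0 & * & 1 \end{pmatrix}\bmod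 d_2\right\},$$ where $*$ denotes an arbitrary entry. *)

theory Defs
  imports
    "HOL-Complex_Analysis.Complex_Analysis"
    "HOL-Number_Theory.Cong"
    "Jordan_Normal_Form.Matrix"
begin

text \<open>Rows are \<open>(A, B, C, H\<^sup>3, c\<^sub>2\<cdot>H, c\<^sub>3, d\<^sub>1, d\<^sub>2)\<close>.\<close>

definition cy_table :: "(real \<times> real \<times> int \<times> int \<times> int \<times> int \<times> int \<times> int) set" where
  "cy_table =
    {(1/5,  2/5,  3125,        5,  50, -200, 5,  5),
     (1/10, 3/10, 8 * 10^5,    1,  34, -288, 1,  1),
     (1/2,  1/2,  256,         16, 64, -128, 16, 8),
     (1/3,  1/3,  729,         9,  54, -144, 9,  3),
     (1/3,  1/2,  432,         12, 60, -144, 12, 1),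
     (1/4,  1/2,  1024,        8,  56, -176, 8,  2),
     (1/8,  3/8,  65536,       2,  44, -296, 2,  2),
     (1/6,  1/3,  11664,       3,  42, -204, 3,  1),
     (1/12, 5/12, 12^6,        1,  46, -484, 1,  1),
     (1/4,  1/4,  4096,        4,  40, -144, 4,  4),
     (1/4,  1/3,  1728,        6,  48, -156, 6,  1),
     (1/6,  1/4,  27648,       2,  32, -156, 2,  1),
     (1/6,  1/6,  2^8 * 3^6,   1,  22, -120, 1,  1),
     (1/6,  1/2,  6912,        4,  52, -256, 4,  1)}"

definition theta :: "(complex \<Rightarrow> complex) \<Rightarrow> complex \<Rightarrow> complex" where
  "theta f = (\<lambda>z. z * deriv f z)"

definition theta_plus :: "real \<Rightarrow> (complex \<Rightarrow> complex) \<Rightarrow> complex \<Rightarrow> complex" where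
  "theta_plus a f = (\<lambda>z. theta f z + complex_of_real a * f z)"

definition picard_fuchs ::
    "real \<Rightarrow> real \<Rightarrow> int \<Rightarrow> (complex \<Rightarrow> complex) \<Rightarrow> complex \<Rightarrow> complex" where
  "picard_fuchs A B C f = (\<lambda>z. (theta ^^ 4) f z
     - of_int C * z * theta_plus A (theta_plus (1 - A) (theta_plus B (theta_plus (1 - B) f))) z)"

text \<open>
  The Frobenius basis at \<open>0\<close>, on the disc of radius \<open>r\<close>. The functions are only constrained
  on the disc, and those involving the principal logarithm only off its cut.
\<close>

definition frobenius_basis ::
    "((complex \<Rightarrow> complex) \<Rightarrow> complex \<Rightarrow> complex) \<Rightarrow> real \<Rightarrow>
     (complex \<Rightarrow> complex) \<Rightarrow> (complex \<Rightarrow> complex) \<Rightarrow>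
     (complex \<Rightarrow> complex) \<Rightarrow> (complex \<Rightarrow> complex) \<Rightarrow> bool" where
  "frobenius_basis L r y0 y1 y2 y3 \<longleftrightarrow>
     (\<exists>g1 g2 g3.
        y0 holomorphic_on ball 0 r \<and> y0 0 = 1 \<and>
        (\<forall>g \<in> {g1, g2, g3}. g holomorphic_on ball 0 r \<and> g 0 = 0) \<and>
        (\<forall>z \<in> ball 0 r - \<real>\<^sub>\<le>\<^sub>0.
           y1 z = y0 z * Ln z + g1 z \<and>
           y2 z = y0 z * Ln z ^ 2 / 2 + g1 z * Ln z + g2 z \<and>
           y3 z = y0 z * Ln z ^ 3 / 6 + g1 z * Ln z ^ 2 / 2 + g2 z * Ln z + g3 z) \<and>
        (\<forall>y \<in> {y0, y1, y2, y3}. \<forall>z \<in> ball 0 r - \<real>\<^sub>\<le>\<^sub>0. L y z = 0))"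

text \<open>
  The germ of \<open>f\<close> at the start of \<open>\<gamma>\<close> continues analytically along \<open>\<gamma>\<close> to the germ of \<open>g\<close> at
  its end: there are germs \<open>F t\<close> at \<open>\<gamma> t\<close> such that \<open>F s\<close> is the restriction of \<open>F t\<close> for \<open>s\<close>
  near \<open>t\<close>.
\<close>

definition continues_along ::
    "(real \<Rightarrow> complex) \<Rightarrow> (complex \<Rightarrow> complex) \<Rightarrow> (complex \<Rightarrow> complex) \<Rightarrow> bool" where
  "continues_along \<gamma> f g \<longleftrightarrow> path \<gamma> \<and>
     (\<exists>F :: real \<Rightarrow> complex \<Rightarrow> complex.
        (\<forall>t \<in> {0..1}. F t analytic_on {\<gamma> t}) \<and>
        (\<forall>t \<in> {0..1}. \<forall>\<^sub>F s in at t within {0..1}. \<forall>\<^sub>F z in nhds (\<gamma> s). F s z = F t z) \<and>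
        (\<forall>\<^sub>F z in nhds (pathstart \<gamma>). F 0 z = f z) \<and>
        (\<forall>\<^sub>F z in nhds (pathfinish \<gamma>). F 1 z = g z))"

definition local_solution ::
    "((complex \<Rightarrow> complex) \<Rightarrow> complex \<Rightarrow> complex) \<Rightarrow> complex \<Rightarrow> (complex \<Rightarrow> complex) \<Rightarrow> bool" where
  "local_solution L b f \<longleftrightarrow> f analytic_on {b} \<and> (\<forall>\<^sub>F z in nhds b. L f z = 0)"

definition solution_basis ::
    "((complex \<Rightarrow> complex) \<Rightarrow> complex \<Rightarrow> complex) \<Rightarrow> complex \<Rightarrow>
     (complex \<Rightarrow> complex) list \<Rightarrow> bool" where
  "solution_basis L b fs \<longleftrightarrow>
     (\<forall>f \<in> set fs. local_solution L b f) \<and>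
     (\<forall>h. local_solution L b h \<longrightarrow>
        (\<exists>!c. c \<in> carrier_vec (length fs) \<and>
              (\<forall>\<^sub>F z in nhds b. h z = (\<Sum>j<length fs. vec_index c j * (fs ! j) z))))"

text \<open>
  Row \<open>i\<close> of the monodromy matrix holds the coefficients of the continuation of \<open>fs ! i\<close>.
\<close>

definition monodromy_matrix ::
    "((complex \<Rightarrow> complex) \<Rightarrow> complex \<Rightarrow> complex) \<Rightarrow> (real \<Rightarrow> complex) \<Rightarrow>
     (complex \<Rightarrow> complex) list \<Rightarrow> complex mat \<Rightarrow> bool" where
  "monodromy_matrix L \<gamma> fs M \<longleftrightarrow>
     pathfinish \<gamma> = pathstart \<gamma> \<and>
     solution_basis L (pathstart \<gamma>) fs \<and>
     M \<in> carrier_mat (length fs) (length fs) \<and>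
     (\<forall>i<length fs. continues_along \<gamma> (fs ! i)
        (\<lambda>z. \<Sum>j<length fs. M $$ (i, j) * (fs ! j) z))"

definition zeta3 :: real where
  "zeta3 = (\<Sum>n. 1 / real (Suc n) ^ 3)"

definition ordered_basis ::
    "int \<Rightarrow> int \<Rightarrow> int \<Rightarrow> (complex \<Rightarrow> complex) \<Rightarrow> (complex \<Rightarrow> complex) \<Rightarrow>
     (complex \<Rightarrow> complex) \<Rightarrow> (complex \<Rightarrow> complex) \<Rightarrow> (complex \<Rightarrow> complex) list" where
  "ordered_basis H3 c2H c3 y0 y1 y2 y3 =
    [\<lambda>z. y1 z / (2 * of_real pi * \<i>),
     y0,
     \<lambda>z. of_int H3 / (2 * of_real pi * \<i>)^2 * y2 z
        + of_int H3 / (4 * of_real pi * \<i>) * y1 z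
        - of_int c2H / 24 * y0 z,
     \<lambda>z. - of_int H3 / (2 * of_real pi * \<i>)^3 * y3 z
        - of_int c2H / (48 * of_real pi * \<i>) * y1 z
        - of_int c3 / (2 * of_real pi * \<i>)^3 * of_real zeta3 * y0 z]"

definition monodromy_zero :: "complex \<Rightarrow> complex \<Rightarrow> complex mat" where
  "monodromy_zero d k = mat_of_rows_list 4
     [[1,  1,  0, 0],
      [0,  1,  0, 0],
      [d,  d,  1, 0],
      [0, -k, -1, 1]]"

definition monodromy_conifold :: "complex mat" where
  "monodromy_conifold = mat_of_rows_list 4
     [[1, 0, 0, 0],
      [0, 1, 0, 1],
      [0, 0, 1, 0],
      [0, 0, 0, 1]]"

definition Sp4Z :: "int mat set" where
  "Sp4Z = {four_block_mat P Q R S | P Q R S.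
     P \<in> carrier_mat 2 2 \<and> Q \<in> carrier_mat 2 2 \<and> R \<in> carrier_mat 2 2 \<and> S \<in> carrier_mat 2 2 \<and>
     inverts_mat (four_block_mat P Q R S)
       (four_block_mat (transpose_mat S) (- transpose_mat Q) (- transpose_mat R) (transpose_mat P)) \<and>
     inverts_mat
       (four_block_mat (transpose_mat S) (- transpose_mat Q) (- transpose_mat R) (transpose_mat P))
       (four_block_mat P Q R S)}"

text \<open>In a pattern, \<open>None\<close> stands for an arbitrary entry.\<close>

definition cong_pattern :: "int option list list \<Rightarrow> int \<Rightarrow> int mat \<Rightarrow> bool" where
  "cong_pattern p m M \<longleftrightarrow>
     (\<forall>i<4. \<forall>j<4. case p ! i ! j of None \<Rightarrow> True | Some a \<Rightarrow> [M $$ (i, j) = a] (mod m))"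

definition Gamma_group :: "int \<Rightarrow> int \<Rightarrow> int mat set" where
  "Gamma_group d1 d2 =
     {M \<in> Sp4Z. cong_pattern
        [[Some 1, None,   None,   None],
         [Some 0, None,   None,   None],
         [Some 0, Some 0, Some 1, Some 0],
         [Some 0, None,   None,   None]] d1 M}
     \<inter>
     {M \<in> Sp4Z. cong_pattern
        [[Some 1, None,   None,   None],
         [Some 0, Some 1, None,   None],
         [Some 0, Some 0, Some 1, Some 0],
         [Some 0, Some 0, None,   Some 1]] d2 M}"

end

theory Submission
  imports Defs "HOL-Probability.Sinc_Integral"
begin

text \<open>
  Write \<open>x = C z\<close> and let \<open>R(s)\<close> be the Gamma quotient that interpolates the coefficients of \<open>y\<^sub>0\<close> as a
  power series in \<open>x\<close>. For a trigonometric kernel \<open>T\<close> of period \<open>1\<close> whose pole at \<open>0\<close> has order at most \<open>4\<close>,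
  the Mellin--Barnes integral of \<open>R(s) T(s) x\<^sup>s\<close> over \<open>Re s = -1/24\<close> solves \<open>L y = 0\<close>, because
  shifting the contour by \<open>1\<close> turns the recurrence of \<open>R\<close> into the differential equation. Shifting it
  across \<open>s = 0\<close> gives the behaviour at \<open>z = 0\<close>, so the Taylor coefficients of
  \<open>s\<^sup>4 T(s) R(s) C\<^sup>s\<close> at \<open>0\<close> express the integral in the Frobenius basis; this is where \<open>c\<^sub>2\<cdot>H\<close> and
  \<open>c\<^sub>3 \<zeta>(3)\<close> come from.

  Three of the four basis functions are such integrals with kernels \<open>1/sin\<^sup>2\<close>, \<open>e\<^sup>i\<^sup>\<pi>\<^sup>s/sin\<^sup>3\<close> and a combination of
  \<open>1/sin\<^sup>4\<close> and \<open>1/sin\<^sup>2\<close> (at \<open>\<pi>s\<close>), which converge for \<open>|arg x| < \<pi>\<close>: they have no monodromy around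
  \<open>1/C\<close>. The kernels \<open>e\<^sup>\<mp>\<^sup>i\<^sup>\<pi>\<^sup>s/sin\<close> continue \<open>y\<^sub>0\<close> to the upper and the lower half plane; for \<open>x > 1\<close>
  the two continuations differ by a multiple of the integral of \<open>R(s) x\<^sup>s\<close>. Closing that contour to the
  left, after multiplying \<open>R\<close> by the periodic function that vanishes at all its poles, identifies the
  jump with the fourth basis function \<open>W\<close>. Hence \<open>y\<^sub>0 - W log(1 - x) / 2\<pi>i\<close> is holomorphic off
  \<open>(-\<infinity>, 0]\<close>.
\<close>

section \<open>Gamma quotients\<close>

text \<open>The Frobenius functions are given only on a disc, while a loop around 1/C has to leave
  it; so each basis function needs a second, global description. The two can be matched because a
  solution on the upper half disc is determined by its logarithmic asymptotics at 0 up to o(1), and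
  these come from a single residue. The obstacle is \<open>y0\<close>. The strips of convergence of
  its two kernels end at arg x = 0, exactly where the two continuations must be compared and where
  no exponential decay is left. Convergence there rests on R(s) = O(1/|s|^2), obtained from infinite
  products with bounds uniform on half planes. The periodic function that removes the poles of R is
  the product of 1 - sin^2(pi a)/sin^2(pi s) over a = A, B. Expanded, it consists of 1, 1/sin^2 and
  1/sin^4 only, and its coefficients are the rational numbers H^3/16 and (c2.H + 2 H^3)/48 up to
  sign; this is how the jump becomes an integral basis function. At 1/C itself only continuity is
  available, and it holds because W vanishes there.\<close>

lemma norm_prod_one_plus_le:
  fixes x :: "nat \<Rightarrow> complex"
  shows "norm (\<Prod>k\<in>S. 1 + x k) \<le> exp (\<Sum>k\<in>S. norm (x k))"
proof -
  have "norm (\<Prod>k\<in>S. 1 + x k) = (\<Prod>k\<in>S. norm (1 + x k))"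
    by (simp add: prod_norm)
  also have "\<dots> \<le> (\<Prod>k\<in>S. exp (norm (x k)))"
  proof (rule prod_mono)
    fix k
    have "norm (1 + x k) \<le> 1 + norm (x k)"
      using norm_triangle_ineq[of 1 "x k"] by simp
    also have "\<dots> \<le> exp (norm (x k))" by simp
    finally show "0 \<le> norm (1 + x k) \<and> norm (1 + x k) \<le> exp (norm (x k))" by simp
  qed
  also have "\<dots> \<le> exp (\<Sum>k\<in>S. norm (x k))"
    by (cases "finite S") (simp_all add: exp_sum)
  finally show ?thesis .
qed

text \<open>Factors 1 + O(1/(delta + k)^2) give partial products dominated by the exponential of a
  convergent trigamma series. The bound involves only \<open>\<delta>\<close> and \<open>c\<close>,
  so it is uniform over all products obeying the same estimate.\<close>

lemma norm_limit_prod_le: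
  fixes f :: "nat \<Rightarrow> complex" and \<delta> c :: real
  assumes lim: "(\<lambda>n. \<Prod>k\<le>n. f k) \<longlonglongrightarrow> l" and \<delta>: "\<delta> > 0" and c: "c \<ge> 0"
    and f: "\<And>k. norm (f k - 1) \<le> c / (\<delta> + real k) ^ 2"
  shows "norm l \<le> exp (c * (\<Sum>k. inverse ((\<delta> + real k) ^ 2)))"
proof -
  have sm: "summable (\<lambda>k. inverse ((\<delta> + real k) ^ 2))"
    using Polygamma_converges'[of \<delta> 2] \<delta> by simp
  have "norm (\<Prod>k\<le>n. f k) \<le> exp (c * (\<Sum>k. inverse ((\<delta> + real k) ^ 2)))" for n
  proof -
    have "norm (\<Prod>k\<le>n. f k) \<le> exp (\<Sum>k\<le>n. norm (f k - 1))"
      using norm_prod_one_plus_le[of "\<lambda>k. f k - 1" "{..n}"] by simp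
    also have "(\<Sum>k\<le>n. norm (f k - 1)) \<le> (\<Sum>k\<le>n. c * inverse ((\<delta> + real k) ^ 2))"
      using f by (intro sum_mono) (simp add: field_simps)
    also have "\<dots> = c * (\<Sum>k\<le>n. inverse ((\<delta> + real k) ^ 2))" by (simp add: sum_distrib_left)
    also have "\<dots> \<le> c * (\<Sum>k. inverse ((\<delta> + real k) ^ 2))"
      by (intro mult_left_mono sum_le_suminf sm c) (use \<delta> in auto)
    finally show ?thesis by simp
  qed
  then show ?thesis using lim by (intro tendsto_upperbound[OF tendsto_norm[OF lim]]) auto
qed

text \<open>The arguments of the two Gamma factors and of the two reciprocal ones have the same sum
  2s + 1. Hence the powers of n in the Gauss product formulas cancel, and the quotient is an
  infinite product that can be estimated factor by factor; no Stirling formula enters.\<close>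

definition gamma_quot :: "real \<Rightarrow> complex \<Rightarrow> complex" where
  "gamma_quot a s = Gamma (s + a) * Gamma (s + 1 - a) * rGamma s * rGamma (s + 1)"

lemma gamma_quot_LIMSEQ:
  "(\<lambda>n. \<Prod>k\<le>n. (s + of_nat k) * (s + 1 + of_nat k) / ((s + a + of_nat k) * (s + 1 - a + of_nat k)))
     \<longlonglongrightarrow> gamma_quot a s"
proof -
  let ?f = "\<lambda>n. Gamma_series (s + a) n * Gamma_series (s + 1 - a) n
      * rGamma_series s n * rGamma_series (s + 1) n"
  have lim: "?f \<longlonglongrightarrow> gamma_quot a s"
    unfolding gamma_quot_def by (intro tendsto_intros)
  have eq: "?f n = (\<Prod>k\<le>n. (s + of_nat k) * (s + 1 + of_nat k) / ((s + a + of_nat k) * (s + 1 - a + of_nat k)))"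
    for n
  proof -
    define l :: complex where "l = of_real (ln (of_nat n))"
    have ph: "pochhammer z (n+1) = (\<Prod>k\<le>n. z + of_nat k)" for z :: complex
      by (simp add: pochhammer_Suc_prod atLeast0AtMost)
    have ex: "exp ((s + a) * l) * exp ((s + 1 - a) * l) = exp (s * l) * exp ((s+1) * l)"
      by (simp flip: exp_add add: algebra_simps)
    have "?f n = (fact n * exp ((s + a) * l) / pochhammer (s + a) (n+1))
       * (fact n * exp ((s + 1 - a) * l) / pochhammer (s + 1 - a) (n+1))
       * (pochhammer s (n+1) / (fact n * exp (s * l)))
       * (pochhammer (s+1) (n+1) / (fact n * exp ((s+1) * l)))"
      by (simp add: Gamma_series_def rGamma_series_def l_def)
    also have "\<dots> = (exp ((s + a) * l) * exp ((s + 1 - a) * l)) / (exp (s * l) * exp ((s+1) * l)) *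
        (pochhammer s (n+1) * pochhammer (s+1) (n+1) / (pochhammer (s + a) (n+1) * pochhammer (s + 1 - a) (n+1)))"
      by (simp add: divide_simps)
    also have "\<dots> = pochhammer s (n+1) * pochhammer (s+1) (n+1) / (pochhammer (s + a) (n+1) * pochhammer (s + 1 - a) (n+1))"
      by (simp add: ex)
    also have "\<dots> = (\<Prod>k\<le>n. (s + of_nat k) * (s + 1 + of_nat k) / ((s + a + of_nat k) * (s + 1 - a + of_nat k)))"
      unfolding ph by (simp add: prod.distrib prod_dividef)
    finally show ?thesis .
  qed
  show ?thesis using lim unfolding eq .
qed

lemma norm_mult_ge_power2:
  fixes x y :: complex and \<delta> :: real
  assumes "0 < \<delta>" "\<delta> \<le> Re x" "\<delta> \<le> Re y"
  shows "\<delta> ^ 2 \<le> norm (x * y)"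
proof -
  have "\<delta> \<le> norm x" "\<delta> \<le> norm y"
    using assms complex_Re_le_cmod[of x] complex_Re_le_cmod[of y] by auto
  then have "\<delta> * \<delta> \<le> norm x * norm y" using assms by (intro mult_mono) auto
  then show ?thesis by (simp add: norm_mult power2_eq_square)
qed

text \<open>Numerator and denominator of the k-th factor differ by the constant a(1 - a). Each
  factor is therefore 1 - a(1 - a)/p with |p| at least (delta + k)^2, uniformly on the half
  plane.\<close>

lemma gamma_quot_bound:
  assumes a: "\<sigma> < a" "\<sigma> < 1 - a" "0 < a" "a < 1"
  shows "\<exists>K. \<forall>s. Re s \<ge> - \<sigma> \<longrightarrow> norm (gamma_quot a s) \<le> K"
proof -
  define \<delta> where "\<delta> = min a (1 - a) - \<sigma>"
  have \<delta>: "\<delta> > 0" using a by (simp add: \<delta>_def)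
  have "norm (gamma_quot a s) \<le> exp (\<bar>a * (1 - a)\<bar> * (\<Sum>k. inverse ((\<delta> + real k) ^ 2)))"
    if s: "Re s \<ge> - \<sigma>" for s
  proof (rule norm_limit_prod_le[OF gamma_quot_LIMSEQ \<delta>])
    fix k :: nat
    define p where "p = (s + a + of_nat k) * (s + 1 - a + of_nat k)"
    have p: "(\<delta> + real k) ^ 2 \<le> norm p" unfolding p_def
      by (rule norm_mult_ge_power2) (use \<delta> s in \<open>auto simp: \<delta>_def\<close>)
    have "0 < (\<delta> + real k) ^ 2" using \<delta> by simp
    with p have p0: "p \<noteq> 0" by auto
    have "(s + of_nat k) * (s + 1 + of_nat k) / p - 1 = - of_real (a * (1 - a)) / p"
      using p0 by (simp add: divide_simps) (simp add: p_def algebra_simps)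
    then have "norm ((s + of_nat k) * (s + 1 + of_nat k) / p - 1) = \<bar>a * (1 - a)\<bar> / norm p"
      by (simp add: norm_divide norm_mult del: of_real_mult of_real_diff) 
    also have "\<dots> \<le> \<bar>a * (1 - a)\<bar> / (\<delta> + real k) ^ 2"
      using p \<delta> by (intro divide_left_mono mult_pos_pos) (auto intro!: zero_less_power add_pos_nonneg p0)
    finally show "norm ((s + of_nat k) * (s + 1 + of_nat k) / ((s + a + of_nat k) * (s + 1 - a + of_nat k)) - 1)
        \<le> \<bar>a * (1 - a)\<bar> / (\<delta> + real k) ^ 2" unfolding p_def .
  qed auto
  then show ?thesis by blast
qed

lemma nonpos_Int_Re: "z \<in> \<int>\<^sub>\<le>\<^sub>0 \<Longrightarrow> Re z \<le> 0"
  by (auto elim!: nonpos_Ints_cases)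

text \<open>The reciprocal product has factors 1 + a(1 - a)/p with p = (s + k)(s + 1 + k), so the
  same estimate applies once Re s stays away from 0. It controls the reflected function in the left
  half plane.\<close>

lemma gamma_quot_inverse_bound:
  assumes a: "0 < a" "a < 1" "0 < \<sigma>"
  shows "\<exists>K. \<forall>s. Re s \<ge> \<sigma> \<longrightarrow> norm (inverse (gamma_quot a s)) \<le> K"
proof -
  have "norm (inverse (gamma_quot a s)) \<le> exp (\<bar>a * (1 - a)\<bar> * (\<Sum>k. inverse ((\<sigma> + real k) ^ 2)))"
    if s: "Re s \<ge> \<sigma>" for s
  proof (rule norm_limit_prod_le[OF _ a(3)])
    let ?f = "\<lambda>k. (s + of_nat k) * (s + 1 + of_nat k) / ((s + a + of_nat k) * (s + 1 - a + of_nat k))"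
    have "Re z > 0 \<Longrightarrow> Gamma z \<noteq> 0 \<and> rGamma z \<noteq> 0" for z :: complex
      using nonpos_Int_Re[of z] by (auto simp: Gamma_eq_zero_iff rGamma_inverse_Gamma)
    then have "gamma_quot a s \<noteq> 0"
      using s a by (auto simp: gamma_quot_def)
    then have "(\<lambda>n. inverse (\<Prod>k\<le>n. ?f k)) \<longlonglongrightarrow> inverse (gamma_quot a s)"
      by (intro tendsto_inverse gamma_quot_LIMSEQ)
    then show "(\<lambda>n. \<Prod>k\<le>n. inverse (?f k)) \<longlonglongrightarrow> inverse (gamma_quot a s)"
      by (simp only: prod_inversef[unfolded o_def])
  next
    fix k :: nat
    define p where "p = (s + of_nat k) * (s + 1 + of_nat k)"
    have p: "(\<sigma> + real k) ^ 2 \<le> norm p" unfolding p_def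
      by (rule norm_mult_ge_power2) (use s a in auto)
    have "0 < (\<sigma> + real k) ^ 2" using a by simp
    with p have p0: "p \<noteq> 0" by auto
    have "inverse (p / ((s + a + of_nat k) * (s + 1 - a + of_nat k))) - 1 = of_real (a * (1 - a)) / p"
      using p0 by (simp add: divide_simps) (simp add: p_def algebra_simps)
    then have "norm (inverse (p / ((s + a + of_nat k) * (s + 1 - a + of_nat k))) - 1) = \<bar>a * (1 - a)\<bar> / norm p"
      by (simp add: norm_divide norm_mult del: of_real_mult of_real_diff)
    also have "\<dots> \<le> \<bar>a * (1 - a)\<bar> / (\<sigma> + real k) ^ 2"
      using p a by (intro divide_left_mono mult_pos_pos) (auto intro!: zero_less_power add_pos_nonneg p0)
    finally show "norm (inverse ((s + of_nat k) * (s + 1 + of_nat k) / ((s + a + of_nat k) * (s + 1 - a + of_nat k))) - 1)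
        \<le> \<bar>a * (1 - a)\<bar> / (\<sigma> + real k) ^ 2" unfolding p_def .
  qed auto
  then show ?thesis by blast
qed

text \<open>At s = n this is (a)_n (1 - a)_n / n!^2: the prefactor equals 1/(Gamma(a) Gamma(1 -
  a)).\<close>

definition hyp_pair :: "real \<Rightarrow> complex \<Rightarrow> complex" where
  "hyp_pair a s = of_real (sin (pi * a) / pi) * (Gamma (s + a) * Gamma (s + 1 - a) * rGamma (s + 1) ^ 2)"

text \<open>This is \<open>hyp_pair a s\<close> times 1 - sin^2(pi a)/sin^2(pi s), with every Gamma
  factor reflected. In this form it is visibly holomorphic for Re s < 0: the extra factor removes
  the poles of \<open>hyp_pair\<close>.\<close>

definition hyp_pair_left :: "real \<Rightarrow> complex \<Rightarrow> complex" where
  "hyp_pair_left a s = - of_real (sin (pi * a) / pi) * (Gamma (- s) ^ 2 * rGamma (1 - s - a) * rGamma (a - s))"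

text \<open>The factor s turns one \<open>rGamma (s + 1)\<close> into \<open>rGamma s\<close>. Since
  \<open>gamma_quot\<close> is bounded, each pair decays like 1/s.\<close>

lemma hyp_pair_mult: "s * hyp_pair a s = of_real (sin (pi * a) / pi) * gamma_quot a s"
  using rGamma_plus1[of s] by (simp add: hyp_pair_def gamma_quot_def power2_eq_square)

lemma hyp_pair_bound:
  assumes "\<sigma> < a" "\<sigma> < 1 - a" "0 < a" "a < 1"
  shows "\<exists>K. \<forall>s. Re s \<ge> - \<sigma> \<longrightarrow> norm (s * hyp_pair a s) \<le> K"
proof -
  obtain K where "\<forall>s. Re s \<ge> - \<sigma> \<longrightarrow> norm (gamma_quot a s) \<le> K"
    using gamma_quot_bound[OF assms] by blast
  then have "norm (s * hyp_pair a s) \<le> norm (complex_of_real (sin (pi * a) / pi)) * K" if "Re s \<ge> - \<sigma>" for s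
    using that unfolding hyp_pair_mult norm_mult by (intro mult_left_mono) auto
  then show ?thesis by blast
qed

text \<open>Under s -> -s the reflected factors become the reciprocal of \<open>gamma_quot\<close>,
  so bounds for that reciprocal on the right carry over to the left.\<close>

lemma hyp_pair_left_mult:
  assumes "Re s < 0"
  shows "s * hyp_pair_left a s = of_real (sin (pi * a) / pi) * inverse (gamma_quot a (- s))"
proof -
  have g: "Gamma (1 - s) = - s * Gamma (- s)"
    using Gamma_plus1[of "-s"] nonpos_Int_Re[of "-s"] assms by (auto simp: add.commute)
  show ?thesis
    by (simp add: hyp_pair_left_def gamma_quot_def rGamma_inverse_Gamma g power2_eq_square algebra_simps)
qed

lemma hyp_pair_left_bound:
  assumes "0 < a" "a < 1" "0 < \<sigma>"
  shows "\<exists>K. \<forall>s. Re s \<le> - \<sigma> \<longrightarrow> norm (s * hyp_pair_left a s) \<le> K"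
proof -
  obtain K where *: "\<forall>s. Re s \<ge> \<sigma> \<longrightarrow> norm (inverse (gamma_quot a s)) \<le> K"
    using gamma_quot_inverse_bound[OF assms] by blast
  then have "norm (s * hyp_pair_left a s) \<le> norm (complex_of_real (sin (pi * a) / pi)) * K" if "Re s \<le> - \<sigma>" for s
  proof -
    have "s * hyp_pair_left a s = of_real (sin (pi * a) / pi) * inverse (gamma_quot a (- s))"
      by (rule hyp_pair_left_mult) (use that assms in auto)
    moreover have "norm (inverse (gamma_quot a (- s))) \<le> K" using * that by simp
    ultimately show ?thesis unfolding norm_mult[symmetric]
      by (metis norm_ge_zero norm_mult mult_left_mono)
  qed
  then show ?thesis by blast
qed

lemma holomorphic_hyp_pair:
  assumes "0 < a" "a < 1" "\<sigma> \<le> a" "\<sigma> \<le> 1 - a"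
  shows "hyp_pair a holomorphic_on {s. Re s > - \<sigma>}"
proof -
  have "Re z > 0 \<Longrightarrow> z \<notin> \<int>\<^sub>\<le>\<^sub>0" for z :: complex
    using nonpos_Int_Re[of z] by auto
  then show ?thesis
    unfolding hyp_pair_def using assms by (intro holomorphic_intros) auto
qed

lemma holomorphic_hyp_pair_left: "hyp_pair_left a holomorphic_on {s. Re s < 0}"
proof -
  have "Re z > 0 \<Longrightarrow> z \<notin> \<int>\<^sub>\<le>\<^sub>0" for z :: complex
    using nonpos_Int_Re[of z] by auto
  then show ?thesis
    unfolding hyp_pair_left_def by (intro holomorphic_intros) auto
qed

lemma hyp_pair_0:
  assumes "0 < a" "a < 1"
  shows "hyp_pair a 0 = 1"
proof -
  have "sin (pi * a) > 0" using assms by (intro sin_gt_zero) auto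
  moreover have "Gamma (of_real a) * Gamma (1 - of_real a) = complex_of_real pi / sin (complex_of_real pi * a)"
    by (rule Gamma_reflection_complex)
  then have "Gamma (of_real a) * Gamma (1 - of_real a) = complex_of_real (pi / sin (pi * a))"
    by (metis of_real_divide of_real_mult sin_of_real)
  ultimately show ?thesis by (simp add: hyp_pair_def)
qed

lemma hyp_pair_plus1:
  assumes "Re s > - a" "Re s > - (1 - a)"
  shows "(s + 1) ^ 2 * hyp_pair a (s + 1) = (s + a) * (s + 1 - a) * hyp_pair a s"
proof -
  have g1: "Gamma (s + 1 + a) = (s + a) * Gamma (s + a)"
    using nonpos_Int_Re[of "s + a"] assms Gamma_plus1[of "s + a"] by (auto simp: add_ac)
  have g2: "Gamma (s + 1 + 1 - a) = (s + 1 - a) * Gamma (s + 1 - a)"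
    using nonpos_Int_Re[of "s + 1 - a"] assms Gamma_plus1[of "s + 1 - a"] by (auto simp: algebra_simps)
  have "(s + 1) ^ 2 * hyp_pair a (s + 1) = of_real (sin (pi * a) / pi)
      * (((s + a) * Gamma (s + a)) * ((s + 1 - a) * Gamma (s + 1 - a)) * ((s + 1) * rGamma (s + 1 + 1)) ^ 2)"
    unfolding hyp_pair_def g1 g2 power_mult_distrib by (simp only: mult_ac)
  also have "(s + 1) * rGamma (s + 1 + 1) = rGamma (s + 1)" by (rule rGamma_plus1)
  finally show ?thesis unfolding hyp_pair_def by (simp only: mult_ac)
qed

lemma sin_plus_pi_complex: "sin (z + of_real pi) = - sin (z :: complex)"
  by (simp add: sin_add sin_of_real cos_of_real)

lemma sin_add_mult_sin_diff:
  fixes x y :: complex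
  shows "sin (x + y) * sin (x - y) = sin x ^ 2 - sin y ^ 2"
proof -
  have "sin (x + y) * sin (x - y) = sin x ^ 2 * cos y ^ 2 - cos x ^ 2 * sin y ^ 2"
    by (simp add: sin_add sin_diff algebra_simps power2_eq_square)
  then show ?thesis by (simp add: cos_squared_eq algebra_simps)
qed

text \<open>Each Gamma factor is exchanged for its reflection partner. The sines collected on the
  way are sin pi(s + a) sin pi(s - a) in the numerator and sin^2(pi s) in the denominator.\<close>

lemma hyp_pair_left_eq:
  assumes "sin (of_real pi * s) \<noteq> 0" "Re s > - a" "Re s > - (1 - a)"
  shows "hyp_pair_left a s * sin (of_real pi * s) ^ 2
       = hyp_pair a s * (sin (of_real pi * s) ^ 2 - of_real (sin (pi * a) ^ 2))"
proof -
  define S where "S = sin (of_real pi * s)"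
  define S1 where "S1 = sin (of_real pi * (s + a))"
  define S2 where "S2 = sin (of_real pi * (s - a))"
  have S12: "S1 * S2 = S ^ 2 - of_real (sin (pi * a) ^ 2)"
    using sin_add_mult_sin_diff[of "of_real pi * s" "of_real (pi * a)"]
    by (simp add: S1_def S2_def S_def algebra_simps sin_of_real flip: of_real_mult)
  have r1: "rGamma (s + a) * rGamma (1 - s - a) = S1 / of_real pi"
    using rGamma_reflection_complex[of "s + a"] by (simp add: S1_def algebra_simps)
  have "of_real pi * (s + 1 - a) = of_real pi * (s - a) + of_real pi" by (simp add: algebra_simps)
  then have "sin (of_real pi * (s + 1 - a)) = - S2" unfolding S2_def by (simp add: sin_plus_pi_complex)
  then have r2: "rGamma (s + 1 - a) * rGamma (a - s) = - S2 / of_real pi"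
    using rGamma_reflection_complex[of "s + 1 - a"] by simp
  have "of_real pi * (s + 1) = of_real pi * s + of_real pi" by (simp add: algebra_simps)
  then have "sin (of_real pi * (s + 1)) = - S" unfolding S_def by (simp add: sin_plus_pi_complex)
  then have r3: "Gamma (s + 1) * Gamma (- s) = - of_real pi / S"
    using Gamma_reflection_complex[of "s + 1"] by simp
  have "rGamma (s + a) \<noteq> 0" "rGamma (s + 1 - a) \<noteq> 0"
    using nonpos_Int_Re[of "s + a"] nonpos_Int_Re[of "s + 1 - a"] assms(2,3)
    by (auto simp: rGamma_inverse_Gamma Gamma_eq_zero_iff)
  then have g1: "rGamma (1 - s - a) = S1 / of_real pi * Gamma (s + a)"
    and g2: "rGamma (a - s) = - S2 / of_real pi * Gamma (s + 1 - a)"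
    using r1 r2 by (simp_all add: Gamma_def field_simps)
  have g3: "Gamma (- s) * S = - of_real pi * rGamma (s + 1)"
  proof -
    have "Gamma (s + 1) \<noteq> 0" using r3 assms by (auto simp: S_def)
    then show ?thesis using r3 assms by (simp add: rGamma_inverse_Gamma field_simps S_def)
  qed
  have "hyp_pair_left a s * S ^ 2 = - of_real (sin (pi * a) / pi) * ((Gamma (- s) * S) ^ 2 * rGamma (1 - s - a) * rGamma (a - s))"
    by (simp add: hyp_pair_left_def power_mult_distrib)
  also have "\<dots> = of_real (sin (pi * a) / pi) * rGamma (s + 1) ^ 2 * Gamma (s + a) * Gamma (s + 1 - a) * (S1 * S2)"
    unfolding g3 g1 g2 by (simp add: field_simps power2_eq_square)
  finally show ?thesis by (simp add: hyp_pair_def S12 S_def)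
qed

section \<open>Mellin--Barnes integrals\<close>

lemma integrable_inverse_one_plus_square: "integrable lborel (\<lambda>t::real. 1 / (1 + t ^ 2))"
proof -
  have 1: "set_integrable lborel {0<..} (\<lambda>t::real. 1 / (1 + t ^ 2))"
    using integrable_I0i_1_div_plus_square
    by (simp add: interval_lebesgue_integrable_def zero_ereal_def)
  then have 2: "set_integrable lborel {..<0} (\<lambda>t::real. 1 / (1 + t ^ 2))"
    unfolding set_integrable_def
    by (subst (asm) lborel_integrable_real_affine_iff[symmetric, of "-1" _ 0])
       (auto simp: indicator_def cong: if_cong)
  have "set_integrable lborel ({..<0} \<union> {0<..}) (\<lambda>t::real. 1 / (1 + t ^ 2))"
    by (intro set_integrable_Un 1 2) auto
  then have "integrable lborel (\<lambda>t::real. indicator ({..<0} \<union> {0<..}) t *\<^sub>R (1 / (1 + t ^ 2)))"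
    by (simp add: set_integrable_def)
  then show ?thesis
  proof (subst (asm) integrable_cong_AE)
    show "AE t in lborel. indicator ({..<0} \<union> {0<..}) t *\<^sub>R (1 / (1 + t ^ 2)) = 1 / (1 + (t::real) ^ 2)"
      using AE_lborel_singleton[of "0::real"] by eventually_elim (auto simp: indicator_def)
  qed auto
qed

lemma norm_le_quadratic_decay_extend:
  fixes g :: "real \<Rightarrow> complex"
  assumes "continuous_on UNIV g" "\<And>t. \<bar>t\<bar> \<ge> 1 \<Longrightarrow> norm (g t) \<le> K / (1 + t ^ 2)"
  shows "\<exists>K'. \<forall>t. norm (g t) \<le> K' / (1 + t ^ 2)"
proof -
  have "compact (g ` {-1..1})"
    by (intro compact_continuous_image continuous_on_subset[OF assms(1)]) auto
  then obtain B where B: "\<And>t. t \<in> {-1..1} \<Longrightarrow> norm (g t) \<le> B"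
    using compact_imp_bounded bounded_iff by (metis imageI)
  have B0: "0 \<le> B" using order_trans[OF norm_ge_zero B[of 0]] by simp
  \<comment> \<open>The term \<open>2 * B\<close> covers the middle segment, where 1 + t^2 is at
    most 2.\<close>
  have "norm (g t) \<le> (\<bar>K\<bar> + 2 * B) / (1 + t ^ 2)" for t
  proof (cases "\<bar>t\<bar> \<ge> 1")
    case True
    have "norm (g t) \<le> K / (1 + t ^ 2)" using assms(2) True by simp
    also have "\<dots> \<le> (\<bar>K\<bar> + 2 * B) / (1 + t ^ 2)" using B0 by (intro divide_right_mono) auto
    finally show ?thesis .
  next
    case False
    then have "t ^ 2 \<le> 1" by (simp add: abs_square_le_1)
    then have "B * (1 + t ^ 2) \<le> B * 2" using B0 by (intro mult_left_mono) auto
    then have "B \<le> (\<bar>K\<bar> + 2 * B) / (1 + t ^ 2)" by (simp add: field_simps add_pos_nonneg)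
    moreover have "norm (g t) \<le> B" using B[of t] False by (auto simp: abs_if split: if_splits)
    ultimately show ?thesis by linarith
  qed
  then show ?thesis by blast
qed

lemma integrable_quadratic_decay:
  fixes g :: "real \<Rightarrow> complex"
  assumes "continuous_on UNIV g" "\<And>t. norm (g t) \<le> K / (1 + t ^ 2)"
  shows "integrable lborel g"
proof (rule Bochner_Integration.integrable_bound)
  show "integrable lborel (\<lambda>t::real. K * (1 / (1 + t ^ 2)))"
    by (intro integrable_mult_right integrable_inverse_one_plus_square)
  show "g \<in> borel_measurable lborel"
    using borel_measurable_continuous_onI[OF assms(1)] by simp
  have "norm (g t) \<le> norm (K * (1 / (1 + t ^ 2)))" for t
    using assms(2)[of t] by (rule order_trans) (simp add: divide_right_mono)
  then show "AE t in lborel. norm (g t) \<le> norm (K * (1 / (1 + t ^ 2)))" by simp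
qed

text \<open>The upward integral over Re s = c in the real parameter t, without the factor i of ds =
  i dt. Residues therefore enter with the factor -2 pi instead of -2 pi i when a line is moved to
  the right.\<close>

definition line_int :: "real \<Rightarrow> (complex \<Rightarrow> complex) \<Rightarrow> complex" where
  "line_int c f = (LINT t|lborel. f (Complex c t))"

lemma continuous_on_Complex_line:
  assumes "continuous_on S f" "\<And>t. Complex c t \<in> S"
  shows "continuous_on UNIV (\<lambda>t. f (Complex c t))"
proof -
  have "continuous_on UNIV (\<lambda>t. of_real c + \<i> * of_real t)" by (intro continuous_intros)
  then have "continuous_on UNIV (Complex c)" by (simp add: Complex_eq)
  then show ?thesis
    using continuous_on_compose2[OF assms(1), of UNIV "Complex c"] assms(2) by auto
qed

text \<open>Truncations converge by dominated convergence. This ties the Lebesgue integral over the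
  line to the contour integrals for which the residue theorem is stated.\<close>

lemma tendsto_line_int:
  assumes "continuous_on UNIV (\<lambda>t. f (Complex c t))" "\<And>t. norm (f (Complex c t)) \<le> K / (1 + t ^ 2)"
  shows "((\<lambda>N. contour_integral (linepath (Complex c (- N)) (Complex c N)) f)
     \<longlongrightarrow> \<i> * line_int c f) at_top"
proof -
  let ?g = "\<lambda>t. f (Complex c t)"
  have int: "integrable lborel ?g" by (rule integrable_quadratic_decay) fact+
  have meas: "?g \<in> borel_measurable lborel" using int by auto
  have lim: "((\<lambda>N. LINT t|lborel. indicator {-N..N} t *\<^sub>R ?g t) \<longlongrightarrow> (LINT t|lborel. ?g t)) at_top"
  proof (rule integral_dominated_convergence_at_top[where w = "\<lambda>t. norm (?g t)"])
    show "AE t in lborel. ((\<lambda>N. indicator {-N..N} t *\<^sub>R ?g t) \<longlongrightarrow> ?g t) at_top"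
    proof (rule AE_I2)
      fix t :: real
      have "\<forall>\<^sub>F N in at_top. indicator {-N..N} t *\<^sub>R ?g t = ?g t"
        using eventually_ge_at_top[of "\<bar>t\<bar>"] by eventually_elim (auto simp: indicator_def)
      then show "((\<lambda>N. indicator {-N..N} t *\<^sub>R ?g t) \<longlongrightarrow> ?g t) at_top"
        by (simp add: tendsto_eventually)
    qed
  qed (use meas int in \<open>auto simp: indicator_def intro!: borel_measurable_scaleR\<close>)
  have eq: "contour_integral (linepath (Complex c (- N)) (Complex c N)) f
      = \<i> * (LINT t|lborel. indicator {-N..N} t *\<^sub>R ?g t)" if "N > 0" for N
  proof -
    have "set_integrable lborel {-N..N} ?g"
      unfolding set_integrable_def using int by (intro integrable_mult_indicator) auto
    from set_borel_integral_eq_integral(2)[OF this]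
    have "(LINT t|lborel. indicator {-N..N} t *\<^sub>R ?g t) = integral {-N..N} ?g"
      by (simp add: set_lebesgue_integral_def)
    then show ?thesis using that
      by (subst contour_integral_linepath_same_Re[where c = c and a = "-N" and b = N]) auto
  qed
  have "((\<lambda>N. \<i> * (LINT t|lborel. indicator {-N..N} t *\<^sub>R ?g t)) \<longlongrightarrow> \<i> * line_int c f) at_top"
    unfolding line_int_def by (intro tendsto_intros lim)
  then show ?thesis
    by (rule Lim_transform_eventually) (rule eventually_mono[OF eventually_gt_at_top[of 0]], use eq in auto)
qed

text \<open>The sign \<open>e\<close> selects the top or the bottom side of a rectangle; the side
  has fixed length while the integrand is O(1/N^2).\<close>

lemma contour_integral_horizontal_tendsto_0:
  fixes f :: "complex \<Rightarrow> complex"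
  assumes "c < d" "continuous_on {s. c \<le> Re s \<and> Re s \<le> d \<and> \<bar>Im s\<bar> \<ge> 1} f"
    and bound: "\<And>s. c \<le> Re s \<Longrightarrow> Re s \<le> d \<Longrightarrow> \<bar>Im s\<bar> \<ge> 1 \<Longrightarrow> norm (f s) \<le> K / (1 + Im s ^ 2)"
    and e: "e = 1 \<or> e = -1"
  shows "((\<lambda>N. contour_integral (linepath (Complex c (e * N)) (Complex d (e * N))) f) \<longlongrightarrow> 0) at_top"
proof (rule Lim_null_comparison)
  have "norm (contour_integral (linepath (Complex c (e * N)) (Complex d (e * N))) f)
      \<le> K / (1 + N ^ 2) * (d - c)" if N: "N \<ge> 1" for N
  proof -
    have N2: "(e * N) ^ 2 = N ^ 2" "\<bar>e * N\<bar> = N" using e N by auto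
    have seg: "s \<in> closed_segment (Complex c (e * N)) (Complex d (e * N)) \<longleftrightarrow>
        Im s = e * N \<and> c \<le> Re s \<and> Re s \<le> d" for s
      using assms(1) by (auto simp: closed_segment_same_Im closed_segment_eq_real_ivl)
    have K: "0 \<le> K / (1 + N ^ 2)"
      using order_trans[OF norm_ge_zero bound[of "Complex c (e * N)"]] assms(1) N N2 by simp
    have "norm (contour_integral (linepath (Complex c (e * N)) (Complex d (e * N))) f)
        \<le> K / (1 + N ^ 2) * norm (Complex d (e * N) - Complex c (e * N))"
    proof (rule contour_integral_bound_linepath[OF _ K])
      show "f contour_integrable_on linepath (Complex c (e * N)) (Complex d (e * N))"
        by (intro contour_integrable_continuous_linepath continuous_on_subset[OF assms(2)])
           (use N N2 in \<open>auto simp: seg\<close>)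
      fix x assume "x \<in> closed_segment (Complex c (e * N)) (Complex d (e * N))"
      then show "norm (f x) \<le> K / (1 + N ^ 2)"
        using bound[of x] N N2 by (auto simp: seg)
    qed
    also have "norm (Complex d (e * N) - Complex c (e * N)) = d - c"
      using assms(1) by (simp add: complex_diff cmod_def)
    finally show ?thesis .
  qed
  then show "\<forall>\<^sub>F N in at_top. norm (contour_integral (linepath (Complex c (e * N)) (Complex d (e * N))) f)
      \<le> K / (1 + N ^ 2) * (d - c)"
    by (rule eventually_mono[OF eventually_ge_at_top[of "1::real"]])
  have "filterlim (\<lambda>N::real. 1 + N ^ 2) at_top at_top"
    by (intro filterlim_tendsto_add_at_top[OF tendsto_const] filterlim_pow_at_top filterlim_ident) auto
  then have "((\<lambda>N. K / (1 + N ^ 2)) \<longlongrightarrow> 0) at_top"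
    by (intro tendsto_divide_0[OF tendsto_const] filterlim_at_top_imp_at_infinity)
  then show "((\<lambda>N. K / (1 + N ^ 2) * (d - c)) \<longlongrightarrow> 0) at_top"
    by (rule tendsto_mult_left_zero)
qed

text \<open>Residue theorem on rectangles of half-height N, with N tending to infinity. Poles are
  required to be real, so that every rectangle contains all of them and the horizontal sides avoid
  them.\<close>

theorem line_int_shift:
  fixes f :: "complex \<Rightarrow> complex"
  assumes strip: "c' < c" "c < d" "d < d'"
    and holo: "f holomorphic_on {s. c' < Re s \<and> Re s < d'} - P"
    and P: "finite P" "\<And>p. p \<in> P \<Longrightarrow> c < Re p \<and> Re p < d \<and> Im p = 0"
    and bound: "\<And>s. c \<le> Re s \<Longrightarrow> Re s \<le> d \<Longrightarrow> \<bar>Im s\<bar> \<ge> 1 \<Longrightarrow> norm (f s) \<le> K / (1 + Im s ^ 2)"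
  shows "line_int c f - line_int d f = - 2 * of_real pi * (\<Sum>p\<in>P. residue f p)"
proof -
  let ?S = "{s. c' < Re s \<and> Re s < d'}"
  have cont: "continuous_on (?S - P) f" by (rule holomorphic_on_imp_continuous_on[OF holo])
  have vert: "\<exists>K'. continuous_on UNIV (\<lambda>t. f (Complex x t)) \<and> (\<forall>t. norm (f (Complex x t)) \<le> K' / (1 + t ^ 2))"
    if "x = c \<or> x = d" for x
  proof -
    have *: "continuous_on UNIV (\<lambda>t. f (Complex x t))"
      by (rule continuous_on_Complex_line[OF cont]) (use that strip P in force)
    then show ?thesis
      using norm_le_quadratic_decay_extend[OF *, of K] bound[of "Complex x _"] that strip by auto
  qed
  let ?V = "\<lambda>x N. contour_integral (linepath (Complex x (- N)) (Complex x N)) f"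
  let ?H = "\<lambda>e N. contour_integral (linepath (Complex c (e * N)) (Complex d (e * N))) f"
  have Vlim: "((\<lambda>N. ?V x N) \<longlongrightarrow> \<i> * line_int x f) at_top" if "x = c \<or> x = d" for x
    using vert[OF that] tendsto_line_int by blast
  have Hlim: "((\<lambda>N. ?H e N) \<longlongrightarrow> 0) at_top" if "e = 1 \<or> e = -1" for e
  proof (rule contour_integral_horizontal_tendsto_0[OF strip(2) _ bound that])
    show "continuous_on {s. c \<le> Re s \<and> Re s \<le> d \<and> 1 \<le> \<bar>Im s\<bar>} f"
      by (rule continuous_on_subset[OF cont]) (use strip P in force)
  qed
  have "open ?S" by (intro open_Collect_conj open_halfspace_Re_gt open_halfspace_Re_lt)
  have cv: "convex ?S" unfolding Collect_conj_eq by (intro convex_Int convex_halfspace_Re_gt convex_halfspace_Re_lt)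
  have rect: "?V d N - ?V c N + ?H (-1) N - ?H 1 N = 2 * of_real pi * \<i> * (\<Sum>p\<in>P. residue f p)"
    if N: "N \<ge> 1" for N
  proof -
    let ?a = "Complex c (- N)" and ?b = "Complex d N"
    have img: "path_image (rectpath ?a ?b) \<subseteq> ?S - P"
      using strip P N by (subst path_image_rectpath) force+
    have ints: "f contour_integrable_on linepath z w" if "closed_segment z w \<subseteq> path_image (rectpath ?a ?b)" for z w
      by (intro contour_integrable_continuous_linepath continuous_on_subset[OF cont]) (use that img in auto)
    have sub: "closed_segment ?a (Complex d (-N)) \<subseteq> path_image (rectpath ?a ?b)"
      "closed_segment (Complex d (-N)) ?b \<subseteq> path_image (rectpath ?a ?b)"
      "closed_segment ?b (Complex c N) \<subseteq> path_image (rectpath ?a ?b)"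
      "closed_segment (Complex c N) ?a \<subseteq> path_image (rectpath ?a ?b)"
      by (auto simp: rectpath_def Let_def path_image_join)
    have "contour_integral (rectpath ?a ?b) f = contour_integral (linepath ?a (Complex d (-N))) f
        + (contour_integral (linepath (Complex d (-N)) ?b) f
        + (contour_integral (linepath ?b (Complex c N)) f
        + contour_integral (linepath (Complex c N) ?a) f))"
      unfolding rectpath_def Let_def using ints[OF sub(1)] ints[OF sub(2)] ints[OF sub(3)] ints[OF sub(4)]
      by (simp add: contour_integrable_joinI valid_path_join)
    also have "contour_integral (linepath ?b (Complex c N)) f = - ?H 1 N"
      using contour_integral_reverse_linepath[of "Complex c N" ?b f]
        continuous_on_subset[OF cont] sub(3) img by (auto simp: closed_segment_commute)
    also have "contour_integral (linepath (Complex c N) ?a) f = - ?V c N"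
      using contour_integral_reverse_linepath[of ?a "Complex c N" f]
        continuous_on_subset[OF cont] sub(4) img by (auto simp: closed_segment_commute)
    finally have 1: "contour_integral (rectpath ?a ?b) f = ?V d N - ?V c N + ?H (-1) N - ?H 1 N" by simp
    have "contour_integral (rectpath ?a ?b) f
        = 2 * pi * \<i> * (\<Sum>p\<in>P. winding_number (rectpath ?a ?b) p * residue f p)"
    proof (rule Residue_theorem[OF \<open>open ?S\<close> convex_connected[OF cv] P(1) holo])
      show "\<forall>z. z \<notin> ?S \<longrightarrow> winding_number (rectpath ?a ?b) z = 0"
      proof (intro allI impI winding_number_rectpath_outside)
        fix z assume "z \<notin> ?S" then show "z \<notin> cbox ?a ?b"
          using strip by (auto simp: in_cbox_complex_iff)
      qed (use strip N in auto)
    qed (use img in auto)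
    also have "(\<Sum>p\<in>P. winding_number (rectpath ?a ?b) p * residue f p) = (\<Sum>p\<in>P. residue f p)"
    proof (rule sum.cong[OF refl])
      fix p assume "p \<in> P"
      then have "p \<in> box ?a ?b" using P N by (force simp: in_box_complex_iff)
      then show "winding_number (rectpath ?a ?b) p * residue f p = residue f p"
        by (simp add: winding_number_rectpath)
    qed
    finally show ?thesis using 1 by simp
  qed
  have "((\<lambda>N. ?V d N - ?V c N + ?H (-1) N - ?H 1 N) \<longlongrightarrow> \<i> * line_int d f - \<i> * line_int c f + 0 - 0) at_top"
    by (intro tendsto_intros Vlim Hlim) auto
  moreover have "((\<lambda>N. ?V d N - ?V c N + ?H (-1) N - ?H 1 N) \<longlongrightarrow> 2 * of_real pi * \<i> * (\<Sum>p\<in>P. residue f p)) at_top"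
    by (rule tendsto_eventually) (rule eventually_mono[OF eventually_ge_at_top[of "1::real"]], use rect in auto)
  ultimately have "\<i> * line_int d f - \<i> * line_int c f = 2 * of_real pi * \<i> * (\<Sum>p\<in>P. residue f p)"
    using tendsto_unique[OF trivial_limit_at_top_linorder] by fastforce
  then have "\<i> * (line_int d f - line_int c f) = \<i> * (2 * of_real pi * (\<Sum>p\<in>P. residue f p))"
    by (simp add: algebra_simps)
  then have "line_int d f - line_int c f = 2 * of_real pi * (\<Sum>p\<in>P. residue f p)"
    unfolding mult_left_cancel[OF complex_i_not_zero] .
  then show ?thesis by (simp add: algebra_simps)
qed

section \<open>Mellin integrals as functions of a logarithm\<close>

definition mellin :: "real \<Rightarrow> (complex \<Rightarrow> complex) \<Rightarrow> complex \<Rightarrow> complex" where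
  "mellin c f u = line_int c (\<lambda>s. f s * exp (s * u))"

text \<open>The variable is u = log x, so that branches of x^s are distinguished by Im u = arg x.
  Since |exp(s u)| = exp(c Re u) exp(-t Im u), only Im u matters for convergence; the first factor
  is constant on the line.\<close>

definition exp_decay :: "real \<Rightarrow> (complex \<Rightarrow> complex) \<Rightarrow> complex \<Rightarrow> bool" where
  "exp_decay c f u \<longleftrightarrow>
     (\<exists>K \<epsilon>. \<epsilon> > 0 \<and> (\<forall>t. norm (f (Complex c t)) * exp (- t * Im u) \<le> K * exp (- \<epsilon> * \<bar>t\<bar>)))"

lemma power_mult_exp_decay:
  fixes \<epsilon> :: real
  assumes "\<epsilon> > 0"
  shows "\<exists>K. \<forall>t. (1 + \<bar>t\<bar>) ^ n * exp (- \<epsilon> * \<bar>t\<bar>) \<le> K"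
proof -
  have "(1 + \<bar>t\<bar>) ^ n * exp (- \<epsilon> * \<bar>t\<bar>) \<le> (real (Suc n) / \<epsilon>) ^ Suc n * exp \<epsilon>" for t
  proof -
    \<comment> \<open>Using the exponent n + 1 keeps \<open>real m\<close> a legitimate divisor also
      for n = 0.\<close>
    define m where "m = Suc n"
    have m: "m > 0" by (simp add: m_def)
    have "(1 + \<bar>t\<bar>) ^ n \<le> (1 + \<bar>t\<bar>) ^ m" unfolding m_def by (rule power_increasing) auto
    also have "\<dots> = (real m / \<epsilon>) ^ m * (\<epsilon> * (1 + \<bar>t\<bar>) / real m) ^ m"
      using assms m by (simp flip: power_mult_distrib)
    also have "\<dots> \<le> (real m / \<epsilon>) ^ m * exp (\<epsilon> * (1 + \<bar>t\<bar>) / real m) ^ m"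
      using assms by (intro mult_left_mono power_mono)
        (auto intro: order_trans[OF _ exp_ge_add_one_self])
    also have "exp (\<epsilon> * (1 + \<bar>t\<bar>) / real m) ^ m = exp \<epsilon> * exp (\<epsilon> * \<bar>t\<bar>)"
      proof -
      have "real m * (\<epsilon> * (1 + \<bar>t\<bar>) / real m) = \<epsilon> + \<epsilon> * \<bar>t\<bar>" using m by (simp add: field_simps)
      then show ?thesis by (metis exp_of_nat_mult exp_add)
    qed
    finally show ?thesis by (simp add: m_def exp_minus field_simps)
  qed
  then show ?thesis by blast
qed

text \<open>Half of the decay rate is spent on the polynomial factor and half remains; hence all
  derivatives of a Mellin integral converge wherever the integral decays exponentially.\<close>

lemma exp_decay_mult_power:
  assumes f: "exp_decay c f u" and g: "\<And>t. norm (g (Complex c t)) \<le> B * (1 + \<bar>t\<bar>) ^ n"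
  shows "exp_decay c (\<lambda>s. g s * f s) u"
proof -
  obtain K \<epsilon> where K: "\<epsilon> > 0" "\<And>t. norm (f (Complex c t)) * exp (- t * Im u) \<le> K * exp (- \<epsilon> * \<bar>t\<bar>)"
    using f unfolding exp_decay_def by blast
  obtain M where M: "\<And>t. (1 + \<bar>t\<bar>) ^ n * exp (- (\<epsilon> / 2) * \<bar>t\<bar>) \<le> M"
    using power_mult_exp_decay[of "\<epsilon> / 2" n] K by auto
  have K0: "K \<ge> 0" using order_trans[OF _ K(2)[of 0]] by auto
  have B0: "B \<ge> 0" using order_trans[OF norm_ge_zero g[of 0]] by simp
  have "norm (g (Complex c t) * f (Complex c t)) * exp (- t * Im u) \<le> B * M * K * exp (- (\<epsilon> / 2) * \<bar>t\<bar>)" for t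
  proof -
    have "norm (g (Complex c t) * f (Complex c t)) * exp (- t * Im u)
        = norm (g (Complex c t)) * (norm (f (Complex c t)) * exp (- t * Im u))" by (simp add: norm_mult)
    also have "\<dots> \<le> (B * (1 + \<bar>t\<bar>) ^ n) * (K * exp (- \<epsilon> * \<bar>t\<bar>))"
      using B0 by (intro mult_mono g K(2)) auto
    also have "exp (- \<epsilon> * \<bar>t\<bar>) = exp (- (\<epsilon> / 2) * \<bar>t\<bar>) * exp (- (\<epsilon> / 2) * \<bar>t\<bar>)"
      by (simp flip: exp_add)
    also have "(B * (1 + \<bar>t\<bar>) ^ n) * (K * (exp (- (\<epsilon> / 2) * \<bar>t\<bar>) * exp (- (\<epsilon> / 2) * \<bar>t\<bar>)))
        = B * K * exp (- (\<epsilon> / 2) * \<bar>t\<bar>) * ((1 + \<bar>t\<bar>) ^ n * exp (- (\<epsilon> / 2) * \<bar>t\<bar>))" by simp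
    also have "\<dots> \<le> B * K * exp (- (\<epsilon> / 2) * \<bar>t\<bar>) * M"
      using B0 K0 by (intro mult_left_mono M) auto
    finally show ?thesis by (simp add: mult_ac)
  qed
  then show ?thesis unfolding exp_decay_def using K(1) by (intro exI[of _ "B * M * K"] exI[of _ "\<epsilon>/2"]) auto
qed

lemma norm_Complex_le: "norm (Complex c t) \<le> (1 + \<bar>c\<bar>) * (1 + \<bar>t\<bar>)"
proof -
  have "norm (Complex c t) \<le> \<bar>c\<bar> + \<bar>t\<bar>" using cmod_le[of "Complex c t"] by simp
  also have "\<dots> \<le> (1 + \<bar>c\<bar>) * (1 + \<bar>t\<bar>)" by (simp add: algebra_simps)
  finally show ?thesis .
qed

lemma exp_decay_mult_s: "exp_decay c f u \<Longrightarrow> exp_decay c (\<lambda>s. s * f s) u"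
  by (rule exp_decay_mult_power[where B = "1 + \<bar>c\<bar>" and n = 1]) (use norm_Complex_le in auto)

lemma norm_exp_mult: "norm (f * exp (Complex c t * u)) = norm f * exp (- t * Im u) * exp (c * Re u)"
  by (simp add: norm_mult norm_exp_eq_Re mult.assoc flip: exp_add)

lemma exp_decay_quadratic:
  assumes "exp_decay c f u"
  shows "\<exists>K. \<forall>t. norm (f (Complex c t) * exp (Complex c t * u)) \<le> K / (1 + t ^ 2)"
proof -
  obtain K \<epsilon> where K: "\<epsilon> > 0" "\<And>t. norm (f (Complex c t)) * exp (- t * Im u) \<le> K * exp (- \<epsilon> * \<bar>t\<bar>)"
    using assms unfolding exp_decay_def by blast
  obtain M where M: "\<And>t. (1 + \<bar>t\<bar>) ^ 2 * exp (- \<epsilon> * \<bar>t\<bar>) \<le> M"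
    using power_mult_exp_decay[of "\<epsilon>" 2] K by auto
  have K0: "K \<ge> 0" using order_trans[OF _ K(2)[of 0]] by auto
  have "norm (f (Complex c t) * exp (Complex c t * u)) \<le> exp (c * Re u) * K * M / (1 + t ^ 2)" for t
  proof -
    have "(1 + t ^ 2) * exp (- \<epsilon> * \<bar>t\<bar>) \<le> (1 + \<bar>t\<bar>) ^ 2 * exp (- \<epsilon> * \<bar>t\<bar>)"
      by (intro mult_right_mono) (auto simp: power2_eq_square algebra_simps)
    also note M
    finally have "exp (- \<epsilon> * \<bar>t\<bar>) \<le> M / (1 + t ^ 2)"
      by (simp add: field_simps add_pos_nonneg)
    then have "K * exp (- \<epsilon> * \<bar>t\<bar>) \<le> K * (M / (1 + t ^ 2))" using K0 by (intro mult_left_mono)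
    then have "norm (f (Complex c t)) * exp (- t * Im u) \<le> K * (M / (1 + t ^ 2))"
      using K(2)[of t] by linarith
    then have "norm (f (Complex c t)) * exp (- t * Im u) * exp (c * Re u) \<le> K * (M / (1 + t ^ 2)) * exp (c * Re u)"
      by (intro mult_right_mono) auto
    then show ?thesis unfolding norm_exp_mult by (simp add: mult_ac)
  qed
  then show ?thesis by blast
qed

lemma norm_exp_minus_one_le: "norm (exp z - 1) \<le> norm z * exp (norm (z :: complex))"
proof -
  have "norm (exp z - exp 0) \<le> exp (norm z) * norm (z - 0)"
  proof (rule field_differentiable_bound[where S = "cball 0 (norm z)" and f' = exp])
    fix w :: complex assume "w \<in> cball 0 (norm z)"
    then show "norm (exp w) \<le> exp (norm z)"
      using norm_exp[of w] by (auto intro: order_trans)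
  qed (auto intro: derivative_eq_intros)
  then show ?thesis by (simp add: mult.commute)
qed

text \<open>Dominated convergence speaks about sequences and needs one majorant; confining the
  sequences to a fixed disc makes such a majorant possible.\<close>

lemma tendsto_at_0_sequentially:
  fixes F :: "complex \<Rightarrow> complex"
  assumes "\<delta> > 0"
    and lim: "\<And>X. (\<And>n. X n \<noteq> 0) \<Longrightarrow> X \<longlonglongrightarrow> 0 \<Longrightarrow> (\<And>n. norm (X n) \<le> \<delta>) \<Longrightarrow> (\<lambda>n. F (X n)) \<longlonglongrightarrow> l"
  shows "(F \<longlongrightarrow> l) (at 0)"
proof -
  have "(F \<longlongrightarrow> l) (at 0 within cball 0 \<delta>)"
    unfolding tendsto_at_iff_sequentially o_def using lim by (auto simp: dist_norm)
  moreover have "at 0 within cball 0 \<delta> = at (0::complex)"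
    by (rule at_within_interior) (use assms(1) in \<open>simp add: interior_cball\<close>)
  ultimately show ?thesis by metis
qed

lemma continuous_mellin_integrand:
  assumes "continuous_on UNIV (\<lambda>t. f (Complex c t))"
  shows "continuous_on UNIV (\<lambda>t. f (Complex c t) * exp (Complex c t * u))"
proof (intro continuous_on_mult assms)
  have "continuous_on UNIV (\<lambda>s. exp (s * u))" by (intro continuous_intros)
  then show "continuous_on UNIV (\<lambda>t. exp (Complex c t * u))"
    by (rule continuous_on_Complex_line) auto
qed

lemma mellin_integrable:
  assumes "continuous_on UNIV (\<lambda>t. f (Complex c t))" "exp_decay c f u"
  shows "integrable lborel (\<lambda>t. f (Complex c t) * exp (Complex c t * u))"
  using exp_decay_quadratic[OF assms(2)]
    integrable_quadratic_decay[OF continuous_mellin_integrand[OF assms(1)]] by blast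

text \<open>Differentiation under the integral sign. For |h| at most epsilon/2 the difference
  quotient of exp(s h) is bounded by |s| exp(|s| epsilon/2), which uses up half of the exponential
  decay.\<close>

lemma mellin_has_field_derivative:
  assumes cont: "continuous_on UNIV (\<lambda>t. f (Complex c t))" and decay: "exp_decay c f u"
  shows "(mellin c f has_field_derivative mellin c (\<lambda>s. s * f s) u) (at u)"
proof -
  obtain K \<epsilon> where K: "\<epsilon> > 0" "\<And>t. norm (f (Complex c t)) * exp (- t * Im u) \<le> K * exp (- \<epsilon> * \<bar>t\<bar>)"
    using decay unfolding exp_decay_def by blast
  define G where "G = (\<lambda>s. norm s * exp (norm s * (\<epsilon> / 2)) * norm (f s * exp (s * u)))"
  have K0: "K \<ge> 0" using order_trans[OF _ K(2)[of 0]] by auto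
  have dec2: "exp_decay c (\<lambda>s. of_real (norm s * exp (norm s * (\<epsilon> / 2)) * norm (f s))) u"
  proof -
    have d: "exp_decay c (\<lambda>s. of_real (exp (norm s * (\<epsilon> / 2)) * norm (f s))) u"
      unfolding exp_decay_def
    proof (intro exI conjI allI)
      show "\<epsilon> / 2 > 0" using K by simp
      fix t
      have "norm (Complex c t) \<le> \<bar>c\<bar> + \<bar>t\<bar>" using cmod_le[of "Complex c t"] by simp
      then have "exp (norm (Complex c t) * (\<epsilon>/2)) \<le> exp ((\<bar>c\<bar> + \<bar>t\<bar>) * (\<epsilon>/2))" using K(1) by simp
      then have "exp (norm (Complex c t) * (\<epsilon>/2)) * (norm (f (Complex c t)) * exp (- t * Im u))
        \<le> exp ((\<bar>c\<bar> + \<bar>t\<bar>) * (\<epsilon>/2)) * (K * exp (- \<epsilon> * \<bar>t\<bar>))"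
        by (intro mult_mono K) auto
      also have "\<dots> = K * exp ((\<bar>c\<bar> + \<bar>t\<bar>) * (\<epsilon>/2) + (- \<epsilon> * \<bar>t\<bar>))"
        unfolding exp_add by (simp only: mult_ac)
      also have "(\<bar>c\<bar> + \<bar>t\<bar>) * (\<epsilon>/2) + (- \<epsilon> * \<bar>t\<bar>) = \<bar>c\<bar> * (\<epsilon>/2) + (- (\<epsilon>/2) * \<bar>t\<bar>)"
        by (simp add: field_simps)
      also have "K * exp \<dots> = K * exp (\<bar>c\<bar> * (\<epsilon>/2)) * exp (- (\<epsilon>/2) * \<bar>t\<bar>)"
        unfolding exp_add by (simp only: mult_ac)
      finally show "norm (complex_of_real (exp (norm (Complex c t) * (\<epsilon> / 2)) * norm (f (Complex c t)))) *
             exp (- t * Im u) \<le> K * exp (\<bar>c\<bar> * (\<epsilon>/2)) * exp (- (\<epsilon>/2) * \<bar>t\<bar>)"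
        by (simp add: mult.assoc norm_mult)
    qed
    have "norm (complex_of_real (norm (Complex c t))) \<le> (1 + \<bar>c\<bar>) * (1 + \<bar>t\<bar>) ^ 1" for t
      using norm_Complex_le[of c t] by simp
    from exp_decay_mult_power[OF d this] show ?thesis
      by (simp only: of_real_mult mult.assoc)
  qed
  have Geq: "G s = norm (of_real (norm s * exp (norm s * (\<epsilon> / 2)) * norm (f s)) * exp (s * u))" for s
    by (simp add: G_def norm_mult)
  have contC: "continuous_on UNIV (\<lambda>t. Complex c t)"
    by (rule continuous_on_Complex_line[of UNIV "\<lambda>s. s"]) auto
  have contG: "continuous_on UNIV (\<lambda>t. complex_of_real (norm (Complex c t) * exp (norm (Complex c t) * (\<epsilon> / 2)) * norm (f (Complex c t))))"
  proof -
    have "continuous_on UNIV (\<lambda>t. complex_of_real (norm (Complex c t) * exp (norm (Complex c t) * (\<epsilon> / 2))) * complex_of_real (norm (f (Complex c t))))"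
      by (intro continuous_intros cont contC)
    then show ?thesis by simp
  qed
  have intG: "integrable lborel (\<lambda>t. G (Complex c t))"
    unfolding Geq by (intro integrable_norm mellin_integrable[OF _ dec2] contG)
  have cont': "continuous_on UNIV (\<lambda>t. Complex c t * f (Complex c t))"
    by (intro continuous_on_mult cont contC)
  have int0: "integrable lborel (\<lambda>t. f (Complex c t) * exp (Complex c t * u))"
    by (rule mellin_integrable[OF cont decay])
  have "((\<lambda>h. (mellin c f (u + h) - mellin c f u) / h) \<longlongrightarrow> mellin c (\<lambda>s. s * f s) u) (at 0)"
  proof (rule tendsto_at_0_sequentially[of "\<epsilon> / 2"])
    show "\<epsilon> / 2 > 0" using K by simp
  next
    fix X :: "nat \<Rightarrow> complex"
    assume X: "\<And>n. X n \<noteq> 0" "X \<longlonglongrightarrow> 0" "\<And>n. norm (X n) \<le> \<epsilon> / 2"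
    let ?D = "\<lambda>n t. f (Complex c t) * exp (Complex c t * u) * ((exp (Complex c t * X n) - 1) / X n)"
    have bnd: "norm (?D n t) \<le> G (Complex c t)" for n t
    proof -
      have "norm ((exp (Complex c t * X n) - 1) / X n) \<le> norm (Complex c t * X n) * exp (norm (Complex c t * X n)) / norm (X n)"
        unfolding norm_divide by (intro divide_right_mono norm_exp_minus_one_le) auto
      also have "\<dots> = norm (Complex c t) * exp (norm (Complex c t) * norm (X n))"
        using X by (simp add: norm_mult)
      also have "\<dots> \<le> norm (Complex c t) * exp (norm (Complex c t) * (\<epsilon> / 2))"
      proof (intro mult_left_mono)
        have "norm (Complex c t) * norm (X n) \<le> norm (Complex c t) * (\<epsilon> / 2)"
          by (intro mult_left_mono X) auto
        then show "exp (norm (Complex c t) * norm (X n)) \<le> exp (norm (Complex c t) * (\<epsilon> / 2))" by simp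
      qed auto
      finally have le: "norm ((exp (Complex c t * X n) - 1) / X n) \<le> norm (Complex c t) * exp (norm (Complex c t) * (\<epsilon> / 2))" .
      have "norm (?D n t) = norm (f (Complex c t) * exp (Complex c t * u)) * norm ((exp (Complex c t * X n) - 1) / X n)"
        by (rule norm_mult)
      also have "\<dots> \<le> norm (f (Complex c t) * exp (Complex c t * u)) * (norm (Complex c t) * exp (norm (Complex c t) * (\<epsilon> / 2)))"
        by (rule mult_left_mono[OF le norm_ge_zero])
      also have "\<dots> = G (Complex c t)" unfolding G_def by (simp only: mult_ac)
      finally show ?thesis .
    qed
    have contD: "continuous_on UNIV (\<lambda>t. ?D n t)" for n
      by (intro continuous_on_mult[OF continuous_mellin_integrand[OF cont]] continuous_on_divide
          continuous_intros contC) (use X in auto)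
    have lim: "(\<lambda>n. LINT t|lborel. ?D n t) \<longlonglongrightarrow> (LINT t|lborel. Complex c t * f (Complex c t) * exp (Complex c t * u))"
    proof (rule integral_dominated_convergence[OF _ _ intG])
      show "AE t in lborel. (\<lambda>n. ?D n t) \<longlonglongrightarrow> Complex c t * f (Complex c t) * exp (Complex c t * u)"
      proof (rule AE_I2)
        fix t
        have "((\<lambda>h. exp (Complex c t * h)) has_field_derivative Complex c t) (at 0)"
          by (auto intro!: derivative_eq_intros)
        then have "((\<lambda>h. (exp (Complex c t * h) - 1) / h) \<longlongrightarrow> Complex c t) (at 0)"
          by (simp add: DERIV_def)
        then have "(\<lambda>n. (exp (Complex c t * X n) - 1) / X n) \<longlonglongrightarrow> Complex c t"
          by (rule filterlim_compose) (use X in \<open>auto simp: filterlim_at\<close>)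
        then have "(\<lambda>n. ?D n t) \<longlonglongrightarrow> f (Complex c t) * exp (Complex c t * u) * Complex c t"
          by (intro tendsto_intros)
        then show "(\<lambda>n. ?D n t) \<longlonglongrightarrow> Complex c t * f (Complex c t) * exp (Complex c t * u)"
          by (simp add: mult_ac)
      qed
      show "(\<lambda>t. Complex c t * f (Complex c t) * exp (Complex c t * u)) \<in> borel_measurable lborel"
        using borel_measurable_continuous_onI[OF continuous_mellin_integrand[OF cont', of u]] by simp
      show "(\<lambda>t. ?D n t) \<in> borel_measurable lborel" for n
        using borel_measurable_continuous_onI[OF contD[of n]] by simp
    qed (use bnd in auto)
    have "(LINT t|lborel. ?D n t) = (mellin c f (u + X n) - mellin c f u) / X n" for n
    proof -
      have intD: "integrable lborel (\<lambda>t. ?D n t)"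
      proof (rule Bochner_Integration.integrable_bound[OF intG])
        show "(\<lambda>t. ?D n t) \<in> borel_measurable lborel"
          using borel_measurable_continuous_onI[OF contD[of n]] by simp
        show "AE t in lborel. norm (?D n t) \<le> norm (G (Complex c t))"
          unfolding real_norm_def by (intro AE_I2 order_trans[OF bnd abs_ge_self])
      qed
      have "mellin c f (u + X n) = (LINT t|lborel. f (Complex c t) * exp (Complex c t * u) + X n * ?D n t)"
        unfolding mellin_def line_int_def
      proof (rule Bochner_Integration.integral_cong[OF refl])
        fix t
        have "X n * ?D n t = f (Complex c t) * exp (Complex c t * u) * (exp (Complex c t * X n) - 1)"
          using X(1)[of n] by simp
        then show "f (Complex c t) * exp (Complex c t * (u + X n))
            = f (Complex c t) * exp (Complex c t * u) + X n * ?D n t"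
          unfolding distrib_left exp_add by (simp only: right_diff_distrib mult_1_right mult.assoc) simp
      qed
      also have "\<dots> = mellin c f u + X n * (LINT t|lborel. ?D n t)"
      proof -
        have "(LINT t|lborel. f (Complex c t) * exp (Complex c t * u) + X n * ?D n t)
            = (LINT t|lborel. f (Complex c t) * exp (Complex c t * u)) + (LINT t|lborel. X n * ?D n t)"
          by (intro Bochner_Integration.integral_add int0 integrable_mult_right intD)
        then show ?thesis by (simp only: mellin_def line_int_def integral_mult_right_zero)
      qed
      finally have eq: "mellin c f (u + X n) = mellin c f u + X n * (LINT t|lborel. ?D n t)" .
      show ?thesis unfolding eq add_diff_cancel_left'
        by (rule nonzero_mult_div_cancel_left[OF X(1), symmetric])
    qed
    then have eq: "(\<lambda>n. (mellin c f (u + X n) - mellin c f u) / X n) = (\<lambda>n. LINT t|lborel. ?D n t)"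
      by (intro ext) (rule sym)
    show "(\<lambda>n. (mellin c f (u + X n) - mellin c f u) / X n) \<longlonglongrightarrow> mellin c (\<lambda>s. s * f s) u"
      unfolding eq mellin_def[of c "\<lambda>s. s * f s"] line_int_def by (rule lim)
  qed
  then show ?thesis by (simp add: DERIV_def)
qed

text \<open>Only a quadratic majorant is required, so this applies up to the boundary of a strip of
  convergence, where the exponential decay behind differentiability is lost.\<close>

lemma continuous_on_mellin:
  assumes cont: "continuous_on UNIV (\<lambda>t. f (Complex c t))"
    and bound: "\<And>u t. u \<in> U \<Longrightarrow> norm (f (Complex c t)) * exp (- t * Im u) \<le> K / (1 + t ^ 2)"
  shows "continuous_on U (mellin c f)"
proof (rule continuous_on_sequentiallyI)
  fix X u assume X': "\<forall>n. X n \<in> U" and u: "u \<in> U" and "X \<longlonglongrightarrow> u"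
  then have X: "(\<forall>n. X n \<in> U) \<and> X \<longlonglongrightarrow> u" by blast
  have "(\<lambda>n. exp (c * Re (X n))) \<longlonglongrightarrow> exp (c * Re u)"
    using X by (intro tendsto_intros) auto
  then have "Bseq (\<lambda>n. exp (c * Re (X n)))"
    by (intro convergent_imp_Bseq convergentI)
  then obtain B where B: "\<And>n. exp (c * Re (X n)) \<le> B" by (auto simp: Bseq_def)
  have K0: "K \<ge> 0" using order_trans[OF _ bound[OF u, of 0]] by simp
  show "(\<lambda>n. mellin c f (X n)) \<longlonglongrightarrow> mellin c f u"
    unfolding mellin_def line_int_def
  proof (rule integral_dominated_convergence[where w = "\<lambda>t. K * B * (1 / (1 + t ^ 2))"])
    show "integrable lborel (\<lambda>t. K * B * (1 / (1 + t ^ 2)))"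
      by (intro integrable_mult_right integrable_inverse_one_plus_square)
    show "(\<lambda>t. f (Complex c t) * exp (Complex c t * u)) \<in> borel_measurable lborel"
      "\<And>n. (\<lambda>t. f (Complex c t) * exp (Complex c t * X n)) \<in> borel_measurable lborel"
      using borel_measurable_continuous_onI[OF continuous_mellin_integrand[OF cont]] by simp_all
    show "AE t in lborel. (\<lambda>n. f (Complex c t) * exp (Complex c t * X n)) \<longlonglongrightarrow> f (Complex c t) * exp (Complex c t * u)"
      using X by (intro AE_I2 tendsto_intros) auto
    show "AE t in lborel. norm (f (Complex c t) * exp (Complex c t * X n)) \<le> K * B * (1 / (1 + t ^ 2))" for n
    proof (rule AE_I2)
      fix t
      have "norm (f (Complex c t)) * exp (- t * Im (X n)) * exp (c * Re (X n)) \<le> K / (1 + t ^ 2) * B"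
        using X K0 by (intro mult_mono bound B) auto
      then show "norm (f (Complex c t) * exp (Complex c t * X n)) \<le> K * B * (1 / (1 + t ^ 2))"
        unfolding norm_exp_mult by simp
    qed
  qed
qed

section \<open>The differential equation in terms of jets\<close>

text \<open>A chain lists f, theta f, theta^2 f, ... as explicit functions on \<open>S\<close>. With
  such jets the operator becomes algebraic, and nothing needs to be known about f outside
  \<open>S\<close>.\<close>

definition theta_chain :: "complex set \<Rightarrow> (nat \<Rightarrow> complex \<Rightarrow> complex) \<Rightarrow> bool" where
  "theta_chain S g \<longleftrightarrow> (\<forall>n. \<forall>z\<in>S. (g n has_field_derivative g (Suc n) z / z) (at z))"

text \<open>The action of theta + a on jets. Four such shifts, read off at index 0, give the second
  factor of the operator.\<close>

definition tshift :: "real \<Rightarrow> (nat \<Rightarrow> complex) \<Rightarrow> nat \<Rightarrow> complex" where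
  "tshift a w = (\<lambda>n. w (Suc n) + of_real a * w n)"

definition tpoly :: "real \<Rightarrow> real \<Rightarrow> (nat \<Rightarrow> complex) \<Rightarrow> complex" where
  "tpoly A B w = tshift A (tshift (1 - A) (tshift B (tshift (1 - B) w))) 0"

lemma theta_eq:
  assumes "open S" "0 \<notin> S" "z \<in> S" "\<And>w. w \<in> S \<Longrightarrow> f w = h w" "(h has_field_derivative h' / z) (at z)"
  shows "theta f z = h'"
proof -
  have "(f has_field_derivative h' / z) (at z)"
    by (rule DERIV_cong_ev[THEN iffD2, OF refl _ refl assms(5)])
      (rule eventually_mono[OF eventually_nhds_in_open[OF assms(1,3)] assms(4)])
  then show ?thesis using assms(2,3) by (auto simp: theta_def dest!: DERIV_imp_deriv)
qed

lemma theta_chain_Suc: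
  assumes "open S" "0 \<notin> S" "theta_chain S g" "\<And>w. w \<in> S \<Longrightarrow> f w = g n w" "z \<in> S"
  shows "theta f z = g (Suc n) z"
  by (rule theta_eq[OF assms(1,2,5,4)]) (use assms in \<open>auto simp: theta_chain_def\<close>)

lemma theta_chain_funpow:
  assumes "open S" "0 \<notin> S" "theta_chain S g" "\<And>w. w \<in> S \<Longrightarrow> f w = g 0 w" "z \<in> S"
  shows "(theta ^^ n) f z = g n z"
  using assms(5)
proof (induction n arbitrary: z)
  case (Suc n)
  show ?case using theta_chain_Suc[OF assms(1-3) Suc.IH Suc.prems] by simp
qed (use assms in simp)

lemma theta_chain_tshift:
  assumes "theta_chain S g"
  shows "theta_chain S (\<lambda>n z. tshift a (\<lambda>n. g n z) n)"
  using assms unfolding theta_chain_def tshift_def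
  by (auto intro!: derivative_eq_intros simp: add_divide_distrib)

lemma theta_plus_chain:
  assumes "open S" "0 \<notin> S" "theta_chain S g" "\<And>w. w \<in> S \<Longrightarrow> f w = g 0 w" "z \<in> S"
  shows "theta_plus a f z = tshift a (\<lambda>n. g n z) 0"
  unfolding theta_plus_def tshift_def
  using theta_chain_Suc[OF assms(1-3) assms(4) assms(5)] assms(4,5) by simp

lemma picard_fuchs_chain:
  assumes S: "open S" "0 \<notin> S" and g: "theta_chain S g" "\<And>w. w \<in> S \<Longrightarrow> f w = g 0 w" and z: "z \<in> S"
  shows "picard_fuchs A B C f z = g 4 z - of_int C * z * tpoly A B (\<lambda>n. g n z)"
proof -
  note c1 = theta_chain_tshift[OF g(1), of "1 - B"]
  note c2 = theta_chain_tshift[OF c1, of "B"]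
  note c3 = theta_chain_tshift[OF c2, of "1 - A"]
  note e1 = theta_plus_chain[OF S g]
  note e2 = theta_plus_chain[OF S c1 e1]
  note e3 = theta_plus_chain[OF S c2 e2]
  note e4 = theta_plus_chain[OF S c3 e3 z]
  show ?thesis
    unfolding picard_fuchs_def tpoly_def using e4[of A] theta_chain_funpow[OF S g z, of 4] by simp
qed

text \<open>The product of the two factors theta^2 + theta + a(1 - a), a = A and a = B, with the
  powers of theta turned into jet indices.\<close>

lemma tpoly_expand:
  "tpoly A B w = w 4 + 2 * w 3 + of_real (1 + A * (1 - A) + B * (1 - B)) * w 2
     + of_real (A * (1 - A) + B * (1 - B)) * w 1 + of_real (A * (1 - A) * (B * (1 - B))) * w 0"
  by (simp add: tpoly_def tshift_def eval_nat_numeral algebra_simps)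

lemma theta_chain_holomorphic:
  assumes "open S" "0 \<notin> S" "f holomorphic_on S"
  shows "theta_chain S (\<lambda>n. (theta ^^ n) f)"
proof -
  have holo: "(theta ^^ n) f holomorphic_on S" for n
  proof (induction n)
    case (Suc n)
    then show ?case unfolding funpow.simps o_def theta_def
      by (intro holomorphic_intros assms(1))
  qed (use assms in simp)
  show ?thesis unfolding theta_chain_def
  proof (intro allI ballI)
    fix n z assume z: "z \<in> S"
    then have "((theta ^^ n) f has_field_derivative deriv ((theta ^^ n) f) z) (at z)"
      using holomorphic_derivI[OF holo assms(1)] by blast
    moreover have "(theta ^^ Suc n) f z = z * deriv ((theta ^^ n) f) z" by (simp add: theta_def)
    ultimately show "((theta ^^ n) f has_field_derivative (theta ^^ Suc n) f z / z) (at z)"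
      using z assms(2) by auto
  qed
qed

lemma theta_chain_sum:
  assumes "\<And>j. j \<in> J \<Longrightarrow> theta_chain S (g j)"
  shows "theta_chain S (\<lambda>n z. \<Sum>j\<in>J. c j * g j n z)"
  unfolding theta_chain_def
proof (intro allI ballI)
  fix n z assume "z \<in> S"
  then have "((\<lambda>z. \<Sum>j\<in>J. c j * g j n z) has_field_derivative (\<Sum>j\<in>J. c j * (g j (Suc n) z / z))) (at z)"
    by (intro DERIV_sum DERIV_cmult) (use assms in \<open>auto simp: theta_chain_def\<close>)
  then show "((\<lambda>z. \<Sum>j\<in>J. c j * g j n z) has_field_derivative (\<Sum>j\<in>J. c j * g j (Suc n) z) / z) (at z)"
    by (simp add: sum_divide_distrib)
qed

lemma picard_fuchs_sum:
  assumes S: "open S" "0 \<notin> S" and f: "\<And>j. j \<in> J \<Longrightarrow> f j holomorphic_on S"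
    "\<And>j z. j \<in> J \<Longrightarrow> z \<in> S \<Longrightarrow> picard_fuchs A B C (f j) z = 0" and z: "z \<in> S"
  shows "picard_fuchs A B C (\<lambda>z. \<Sum>j\<in>J. c j * f j z) z = 0"
proof -
  let ?g = "\<lambda>j n. (theta ^^ n) (f j)"
  have ch: "j \<in> J \<Longrightarrow> theta_chain S (?g j)" for j by (intro theta_chain_holomorphic S f)
  have "picard_fuchs A B C (\<lambda>z. \<Sum>j\<in>J. c j * f j z) z
      = (\<Sum>j\<in>J. c j * ?g j 4 z) - of_int C * z * tpoly A B (\<lambda>n. \<Sum>j\<in>J. c j * ?g j n z)"
    by (rule picard_fuchs_chain[OF S theta_chain_sum[OF ch] _ z]) auto
  also have "tpoly A B (\<lambda>n. \<Sum>j\<in>J. c j * ?g j n z) = (\<Sum>j\<in>J. c j * tpoly A B (\<lambda>n. ?g j n z))"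
    unfolding tpoly_expand sum_distrib_left sum.distrib[symmetric]
    by (intro sum.cong refl) (simp add: distrib_left mult.left_commute)
  also have "(\<Sum>j\<in>J. c j * ?g j 4 z) - of_int C * z * (\<Sum>j\<in>J. c j * tpoly A B (\<lambda>n. ?g j n z))
      = (\<Sum>j\<in>J. c j * (?g j 4 z - of_int C * z * tpoly A B (\<lambda>n. ?g j n z)))"
    by (simp add: sum_distrib_left sum_subtractf algebra_simps)
  also have "\<dots> = (\<Sum>j\<in>J. c j * picard_fuchs A B C (f j) z)"
    by (intro sum.cong refl) (subst picard_fuchs_chain[OF S ch _ z], auto)
  also have "\<dots> = 0" using f z by simp
  finally show ?thesis .
qed

text \<open>On a small ball around \<open>b\<close> the mean value inequality bounds the maximum of the jet by a
  fraction of itself.\<close>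

lemma theta_chain_unique:
  assumes b: "b \<in> S" "open S" "0 \<notin> S" and C: "\<And>z. z \<in> S \<Longrightarrow> of_int C * z \<noteq> 1"
    and g: "theta_chain S g" "\<And>z. z \<in> S \<Longrightarrow> g 4 z = of_int C * z * tpoly A B (\<lambda>n. g n z)"
    and init: "\<And>n. n < 4 \<Longrightarrow> g n b = 0"
  shows "\<exists>r>0. \<forall>z\<in>ball b r. z \<in> S \<and> g 0 z = 0"
proof -
  obtain r0 where r0: "r0 > 0" "cball b r0 \<subseteq> S" using b open_contains_cball by blast
  \<comment> \<open>Solving the equation for the fourth jet entry divides by 1 - C z, so
    \<open>q\<close> bounds that entry by the lower four. This is where C z = 1 has to be
    avoided.\<close>
  define q where "q = (\<lambda>z::complex. of_int C * z / (1 - of_int C * z))"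
  have "continuous_on (cball b r0) q" "continuous_on (cball b r0) inverse"
    unfolding q_def using r0 C b by (auto intro!: continuous_intros)
  then have "bounded (q ` cball b r0)" "bounded (inverse ` cball b r0)"
    by (simp_all add: compact_continuous_image compact_imp_bounded)
  then obtain Q M where "\<forall>x\<in>cball b r0. norm (q x) \<le> Q" "\<forall>x\<in>cball b r0. norm (inverse x) \<le> M"
    unfolding bounded_iff by auto
  then have Q: "\<And>z. z \<in> cball b r0 \<Longrightarrow> norm (q z) \<le> Q"
    and M: "\<And>z. z \<in> cball b r0 \<Longrightarrow> norm (inverse z) \<le> M"
    by blast+
  have Q0: "Q \<ge> 0" and M0: "M \<ge> 0"
    using order_trans[OF norm_ge_zero Q[of b]] order_trans[OF norm_ge_zero M[of b]] r0 by auto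
  define e2 e1 e0 where "e2 = \<bar>1 + A * (1 - A) + B * (1 - B)\<bar>"
    and "e1 = \<bar>A * (1 - A) + B * (1 - B)\<bar>" and "e0 = \<bar>A * (1 - A) * (B * (1 - B))\<bar>"
  define E where "E = 2 + e2 + e1 + e0"
  have en: "e2 \<ge> 0" "e1 \<ge> 0" "e0 \<ge> 0" by (auto simp: e2_def e1_def e0_def)
  define N where "N = (\<lambda>z. norm (g 0 z) + norm (g 1 z) + norm (g 2 z) + norm (g 3 z))"
  have N4: "norm (g 4 z) \<le> Q * (E * N z)" if z: "z \<in> cball b r0" for z
  proof -
    let ?r = "2 * g 3 z + of_real (1 + A * (1 - A) + B * (1 - B)) * g 2 z
        + of_real (A * (1 - A) + B * (1 - B)) * g 1 z + of_real (A * (1 - A) * (B * (1 - B))) * g 0 z"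
    have "g 4 z = of_int C * z * (g 4 z + ?r)"
      using g(2)[of z] r0 z unfolding tpoly_expand by (auto simp: add.assoc)
    then have "g 4 z * (1 - of_int C * z) = of_int C * z * ?r" by (simp add: algebra_simps)
    then have "g 4 z = q z * ?r"
      using C[of z] r0 z by (auto simp: q_def field_simps)
    moreover have "norm ?r \<le> E * N z"
    proof -
      have "norm ?r \<le> 2 * norm (g 3 z) + e2 * norm (g 2 z) + e1 * norm (g 1 z) + e0 * norm (g 0 z)"
        unfolding e2_def e1_def e0_def
        by (intro norm_triangle_mono order.refl) (simp_all only: norm_mult norm_of_real norm_numeral order.refl)
      also have "\<dots> \<le> E * norm (g 3 z) + E * norm (g 2 z) + E * norm (g 1 z) + E * norm (g 0 z)"
        using en by (intro add_mono mult_right_mono) (auto simp: E_def)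
      finally show ?thesis by (simp add: N_def algebra_simps)
    qed
    ultimately show ?thesis using Q[OF z] Q0 by (simp only: norm_mult) (intro mult_mono, auto)
  qed
  define K where "K = (1 + Q * E) * M"
  have E0: "E \<ge> 0" using en by (simp add: E_def)
  have K0: "K \<ge> 0" using Q0 M0 E0 by (simp add: K_def)
  have Nn: "N z \<ge> 0" for z by (simp add: N_def)
  have der: "norm (g (Suc i) z / z) \<le> K * N z" if z: "z \<in> cball b r0" and i: "i < 4" for i z
  proof -
    have "norm (g (Suc i) z) \<le> (1 + Q * E) * N z"
    proof (cases "i = 3")
      case True
      then show ?thesis using N4[OF z] Nn[of z] by (simp add: algebra_simps)
    next
      case False
      then have "i = 0 \<or> i = 1 \<or> i = 2" using i by auto
      then have "norm (g (Suc i) z) \<le> N z" by (auto simp: N_def eval_nat_numeral)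
      also have "\<dots> \<le> (1 + Q * E) * N z" using Q0 E0 Nn[of z] by (simp add: algebra_simps)
      finally show ?thesis .
    qed
    then have "norm (g (Suc i) z) * norm (inverse z) \<le> ((1 + Q * E) * N z) * M"
      using M[OF z] Q0 E0 Nn by (intro mult_mono) auto
    then show ?thesis by (simp add: K_def divide_inverse norm_mult mult_ac)
  qed
  \<comment> \<open>The radius is chosen so that four jet entries, each at most K r times the
    maximum of \<open>N\<close>, add up to strictly less than a positive maximum.\<close>
  define r where "r = min r0 (1 / (8 * K + 8))"
  have r: "r > 0" "r \<le> r0" "4 * K * r < 1"
  proof -
    show "r > 0" "r \<le> r0" using r0 K0 by (auto simp: r_def)
    have "4 * K * r \<le> 4 * K * (1 / (8 * K + 8))" using K0 by (intro mult_left_mono) (auto simp: r_def)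
    also have "\<dots> < 1" using K0 by (simp add: field_simps)
    finally show "4 * K * r < 1" .
  qed
  have sub: "cball b r \<subseteq> cball b r0" using r by auto
  have contg: "continuous_on (cball b r) (g i)" for i
  proof (rule DERIV_continuous_on)
    fix x assume "x \<in> cball b r"
    then have "x \<in> S" using sub r0 by blast
    then show "(g i has_field_derivative g (Suc i) x / x) (at x within cball b r)"
      using g(1) by (auto simp: theta_chain_def intro: has_field_derivative_at_within)
  qed
  have "continuous_on (cball b r) N" unfolding N_def by (intro continuous_intros contg)
  then obtain x where x: "x \<in> cball b r" "\<And>z. z \<in> cball b r \<Longrightarrow> N z \<le> N x"
    using continuous_attains_sup[of "cball b r" N] r by (auto simp: less_imp_le)
  have gi: "norm (g i x) \<le> K * N x * r" if i: "i < 4" for i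
  proof -
    have "norm (g i x - g i b) \<le> (K * N x) * norm (x - b)"
    proof (rule field_differentiable_bound[where S = "cball b r" and f' = "\<lambda>z. g (Suc i) z / z"])
      fix z assume z: "z \<in> cball b r"
      then have "z \<in> S" using sub r0 by blast
      then show "(g i has_field_derivative g (Suc i) z / z) (at z within cball b r)"
        using g(1) by (auto simp: theta_chain_def intro: has_field_derivative_at_within)
      have "norm (g (Suc i) z / z) \<le> K * N z" using der[OF _ i] z sub by blast
      also have "\<dots> \<le> K * N x" using x(2)[OF z] K0 by (intro mult_left_mono)
      finally show "norm (g (Suc i) z / z) \<le> K * N x" .
    qed (use x r in auto)
    also have "\<dots> \<le> (K * N x) * r"
      using x(1) K0 Nn[of x] by (intro mult_left_mono) (auto simp: dist_norm norm_minus_commute)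
    finally show ?thesis using init[OF i] by simp
  qed
  have "N x \<le> K * N x * r + K * N x * r + K * N x * r + K * N x * r"
  proof -
    have "N x = norm (g 0 x) + norm (g 1 x) + norm (g 2 x) + norm (g 3 x)" by (simp add: N_def)
    then show ?thesis using gi[of 0] gi[of 1] gi[of 2] gi[of 3] by linarith
  qed
  then have le: "N x * (1 - 4 * K * r) \<le> 0" by (simp add: algebra_simps)
  have "N x = 0"
  proof (rule ccontr)
    assume "N x \<noteq> 0"
    then have "N x > 0" using Nn[of x] by simp
    then have "0 < N x * (1 - 4 * K * r)" using r by (intro mult_pos_pos) auto
    then show False using le by simp
  qed
  then have "g 0 z = 0" if "z \<in> cball b r" for z
  proof -
    have "norm (g 0 z) \<le> N z" by (simp add: N_def)
    also have "\<dots> \<le> N x" by (rule x(2)[OF that])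
    finally show ?thesis using \<open>N x = 0\<close> by simp
  qed
  then show ?thesis using r sub r0 by (intro exI[of _ r]) force
qed


section \<open>The local solution space has dimension four\<close>

lemma local_solution_ball:
  assumes "local_solution (picard_fuchs A B C) b h" "open S" "b \<in> S"
  obtains r where "r > 0" "ball b r \<subseteq> S" "h holomorphic_on ball b r"
    "\<And>z. z \<in> ball b r \<Longrightarrow> picard_fuchs A B C h z = 0"
proof -
  obtain r1 where r1: "r1 > 0" "h holomorphic_on ball b r1"
    using assms by (auto simp: local_solution_def analytic_on_def)
  obtain r2 where r2: "r2 > 0" "\<And>z. dist z b < r2 \<Longrightarrow> picard_fuchs A B C h z = 0"
    using assms by (auto simp: local_solution_def eventually_nhds_metric)
  obtain r3 where r3: "r3 > 0" "ball b r3 \<subseteq> S" using assms open_contains_ball by blast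
  show ?thesis
  proof (rule that[of "min r1 (min r2 r3)"])
    show "h holomorphic_on ball b (min r1 (min r2 r3))"
      by (rule holomorphic_on_subset[OF r1(2)]) auto
    show "ball b (min r1 (min r2 r3)) \<subseteq> S" using r3 by (auto simp: subset_iff)
  qed (use r1 r2 r3 in \<open>auto simp: dist_commute\<close>)
qed

lemma solution_unique:
  assumes S: "open S" "0 \<notin> S" "b \<in> S" "\<And>z. z \<in> S \<Longrightarrow> of_int C * z \<noteq> 1"
    and f: "f holomorphic_on S" "\<And>z. z \<in> S \<Longrightarrow> picard_fuchs A B C f z = 0"
    and init: "\<And>n. n < 4 \<Longrightarrow> (theta ^^ n) f b = 0"
  shows "\<forall>\<^sub>F z in nhds b. f z = 0"
proof -
  have ch: "theta_chain S (\<lambda>n. (theta ^^ n) f)" by (rule theta_chain_holomorphic) fact+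
  have "\<exists>r>0. \<forall>z\<in>ball b r. z \<in> S \<and> (theta ^^ 0) f z = 0"
  proof (rule theta_chain_unique[where C = C and A = A and B = B])
    fix z assume z: "z \<in> S"
    show "(theta ^^ 4) f z = of_int C * z * tpoly A B (\<lambda>n. (theta ^^ n) f z)"
      using picard_fuchs_chain[OF S(1,2) ch _ z, of f A B C] f(2)[OF z] by simp
  qed (use S ch init in auto)
  then obtain r where "r > 0" "\<forall>z\<in>ball b r. f z = 0" by auto
  then show ?thesis unfolding eventually_nhds_metric by (auto simp: dist_commute)
qed

text \<open>Sending coefficients to the 4-jet of the combination at \<open>b\<close> is injective: a
  combination with zero jet vanishes near \<open>b\<close>, hence on the connected set
  \<open>S\<close>, and independence applies. By dimension the map is onto.\<close>

lemma jets_span: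
  fixes f :: "nat \<Rightarrow> complex \<Rightarrow> complex"
  assumes S: "open S" "0 \<notin> S" "connected S" "b \<in> S" "\<And>z. z \<in> S \<Longrightarrow> of_int C * z \<noteq> 1"
    and f: "\<And>j. j < 4 \<Longrightarrow> f j holomorphic_on S" "\<And>j z. j < 4 \<Longrightarrow> z \<in> S \<Longrightarrow> picard_fuchs A B C (f j) z = 0"
    and indep: "\<forall>c. (\<forall>z\<in>S. (\<Sum>j<4. c j * f j z) = 0) \<longrightarrow> (\<forall>j<4. c j = 0)"
  shows "\<exists>c. \<forall>n<4. (\<Sum>j<4. c j * (theta ^^ n) (f j) b) = v n"
proof -
  \<comment> \<open>Quadruples form a Euclidean space, in which an injective linear endomorphism is
    onto; linearity over the reals is enough for that.\<close>
  define \<Phi> :: "complex \<times> complex \<times> complex \<times> complex \<Rightarrow> complex \<times> complex \<times> complex \<times> complex" where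
    "\<Phi> = (\<lambda>(c0, c1, c2, c3). let J = (\<lambda>n. c0 * (theta ^^ n) (f 0) b + c1 * (theta ^^ n) (f 1) b
        + c2 * (theta ^^ n) (f 2) b + c3 * (theta ^^ n) (f 3) b) in (J 0, J 1, J 2, J 3))"
  define cc :: "complex \<times> complex \<times> complex \<times> complex \<Rightarrow> nat \<Rightarrow> complex" where
    "cc = (\<lambda>(c0, c1, c2, c3). \<lambda>n. if n = 0 then c0 else if n = 1 then c1 else if n = 2 then c2 else c3)"
  have sum4: "(\<Sum>j<4. g j) = g 0 + g 1 + g 2 + g 3" for g :: "nat \<Rightarrow> complex"
    by (simp add: eval_nat_numeral)
  have \<Phi>: "\<Phi> c = ((\<Sum>j<4. cc c j * (theta ^^ 0) (f j) b), (\<Sum>j<4. cc c j * (theta ^^ 1) (f j) b),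
      (\<Sum>j<4. cc c j * (theta ^^ 2) (f j) b), (\<Sum>j<4. cc c j * (theta ^^ 3) (f j) b))" for c
    by (cases c) (simp add: \<Phi>_def cc_def sum4 Let_def)
  have lin: "linear \<Phi>"
    by (rule linearI) (auto simp: \<Phi>_def Let_def algebra_simps scaleR_conv_of_real split: prod.splits)
  have ker: "c = 0" if c: "\<Phi> c = 0" for c
  proof -
    let ?h = "\<lambda>z. \<Sum>j\<in>{..<4}. cc c j * f j z"
    have ch: "theta_chain S (\<lambda>n z. \<Sum>j\<in>{..<4}. cc c j * (theta ^^ n) (f j) z)"
      by (rule theta_chain_sum) (use theta_chain_holomorphic S f in auto)
    have hol: "?h holomorphic_on S" by (intro holomorphic_intros f) auto
    have "\<forall>\<^sub>F z in nhds b. ?h z = 0"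
    proof (rule solution_unique[OF S(1,2,4,5) hol])
      show "picard_fuchs A B C ?h z = 0" if "z \<in> S" for z
        by (rule picard_fuchs_sum[OF S(1,2) _ _ that]) (use f in auto)
      fix n :: nat assume n: "n < 4"
      have "(theta ^^ n) ?h b = (\<Sum>j\<in>{..<4}. cc c j * (theta ^^ n) (f j) b)"
        by (rule theta_chain_funpow[OF S(1,2) ch]) (use S in auto)
      moreover have "n = 0 \<or> n = 1 \<or> n = 2 \<or> n = 3" using n by auto
      ultimately show "(theta ^^ n) ?h b = 0" using c unfolding \<Phi> by (auto simp: zero_prod_def)
    qed (use S in auto)
    then obtain T where T: "open T" "b \<in> T" "\<And>z. z \<in> T \<Longrightarrow> ?h z = 0"
      by (auto simp: eventually_nhds)
    have "?h z = 0" if "z \<in> S" for z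
      by (rule analytic_continuation_open[of "S \<inter> T" S ?h "\<lambda>_. 0"]) (use T S hol that in \<open>auto intro: open_Int\<close>)
    then have "cc c j = 0" if "j < 4" for j using indep[rule_format, of "cc c", OF _ that] by blast
    from this[of 0] this[of 1] this[of 2] this[of 3] show ?thesis
      by (cases c) (simp add: cc_def zero_prod_def)
  qed
  have "inj \<Phi>" using ker lin by (auto simp: linear_injective_0)
  then have "surj \<Phi>" using lin linear_injective_imp_surjective by blast
  then obtain c where c: "\<Phi> c = (v 0, v 1, v 2, v 3)" by (metis surjD)
  show ?thesis
  proof (intro exI[of _ "cc c"] allI impI)
    fix n :: nat assume "n < 4"
    then have "n = 0 \<or> n = 1 \<or> n = 2 \<or> n = 3" by auto
    then show "(\<Sum>j<4. cc c j * (theta ^^ n) (f j) b) = v n" using c unfolding \<Phi> by auto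
  qed
qed

text \<open>Take the combination with the same 4-jet at \<open>b\<close> as \<open>h\<close>; the
  difference is a solution with zero jet and so vanishes near \<open>b\<close>.\<close>

lemma local_solution_expansion:
  fixes f :: "nat \<Rightarrow> complex \<Rightarrow> complex"
  assumes S: "open S" "0 \<notin> S" "connected S" "b \<in> S" "\<And>z. z \<in> S \<Longrightarrow> of_int C * z \<noteq> 1"
    and f: "\<And>j. j < 4 \<Longrightarrow> f j holomorphic_on S" "\<And>j z. j < 4 \<Longrightarrow> z \<in> S \<Longrightarrow> picard_fuchs A B C (f j) z = 0"
    and indep: "\<forall>c. (\<forall>z\<in>S. (\<Sum>j<4. c j * f j z) = 0) \<longrightarrow> (\<forall>j<4. c j = 0)"
    and h: "local_solution (picard_fuchs A B C) b h"
  shows "\<exists>c. \<forall>\<^sub>F z in nhds b. h z = (\<Sum>j<4. c j * f j z)"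
proof -
  obtain c where c: "\<forall>n<4. (\<Sum>j<4. c j * (theta ^^ n) (f j) b) = (theta ^^ n) h b"
    using jets_span[where f = f, OF S f indep, of "\<lambda>n. (theta ^^ n) h b"] by blast
  obtain r where r: "r > 0" "ball b r \<subseteq> S" "h holomorphic_on ball b r"
    "\<And>z. z \<in> ball b r \<Longrightarrow> picard_fuchs A B C h z = 0"
    using local_solution_ball[OF h S(1,4)] by metis
  have b: "b \<in> ball b r" "0 \<notin> ball b r" using r(1,2) S(2) by (simp, blast)
  \<comment> \<open>Index 4 carries \<open>h\<close> itself, which makes the difference one finite
    combination of solutions.\<close>
  define F where "F = (\<lambda>j. if j = (4::nat) then h else f j)"
  define e where "e = (\<lambda>j. if j = (4::nat) then 1 else - c j)"
  let ?h = "\<lambda>z. \<Sum>j\<in>{..<5}. e j * F j z"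
  have F: "F j holomorphic_on ball b r" "z \<in> ball b r \<Longrightarrow> picard_fuchs A B C (F j) z = 0"
    if "j \<in> {..<5}" for j z
    using that r f holomorphic_on_subset[OF f(1) r(2)] by (auto simp: F_def subset_iff)
  have sum5: "(\<Sum>j\<in>{..<5}. e j * G j) = G 4 - (\<Sum>j<4. c j * G j)" for G
    by (simp add: eval_nat_numeral e_def)
  have ch: "theta_chain (ball b r) (\<lambda>n z. \<Sum>j\<in>{..<5}. e j * (theta ^^ n) (F j) z)"
    by (rule theta_chain_sum) (use theta_chain_holomorphic F b in auto)
  have "\<forall>\<^sub>F z in nhds b. ?h z = 0"
  proof (rule solution_unique[OF _ b(2,1)])
    show "?h holomorphic_on ball b r" by (intro holomorphic_intros F) auto
    show "picard_fuchs A B C ?h z = 0" if "z \<in> ball b r" for z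
      by (rule picard_fuchs_sum[OF _ b(2) F(1) F(2) that]) auto
    show "of_int C * z \<noteq> 1" if "z \<in> ball b r" for z using S(5) that r(2) by blast
    fix n :: nat assume n: "n < 4"
    have "(theta ^^ n) ?h b = (\<Sum>j\<in>{..<5}. e j * (theta ^^ n) (F j) b)"
      by (rule theta_chain_funpow[OF _ b(2) ch]) (use b in auto)
    also have "\<dots> = (theta ^^ n) h b - (\<Sum>j<4. c j * (theta ^^ n) (f j) b)"
      unfolding sum5 by (auto simp: F_def intro!: sum.cong)
    finally show "(theta ^^ n) ?h b = 0" using c n by simp
  qed auto
  then have "\<forall>\<^sub>F z in nhds b. h z = (\<Sum>j<4. c j * f j z)"
  proof (rule eventually_mono)
    fix z assume "?h z = 0"
    then have "h z - (\<Sum>j<4. c j * F j z) = 0" unfolding sum5 by (simp add: F_def)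
    also have "(\<Sum>j<4. c j * F j z) = (\<Sum>j<4. c j * f j z)" by (intro sum.cong) (auto simp: F_def)
    finally show "h z = (\<Sum>j<4. c j * f j z)" by simp
  qed
  then show ?thesis by blast
qed

theorem solution_basisI:
  fixes f :: "nat \<Rightarrow> complex \<Rightarrow> complex"
  assumes S: "open S" "0 \<notin> S" "connected S" "b \<in> S" "\<And>z. z \<in> S \<Longrightarrow> of_int C * z \<noteq> 1"
    and f: "\<And>j. j < 4 \<Longrightarrow> fs ! j holomorphic_on S" "\<And>j z. j < 4 \<Longrightarrow> z \<in> S \<Longrightarrow> picard_fuchs A B C (fs ! j) z = 0"
    and len: "length fs = 4"
    and indep: "\<forall>c. (\<forall>z\<in>S. (\<Sum>j<4. c j * (fs ! j) z) = 0) \<longrightarrow> (\<forall>j<4. c j = 0)"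
  shows "solution_basis (picard_fuchs A B C) b fs"
  unfolding solution_basis_def
proof (intro conjI ballI allI impI)
  fix f assume "f \<in> set fs"
  then obtain j where j: "j < 4" "f = fs ! j" using len by (metis in_set_conv_nth)
  show "local_solution (picard_fuchs A B C) b f"
    unfolding local_solution_def j(2)
  proof
    show "fs ! j analytic_on {b}" using f(1)[OF j(1)] S by (auto simp: analytic_on_holomorphic)
    show "\<forall>\<^sub>F z in nhds b. picard_fuchs A B C (fs ! j) z = 0"
      by (rule eventually_mono[OF eventually_nhds_in_open[OF S(1,4)] f(2)[OF j(1)]])
  qed
next
  fix h assume h: "local_solution (picard_fuchs A B C) b h"
  obtain c where c: "\<forall>\<^sub>F z in nhds b. h z = (\<Sum>j<4. c j * (fs ! j) z)"
    using local_solution_expansion[where f = "(!) fs", OF S f indep h] by blast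
  show "\<exists>!c. c \<in> carrier_vec (length fs) \<and> (\<forall>\<^sub>F z in nhds b. h z = (\<Sum>j<length fs. vec_index c j * (fs ! j) z))"
  proof (rule ex1I[of _ "Matrix.vec 4 c"])
    have "(\<Sum>j<4. vec_index (Matrix.vec 4 c) j * (fs ! j) z) = (\<Sum>j<4. c j * (fs ! j) z)" for z
      by (intro sum.cong) auto
    then show "Matrix.vec 4 c \<in> carrier_vec (length fs) \<and> (\<forall>\<^sub>F z in nhds b. h z = (\<Sum>j<length fs. vec_index (Matrix.vec 4 c) j * (fs ! j) z))"
      using c len by simp
  next
    fix c' assume c': "c' \<in> carrier_vec (length fs) \<and> (\<forall>\<^sub>F z in nhds b. h z = (\<Sum>j<length fs. vec_index c' j * (fs ! j) z))"
    let ?h = "\<lambda>z. \<Sum>j<4. (vec_index c' j - c j) * (fs ! j) z"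
    have "\<forall>\<^sub>F z in nhds b. ?h z = 0"
      using c conjunct2[OF c'] unfolding len
      by eventually_elim (simp add: algebra_simps sum_subtractf)
    then obtain T where T: "open T" "b \<in> T" "\<And>z. z \<in> T \<Longrightarrow> ?h z = 0"
      by (auto simp: eventually_nhds)
    have hol: "?h holomorphic_on S" by (intro holomorphic_intros f) auto
    have "?h z = 0" if "z \<in> S" for z
      by (rule analytic_continuation_open[of "S \<inter> T" S ?h "\<lambda>_. 0"]) (use T S hol that in \<open>auto intro: open_Int\<close>)
    then have "vec_index c' j - c j = 0" if "j < 4" for j
      using indep[rule_format, of "\<lambda>j. vec_index c' j - c j", OF _ that] by blast
    then show "c' = Matrix.vec 4 c" using c' len by (intro eq_vecI) auto
  qed
qed

section \<open>The Frobenius basis\<close>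

text \<open>Dividing by the top power of \<open>w\<close> isolates the leading coefficient; once it
  is seen to be zero, the degree drops.\<close>

lemma tendsto_polynomial_zero:
  fixes a :: "nat \<Rightarrow> complex"
  assumes F: "F \<noteq> bot" and w: "filterlim w at_infinity F"
    and lim: "((\<lambda>r. \<Sum>j<n. a j * w r ^ j) \<longlongrightarrow> 0) F"
  shows "\<forall>j<n. a j = 0"
  using lim
proof (induction n)
  case (Suc n)
  have inv: "((\<lambda>r. inverse (w r)) \<longlongrightarrow> 0) F" by (rule filterlim_compose[OF tendsto_inverse_0 w])
  have ev: "\<forall>\<^sub>F r in F. w r \<noteq> 0"
    using w by (auto simp: filterlim_at_infinity[OF order.refl] elim!: allE[of _ 1] eventually_mono)
  have 1: "((\<lambda>r. (\<Sum>j<Suc n. a j * w r ^ j) * inverse (w r) ^ n) \<longlongrightarrow> 0 * 0 ^ n) F"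
    by (intro tendsto_intros Suc.prems inv)
  have 2: "((\<lambda>r. (\<Sum>j<n. a j * inverse (w r) ^ (n - j)) + a n) \<longlongrightarrow> (\<Sum>j<n. a j * 0 ^ (n - j)) + a n) F"
    by (intro tendsto_intros inv)
  have eq: "\<forall>\<^sub>F r in F. (\<Sum>j<Suc n. a j * w r ^ j) * inverse (w r) ^ n = (\<Sum>j<n. a j * inverse (w r) ^ (n - j)) + a n"
    using ev
  proof eventually_elim
    case (elim r)
    have "w r ^ j * inverse (w r) ^ n = inverse (w r) ^ (n - j)" if "j \<le> n" for j
    proof -
      have "w r ^ j * inverse (w r) ^ n = w r ^ j * (inverse (w r) ^ j * inverse (w r) ^ (n - j))"
        using that by (simp flip: power_add)
      also have "\<dots> = inverse (w r) ^ (n - j)"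
        using elim by (simp add: mult.assoc[symmetric] power_mult_distrib[symmetric])
      finally show ?thesis .
    qed
    from this[of n] this show ?case
      by (simp add: sum_distrib_right distrib_right mult.assoc)
  qed
  from 2 have "((\<lambda>r. (\<Sum>j<Suc n. a j * w r ^ j) * inverse (w r) ^ n) \<longlongrightarrow> (\<Sum>j<n. a j * 0 ^ (n - j)) + a n) F"
    by (rule Lim_transform_eventually) (rule eventually_mono[OF eq], simp)
  with 1 have "(\<Sum>j<n. a j * 0 ^ (n - j)) + a n = 0 * 0 ^ n"
    using tendsto_unique[OF F] by blast
  moreover have "(\<Sum>j<n. a j * 0 ^ (n - j)) = 0" by (intro sum.neutral) (auto simp: power_0_left)
  ultimately have "a n = 0" by simp
  moreover have "\<forall>j<n. a j = 0" using Suc.IH Suc.prems \<open>a n = 0\<close> by simp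
  ultimately show ?case by (auto simp: less_Suc_eq)
qed simp

text \<open>A path to 0 along the positive imaginary axis, with r = -log|z|. Asymptotics are tested
  here because arg z = pi/2 is interior to the strip of convergence of every kernel in use.\<close>

definition imag_ray :: "real \<Rightarrow> complex" where
  "imag_ray r = \<i> * of_real (exp (- r))"

lemma Ln_imag_ray: "Ln (imag_ray r) = - of_real r + \<i> * of_real (pi / 2)"
proof -
  have "Ln (of_real (exp (- r)) * \<i>) = of_real (ln (exp (- r))) + Ln \<i>"
    by (simp add: Ln_times_of_real Ln_of_real del: of_real_exp)
  then show ?thesis by (simp add: imag_ray_def mult.commute)
qed

lemma norm_imag_ray: "norm (imag_ray r) = exp (- r)"
  by (simp add: imag_ray_def norm_mult del: of_real_exp)

lemma Ln_imag_ray_at_infinity: "filterlim (\<lambda>r. Ln (imag_ray r)) at_infinity at_top"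
proof -
  have "filterlim (\<lambda>r::real. norm (Ln (imag_ray r))) at_top at_top"
  proof (rule filterlim_at_top_mono)
    show "filterlim (\<lambda>r::real. r) at_top at_top" by (rule filterlim_ident)
    have "r \<le> norm (Ln (imag_ray r))" for r
      using abs_Re_le_cmod[of "Ln (imag_ray r)"] by (simp add: Ln_imag_ray)
    then show "\<forall>\<^sub>F r in at_top. r \<le> norm (Ln (imag_ray r))" by simp
  qed
  then show ?thesis by (simp add: filterlim_at_infinity_conv_norm_at_top)
qed

lemma imag_ray_tendsto_0: "(imag_ray \<longlongrightarrow> 0) at_top"
proof -
  have "((\<lambda>r::real. exp (- r)) \<longlongrightarrow> 0) at_top"
    by (rule filterlim_compose[OF exp_at_bot filterlim_uminus_at_bot_at_top])
  from tendsto_mult[OF tendsto_const[of \<i>] tendsto_of_real[OF this]]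
  show ?thesis unfolding imag_ray_def by simp
qed

lemma imag_ray_Ln_power_tendsto_0: "((\<lambda>r. imag_ray r * Ln (imag_ray r) ^ k) \<longlongrightarrow> 0) at_top"
proof (rule Lim_null_comparison)
  show "\<forall>\<^sub>F r in at_top. norm (imag_ray r * Ln (imag_ray r) ^ k) \<le> 3 ^ k * (r ^ k / exp r)"
    using eventually_ge_at_top[of "1::real"]
  proof eventually_elim
    case (elim r)
    have "norm (Ln (imag_ray r)) \<le> norm (- complex_of_real r) + norm (\<i> * complex_of_real (pi / 2))"
      unfolding Ln_imag_ray by (rule norm_triangle_ineq)
    also have "\<dots> = r + pi / 2" using elim by (simp add: norm_mult)
    also have "\<dots> \<le> 3 * r" using elim pi_less_4 by simp
    finally have "norm (Ln (imag_ray r)) ^ k \<le> (3 * r) ^ k" by (intro power_mono) auto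
    then have "exp (- r) * norm (Ln (imag_ray r)) ^ k \<le> exp (- r) * (3 * r) ^ k" by (intro mult_left_mono) auto
    then show ?case by (simp add: norm_imag_ray norm_mult norm_power power_mult_distrib exp_minus field_simps)
  qed
  show "((\<lambda>r::real. 3 ^ k * (r ^ k / exp r)) \<longlongrightarrow> 0) at_top"
    using tendsto_mult_right_zero[OF tendsto_power_div_exp_0[of k]] by blast
qed

text \<open>A zero at the origin gives g(z) = O(z), which beats every power of the
  logarithm.\<close>

lemma holomorphic_Ln_power_tendsto_0:
  assumes g: "g holomorphic_on ball 0 \<rho>" "g 0 = 0" and \<rho>: "\<rho> > 0"
  shows "((\<lambda>r. g (imag_ray r) * Ln (imag_ray r) ^ k) \<longlongrightarrow> 0) at_top"
proof -
  have "(g has_field_derivative deriv g 0) (at 0)"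
    using holomorphic_derivI[OF g(1)] \<rho> by auto
  then have "((\<lambda>h. g h / h) \<longlongrightarrow> deriv g 0) (at 0)" using g(2) by (simp add: DERIV_def)
  moreover have "filterlim imag_ray (at 0) at_top"
    using imag_ray_tendsto_0 by (auto simp: filterlim_at imag_ray_def)
  ultimately have "((\<lambda>r. g (imag_ray r) / imag_ray r) \<longlongrightarrow> deriv g 0) at_top"
    by (rule filterlim_compose)
  from tendsto_mult[OF this imag_ray_Ln_power_tendsto_0[of k]]
  show ?thesis by (simp add: imag_ray_def)
qed

lemma less4: "j < 4 \<longleftrightarrow> j = 0 \<or> j = 1 \<or> j = 2 \<or> j = (3::nat)"
  by auto

lemma sum4: "(\<Sum>j<4. g j) = g 0 + g 1 + g 2 + g 3" for g :: "nat \<Rightarrow> complex"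
  by (simp add: eval_nat_numeral)

locale frobenius =
  fixes A B :: real and C :: int and y0 y1 y2 y3 :: "complex \<Rightarrow> complex"
  assumes C: "C > 0" and frob: "frobenius_basis (picard_fuchs A B C) (1 / C) y0 y1 y2 y3"
begin

definition y :: "nat \<Rightarrow> complex \<Rightarrow> complex" where
  "y j = [y0, y1, y2, y3] ! j"

definition slit_disc :: "complex set" where
  "slit_disc = ball 0 (1 / C) - \<real>\<^sub>\<le>\<^sub>0"

text \<open>The comparison with contour integrals takes place here: the integral representing
  \<open>y0\<close> converges for arg x in (0, pi), but not just below the positive axis.\<close>

definition half_disc :: "complex set" where
  "half_disc = ball 0 (1 / C) \<inter> {z. Im z > 0}"

lemma y_simps: "y 0 = y0" "y 1 = y1" "y (Suc 0) = y1" "y 2 = y2" "y 3 = y3"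
  by (simp_all add: y_def)

lemma slit_disc: "open slit_disc" "0 \<notin> slit_disc" "connected slit_disc"
  "\<And>z. z \<in> slit_disc \<Longrightarrow> of_int C * z \<noteq> 1"
proof -
  show "open slit_disc" by (auto simp: slit_disc_def intro!: open_Diff)
  show "0 \<notin> slit_disc" by (auto simp: slit_disc_def)
  show "connected slit_disc"
  proof (cases "slit_disc = {}")
    case False
    have "starlike slit_disc"
      unfolding starlike_def
    proof (intro bexI ballI)
      define a where "a = complex_of_real (1 / (2 * real_of_int C))"
      show a: "a \<in> slit_disc" using C by (auto simp: a_def slit_disc_def complex_nonpos_Reals_iff norm_divide norm_mult field_simps)
      fix x assume x: "x \<in> slit_disc"
      have "closed_segment a x \<subseteq> ball 0 (1 / C)"
        using a x by (intro closed_segment_subset) (auto simp: slit_disc_def)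
      moreover have "closed_segment a x \<subseteq> - complex_of_real ` {..0}"
        unfolding a_def
        by (rule starlike_slotted_complex_plane_left_aux)
          (use x C in \<open>auto simp: slit_disc_def complex_nonpos_Reals_iff\<close>)
      ultimately show "closed_segment a x \<subseteq> slit_disc" 
        by (force simp: slit_disc_def elim!: nonpos_Reals_cases)
    qed
    then show ?thesis by (rule starlike_imp_connected)
  qed simp
  fix z assume z: "z \<in> slit_disc"
  show "of_int C * z \<noteq> 1"
  proof
    assume "of_int C * z = 1"
    then have "z = of_real (1 / C)" using C by (simp add: field_simps)
    then show False using z C by (simp add: slit_disc_def norm_divide)
  qed
qed

lemma half_disc: "open half_disc" "connected half_disc" "half_disc \<subseteq> slit_disc" "0 \<notin> half_disc"
proof -
  show "open half_disc" by (auto simp: half_disc_def intro!: open_Int open_halfspace_Im_gt)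
  show "connected half_disc"
    unfolding half_disc_def by (intro convex_connected convex_Int convex_ball convex_halfspace_Im_gt)
  show "half_disc \<subseteq> slit_disc" "0 \<notin> half_disc"
    by (auto simp: half_disc_def slit_disc_def complex_nonpos_Reals_iff)
qed

lemma imag_ray_half_disc: "\<forall>\<^sub>F r in at_top. imag_ray r \<in> half_disc"
proof -
  have "\<forall>\<^sub>F r in at_top. dist (imag_ray r) 0 < 1 / C"
    using imag_ray_tendsto_0 C by (intro tendstoD) auto
  then show ?thesis by eventually_elim (auto simp: half_disc_def imag_ray_def)
qed

text \<open>For the asymptotics: all corrections have the form g(z) log^k z with g holomorphic and
  g(0) = 0. On the ray \<open>y j\<close> is thus log^j z / j! up to o(1), and the four functions
  are separated by the growth of the logarithm.\<close>

lemma y_holomorphic: "j < 4 \<Longrightarrow> y j holomorphic_on slit_disc"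
  and y_solution: "j < 4 \<Longrightarrow> z \<in> slit_disc \<Longrightarrow> picard_fuchs A B C (y j) z = 0"
  and y_asymp: "j < 4 \<Longrightarrow> ((\<lambda>r. y j (imag_ray r) - Ln (imag_ray r) ^ j / fact j) \<longlongrightarrow> 0) at_top"
proof -
  obtain g1 g2 g3 where y0: "y0 holomorphic_on ball 0 (1 / C)" "y0 0 = 1"
    and g: "\<And>g. g \<in> {g1, g2, g3} \<Longrightarrow> g holomorphic_on ball 0 (1 / C)" "\<And>g. g \<in> {g1, g2, g3} \<Longrightarrow> g 0 = 0"
    and ys: "\<And>z. z \<in> slit_disc \<Longrightarrow> y1 z = y0 z * Ln z + g1 z"
      "\<And>z. z \<in> slit_disc \<Longrightarrow> y2 z = y0 z * Ln z ^ 2 / 2 + g1 z * Ln z + g2 z"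
      "\<And>z. z \<in> slit_disc \<Longrightarrow> y3 z = y0 z * Ln z ^ 3 / 6 + g1 z * Ln z ^ 2 / 2 + g2 z * Ln z + g3 z"
    and sol: "\<And>y z. y \<in> {y0, y1, y2, y3} \<Longrightarrow> z \<in> slit_disc \<Longrightarrow> picard_fuchs A B C y z = 0"
    using frob unfolding frobenius_basis_def slit_disc_def by blast
  note h0 = holomorphic_on_subset[OF y0(1), of slit_disc]
  have sub: "slit_disc \<subseteq> ball 0 (1 / C)" "slit_disc \<inter> \<real>\<^sub>\<le>\<^sub>0 = {}" by (auto simp: slit_disc_def)
  have hg: "g1 holomorphic_on slit_disc" "g2 holomorphic_on slit_disc" "g3 holomorphic_on slit_disc"
    using g(1) sub(1) holomorphic_on_subset by blast+
  have "(\<lambda>z. y0 z * Ln z + g1 z) holomorphic_on slit_disc"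
    "(\<lambda>z. y0 z * Ln z ^ 2 / 2 + g1 z * Ln z + g2 z) holomorphic_on slit_disc"
    "(\<lambda>z. y0 z * Ln z ^ 3 / 6 + g1 z * Ln z ^ 2 / 2 + g2 z * Ln z + g3 z) holomorphic_on slit_disc"
    using sub by (auto intro!: holomorphic_intros h0 hg)
  then have "y1 holomorphic_on slit_disc" "y2 holomorphic_on slit_disc" "y3 holomorphic_on slit_disc"
    using ys holomorphic_cong[OF refl] by (metis (no_types, lifting))+
  then show "j < 4 \<Longrightarrow> y j holomorphic_on slit_disc" using h0 sub by (auto simp: less4 y_simps)
  show "j < 4 \<Longrightarrow> z \<in> slit_disc \<Longrightarrow> picard_fuchs A B C (y j) z = 0"
    using sol by (auto simp: less4 y_simps)
  assume j: "j < 4"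
  have C': "1 / real_of_int C > 0" using C by simp
  let ?L = "\<lambda>r. Ln (imag_ray r)"
  have a0: "((\<lambda>r. (y0 (imag_ray r) - 1) * ?L r ^ k) \<longlongrightarrow> 0) at_top" for k
    by (rule holomorphic_Ln_power_tendsto_0[OF _ _ C', of "\<lambda>z. y0 z - 1"])
       (use y0 in \<open>auto intro!: holomorphic_intros\<close>)
  have ag: "((\<lambda>r. g (imag_ray r) * ?L r ^ k) \<longlongrightarrow> 0) at_top" if "g \<in> {g1, g2, g3}" for g k
    by (rule holomorphic_Ln_power_tendsto_0[OF g[OF that] C'])
  note ag' = ag[of g1] ag[of g2] ag[of g3]
  have ev: "\<forall>\<^sub>F r in at_top. imag_ray r \<in> slit_disc"
    using imag_ray_half_disc half_disc(3) by (auto elim: eventually_mono)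
  from j consider "j = 0" | "j = 1" | "j = 2" | "j = 3" by (auto simp: less4)
  then show "((\<lambda>r. y j (imag_ray r) - ?L r ^ j / fact j) \<longlongrightarrow> 0) at_top"
  proof cases
    case 1
    then show ?thesis using a0[of 0] by (simp add: y_simps)
  next
    case 2
    have "((\<lambda>r. (y0 (imag_ray r) - 1) * ?L r ^ 1 + g1 (imag_ray r) * ?L r ^ 0) \<longlongrightarrow> 0 + 0) at_top"
      by (intro tendsto_add a0 ag') auto
    then have "((\<lambda>r. y j (imag_ray r) - ?L r ^ j / fact j) \<longlongrightarrow> 0 + 0) at_top"
      by (rule Lim_transform_eventually, intro eventually_mono[OF ev])
        (auto simp: 2 y_simps ys left_diff_distrib diff_divide_distrib fact_numeral)
    then show ?thesis by simp
  next
    case 3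
    have "((\<lambda>r. (y0 (imag_ray r) - 1) * ?L r ^ 2 / 2 + g1 (imag_ray r) * ?L r ^ 1
        + g2 (imag_ray r) * ?L r ^ 0) \<longlongrightarrow> 0 / 2 + 0 + 0) at_top"
      by (intro tendsto_add tendsto_divide a0 ag' tendsto_const) simp_all
    then have "((\<lambda>r. (y0 (imag_ray r) - 1) * ?L r ^ 2 / 2 + g1 (imag_ray r) * ?L r ^ 1
        + g2 (imag_ray r) * ?L r ^ 0) \<longlongrightarrow> 0 + 0) at_top" by simp
    then have "((\<lambda>r. y j (imag_ray r) - ?L r ^ j / fact j) \<longlongrightarrow> 0 + 0) at_top"
      by (rule Lim_transform_eventually, intro eventually_mono[OF ev])
        (auto simp: 3 y_simps ys left_diff_distrib diff_divide_distrib fact_numeral)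
    then show ?thesis by simp
  next
    case 4
    have "((\<lambda>r. (y0 (imag_ray r) - 1) * ?L r ^ 3 / 6 + g1 (imag_ray r) * ?L r ^ 2 / 2
        + g2 (imag_ray r) * ?L r ^ 1 + g3 (imag_ray r) * ?L r ^ 0) \<longlongrightarrow> 0 / 6 + 0 / 2 + 0 + 0) at_top"
      by (intro tendsto_add tendsto_divide a0 ag' tendsto_const) simp_all
    then have "((\<lambda>r. (y0 (imag_ray r) - 1) * ?L r ^ 3 / 6 + g1 (imag_ray r) * ?L r ^ 2 / 2
        + g2 (imag_ray r) * ?L r ^ 1 + g3 (imag_ray r) * ?L r ^ 0) \<longlongrightarrow> 0 + 0) at_top" by simp
    then have "((\<lambda>r. y j (imag_ray r) - ?L r ^ j / fact j) \<longlongrightarrow> 0 + 0) at_top"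
      by (rule Lim_transform_eventually, intro eventually_mono[OF ev])
        (auto simp: 4 y_simps ys left_diff_distrib diff_divide_distrib fact_numeral)
    then show ?thesis by simp
  qed
qed

lemma asymp_unique:
  assumes "((\<lambda>r. (\<Sum>j<4. c j * y j (imag_ray r)) - (\<Sum>j<4. w j * Ln (imag_ray r) ^ j / fact j)) \<longlongrightarrow> 0) at_top"
  shows "\<forall>j<4. c j = w j"
proof -
  have "((\<lambda>r. \<Sum>j<4. c j * (y j (imag_ray r) - Ln (imag_ray r) ^ j / fact j)) \<longlongrightarrow> (\<Sum>j::nat<4. c j * 0)) at_top"
    by (intro tendsto_intros y_asymp) auto
  from tendsto_diff[OF assms this]
  have "((\<lambda>r. \<Sum>j<4. (c j - w j) / fact j * Ln (imag_ray r) ^ j) \<longlongrightarrow> 0) at_top"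
    by (simp add: sum_subtractf algebra_simps diff_divide_distrib)
  from tendsto_polynomial_zero[OF _ Ln_imag_ray_at_infinity this]
  show ?thesis by simp
qed

lemma y_independent: "\<forall>c. (\<forall>z\<in>half_disc. (\<Sum>j<4. c j * y j z) = 0) \<longrightarrow> (\<forall>j<4. c j = 0)"
proof (intro allI impI)
  fix c :: "nat \<Rightarrow> complex" and j :: nat
  assume c: "\<forall>z\<in>half_disc. (\<Sum>j<4. c j * y j z) = 0" and j: "j < 4"
  have "\<forall>j<4. c j = (\<lambda>_. 0) j"
  proof (rule asymp_unique)
    show "((\<lambda>r. (\<Sum>j<4. c j * y j (imag_ray r)) - (\<Sum>j::nat<4. 0 * Ln (imag_ray r) ^ j / fact j)) \<longlongrightarrow> 0) at_top"
      by (rule tendsto_eventually, rule eventually_mono[OF imag_ray_half_disc]) (use c in auto)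
  qed
  then show "c j = 0" using j by simp
qed

text \<open>Expand \<open>m\<close> in the Frobenius basis near one point, spread the identity over
  the connected half disc and let z tend to 0: the asymptotics force the coefficients. A residue at
  0 is then all that is needed to identify a contour integral.\<close>

lemma solution_identify:
  assumes m: "m holomorphic_on half_disc" "\<And>z. z \<in> half_disc \<Longrightarrow> picard_fuchs A B C m z = 0"
    and asymp: "((\<lambda>r. m (imag_ray r) - (\<Sum>j<4. w j * Ln (imag_ray r) ^ j / fact j)) \<longlongrightarrow> 0) at_top"
    and z: "z \<in> half_disc"
  shows "m z = (\<Sum>j<4. w j * y j z)"
proof -
  note hd = half_disc(1) half_disc(4) half_disc(2) z
  have C1: "of_int C * z \<noteq> 1" if "z \<in> half_disc" for z using that half_disc(3) slit_disc(4) by blast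
  have yh: "y j holomorphic_on half_disc" if "j < 4" for j
    using holomorphic_on_subset[OF y_holomorphic[OF that] half_disc(3)] .
  have ysol: "picard_fuchs A B C (y j) z = 0" if "j < 4" "z \<in> half_disc" for j z
    using y_solution that half_disc(3) by blast
  have loc: "local_solution (picard_fuchs A B C) z m"
    unfolding local_solution_def
  proof
    show "m analytic_on {z}" using m(1) hd(1) z by (auto simp: analytic_on_holomorphic)
    show "\<forall>\<^sub>F z in nhds z. picard_fuchs A B C m z = 0"
      by (rule eventually_mono[OF eventually_nhds_in_open[OF hd(1) z] m(2)])
  qed
  obtain c where c: "\<forall>\<^sub>F z in nhds z. m z = (\<Sum>j<4. c j * y j z)"
    using local_solution_expansion[where f = y, OF hd C1 yh ysol y_independent loc] by blast
  then obtain T where T: "open T" "z \<in> T" "\<And>z. z \<in> T \<Longrightarrow> m z = (\<Sum>j<4. c j * y j z)"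
    by (auto simp: eventually_nhds)
  have hol: "(\<lambda>z. \<Sum>j<4. c j * y j z) holomorphic_on half_disc" by (intro holomorphic_intros yh) auto
  have eq: "m x = (\<Sum>j<4. c j * y j x)" if "x \<in> half_disc" for x
    by (rule analytic_continuation_open[of "half_disc \<inter> T" half_disc m])
       (use T hd hol m that in \<open>auto intro: open_Int\<close>)
  have "\<forall>j<4. c j = w j"
  proof (rule asymp_unique, rule Lim_transform_eventually[OF asymp], rule eventually_mono[OF imag_ray_half_disc])
    fix r assume "imag_ray r \<in> half_disc"
    from eq[OF this] show "m (imag_ray r) - (\<Sum>j<4. w j * Ln (imag_ray r) ^ j / fact j)
        = (\<Sum>j<4. c j * y j (imag_ray r)) - (\<Sum>j<4. w j * Ln (imag_ray r) ^ j / fact j)" by simp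
  qed
  then show ?thesis using eq[OF z] by simp
qed

end

section \<open>Continuation of polynomials in a logarithm\<close>

text \<open>\<open>q\<close> is a continuous logarithm of \<open>\<gamma> t - p\<close>. At time t
  the germ uses the branch \<open>q t + Ln ((z - p) / (\<gamma> t - p))\<close>, which is
  holomorphic near the current point and takes the value \<open>q t\<close> there; so the net effect
  is recorded by the end values of \<open>q\<close>. The loop around 0 uses n = 4, the loop around
  1/C uses n = 2.\<close>

lemma continues_along_log_polynomial:
  fixes h :: "nat \<Rightarrow> complex \<Rightarrow> complex" and \<gamma> q :: "real \<Rightarrow> complex"
  assumes U: "open U" "path_image \<gamma> \<subseteq> U" and h: "\<And>i. i < n \<Longrightarrow> h i holomorphic_on U"
    and \<gamma>: "path \<gamma>" and q: "path q" "\<And>t. t \<in> {0..1} \<Longrightarrow> \<gamma> t = p + exp (q t)"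
    and f: "\<forall>\<^sub>F z in nhds (\<gamma> 0). f z = (\<Sum>i<n. h i z * (q 0 + Ln ((z - p) / (\<gamma> 0 - p))) ^ i)"
    and g: "\<forall>\<^sub>F z in nhds (\<gamma> 1). g z = (\<Sum>i<n. h i z * (q 1 + Ln ((z - p) / (\<gamma> 1 - p))) ^ i)"
  shows "continues_along \<gamma> f g"
proof -
  define lg where "lg = (\<lambda>t z. q t + Ln ((z - p) / (\<gamma> t - p)))"
  define F where "F = (\<lambda>t z. \<Sum>i<n. h i z * lg t z ^ i)"
  have ne: "\<gamma> t - p \<noteq> 0" if "t \<in> {0..1}" for t using q(2)[OF that] by simp
  have inU: "\<gamma> t \<in> U" if "t \<in> {0..1}" for t using U that by (auto simp: path_image_def)
  have an: "F t analytic_on {\<gamma> t}" if t: "t \<in> {0..1}" for t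
  proof -
    have "h i analytic_on {\<gamma> t}" if "i < n" for i
      using h[OF that] U(1) inU[OF t] by (auto simp: analytic_on_holomorphic)
    then show ?thesis unfolding F_def lg_def
      using ne[OF t] by (auto intro!: analytic_intros)
  qed
  have loc: "\<forall>\<^sub>F s in at t within {0..1}. \<forall>\<^sub>F z in nhds (\<gamma> s). F s z = F t z" if t: "t \<in> {0..1}" for t
  proof -
    have "(q \<longlongrightarrow> q t) (at t within {0..1})"
      using q(1) t by (simp add: path_def continuous_on_def)
    then have "\<forall>\<^sub>F s in at t within {0..1}. dist (q s) (q t) < 1" by (rule tendstoD) simp
    moreover have "\<forall>\<^sub>F s in at t within {0..1}. s \<in> {0..1}" by (auto simp: eventually_at_filter)
    ultimately show ?thesis
    proof eventually_elim
      case (elim s)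
      have "isCont (\<lambda>z. Ln ((z - p) / (\<gamma> s - p))) (\<gamma> s)"
        using ne[OF elim(2)] by (auto intro!: continuous_intros)
      then have "((\<lambda>z. Ln ((z - p) / (\<gamma> s - p))) \<longlongrightarrow> Ln ((\<gamma> s - p) / (\<gamma> s - p))) (nhds (\<gamma> s))"
        unfolding continuous_at tendsto_at_iff_tendsto_nhds[of "\<lambda>z. Ln ((z - p) / (\<gamma> s - p))"] .
      then have "((\<lambda>z. Ln ((z - p) / (\<gamma> s - p))) \<longlongrightarrow> 0) (nhds (\<gamma> s))"
        using ne[OF elim(2)] by simp
      then have "\<forall>\<^sub>F z in nhds (\<gamma> s). dist (Ln ((z - p) / (\<gamma> s - p))) 0 < 1" by (rule tendstoD) simp
      moreover have "\<forall>\<^sub>F z in nhds (\<gamma> s). z \<noteq> p"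
        using ne[OF elim(2)] by (intro t1_space_nhds) auto
      ultimately show ?case
      proof eventually_elim
        case (elim z)
        define w where "w = (z - p) / (\<gamma> s - p)"
        have "w \<noteq> 0" using elim ne[OF \<open>s \<in> {0..1}\<close>] by (simp add: w_def)
        have "(z - p) / (\<gamma> t - p) = w * ((\<gamma> s - p) / (\<gamma> t - p))"
          using ne[OF \<open>s \<in> {0..1}\<close>] by (simp add: w_def)
        also have "(\<gamma> s - p) / (\<gamma> t - p) = exp (q s - q t)"
          using q(2)[OF t] q(2)[OF \<open>s \<in> {0..1}\<close>] by (simp add: exp_diff)
        also have "w * exp (q s - q t) = exp (Ln w + (q s - q t))"
          using \<open>w \<noteq> 0\<close> by (simp add: exp_add)
        finally have "Ln ((z - p) / (\<gamma> t - p)) = Ln (exp (Ln w + (q s - q t)))" by simp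
        also have "\<dots> = Ln w + (q s - q t)"
        proof (rule Ln_exp)
          have "\<bar>Im (Ln w)\<bar> < 1" using elim(1) abs_Im_le_cmod[of "Ln w"] by (simp add: w_def)
          moreover have "\<bar>Im (q s - q t)\<bar> < 1"
            using \<open>dist (q s) (q t) < 1\<close> abs_Im_le_cmod[of "q s - q t"] by (simp add: dist_norm)
          \<comment> \<open>Imaginary parts below 2 lie inside (-pi, pi), so \<open>Ln\<close>
            undoes \<open>exp\<close> and the two branches agree exactly, not merely modulo 2 pi
            i.\<close>
          ultimately have "\<bar>Im (Ln w + (q s - q t))\<bar> < 2" by auto
          then show "- pi < Im (Ln w + (q s - q t))" "Im (Ln w + (q s - q t)) \<le> pi"
            using pi_gt3 by linarith+
        qed
        finally have "lg t z = lg s z" by (simp add: lg_def w_def)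
        then show ?case by (simp add: F_def)
      qed
    qed
  qed
  show ?thesis unfolding continues_along_def
  proof (intro conjI exI[of _ F] ballI)
    show "\<forall>\<^sub>F z in nhds (pathstart \<gamma>). F 0 z = f z" "\<forall>\<^sub>F z in nhds (pathfinish \<gamma>). F 1 z = g z"
      using f g by (simp_all add: F_def lg_def pathstart_def pathfinish_def eq_commute)
  qed (use \<gamma> an loc in auto)
qed

section \<open>Digamma values and the table\<close>

lemma sum_residue_classes:
  fixes f :: "nat \<Rightarrow> real"
  shows "(\<Sum>k<m. \<Sum>j=1..n. f (j + n * k)) = (\<Sum>l<m * n. f (Suc l))"
proof -
  have "(\<Sum>j=1..n. f (j + n * k)) = (\<Sum>l\<in>{k * n..<k * n + n}. f (Suc l))" for k
    by (rule sum.reindex_bij_witness[of _ "\<lambda>l. Suc l - n * k" "\<lambda>j. j + n * k - 1"]) (auto simp: mult.commute)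
  then have "(\<Sum>k<m. \<Sum>j=1..n. f (j + n * k)) = (\<Sum>k<m. sum (\<lambda>l. f (Suc l)) {k * n..<k * n + n})" by simp
  also have "\<dots> = (\<Sum>l<m * n. f (Suc l))" by (rule sum.nat_group)
  finally show ?thesis .
qed

text \<open>The Gauss multiplication formula in logarithmic derivative form. The n partial sums over
  j/n + k interleave to one harmonic sum of length mn, and log(mn) - log m leaves the term -n log
  n.\<close>

lemma sum_Digamma:
  assumes n: "n > 0"
  shows "(\<Sum>j=1..n. Digamma (real j / real n)) = real n * Digamma 1 - real n * ln (real n)"
proof -
  have lim1: "(\<lambda>m. \<Sum>j=1..n. (ln (real m) - (\<Sum>k<m. inverse (real j / real n + real k))))
      \<longlonglongrightarrow> (\<Sum>j=1..n. Digamma (real j / real n))"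
  proof (intro tendsto_sum)
    fix j assume "j \<in> {1..n}"
    then have "real j / real n \<noteq> 0" using n by simp
    from Digamma_LIMSEQ[OF this]
    show "(\<lambda>m. ln (real m) - (\<Sum>k<m. inverse (real j / real n + real k))) \<longlonglongrightarrow> Digamma (real j / real n)"
      by simp
  qed
  have lim2: "(\<lambda>m. real n * (ln (real (m * n)) - (\<Sum>k<m * n. inverse (1 + real k))) - real n * ln (real n))
      \<longlonglongrightarrow> real n * Digamma 1 - real n * ln (real n)"
  proof (intro tendsto_intros)
    have "(\<lambda>m. ln (real m) - (\<Sum>k<m. inverse (1 + real k))) \<longlonglongrightarrow> Digamma 1"
      using Digamma_LIMSEQ[of "1::real"] by simp
    then show "(\<lambda>m. ln (real (m * n)) - (\<Sum>k<m * n. inverse (1 + real k))) \<longlonglongrightarrow> Digamma 1"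
      by (rule filterlim_compose) (intro filterlim_at_top_mono[OF filterlim_ident], use n in auto)
  qed
  have ev: "\<forall>\<^sub>F m in sequentially. (\<Sum>j=1..n. (ln (real m) - (\<Sum>k<m. inverse (real j / real n + real k))))
      = real n * (ln (real (m * n)) - (\<Sum>k<m * n. inverse (1 + real k))) - real n * ln (real n)"
    using eventually_gt_at_top[of 0]
  proof eventually_elim
    case (elim m)
    have "(\<Sum>j=1..n. \<Sum>k<m. inverse (real j / real n + real k)) = (\<Sum>k<m. \<Sum>j=1..n. real n * inverse (real (j + n * k)))"
      using n by (subst sum.swap) (auto intro!: sum.cong simp: field_simps)
    also have "\<dots> = (\<Sum>l<m * n. real n * inverse (real (Suc l)))"
      using sum_residue_classes[where f = "\<lambda>l. real n * inverse (real l)" and m = m and n = n] by simp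
    also have "\<dots> = real n * (\<Sum>k<m * n. inverse (1 + real k))" by (simp add: sum_distrib_left)
    finally have "(\<Sum>j=1..n. \<Sum>k<m. inverse (real j / real n + real k)) = real n * (\<Sum>k<m * n. inverse (1 + real k))" .
    then show ?case using n elim by (simp add: sum_subtractf ln_mult algebra_simps)
  qed
  show ?thesis by (rule LIMSEQ_unique[OF Lim_transform_eventually[OF lim1 ev] lim2])
qed

text \<open>The same interleaving of residue classes; for m > 0 the series converge, so no logarithm
  is left over.\<close>

lemma sum_Polygamma:
  assumes n: "n > 0" and m: "m > 0"
  shows "(\<Sum>j=1..n. Polygamma m (real j / real n)) = real n ^ Suc m * Polygamma m 1"
proof -
  have P: "(\<lambda>k. inverse ((z + real k) ^ Suc m)) sums ((-1) ^ Suc m * Polygamma m z / fact m)" if "z > 0" for z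
    using Polygamma_LIMSEQ[of z m] m that by auto
  have s1: "(\<lambda>k. \<Sum>j=1..n. inverse ((real j / real n + real k) ^ Suc m))
      sums (\<Sum>j=1..n. (-1) ^ Suc m * Polygamma m (real j / real n) / fact m)"
    using n by (intro sums_sum P) auto
  have eq: "(\<lambda>k. \<Sum>j=1..n. inverse ((real j / real n + real k) ^ Suc m))
      = (\<lambda>k. real n ^ Suc m * (\<Sum>l\<in>{k * n..<k * n + n}. inverse ((1 + real l) ^ Suc m)))"
  proof
    fix k
    have "(\<Sum>j=1..n. inverse ((real j / real n + real k) ^ Suc m))
        = (\<Sum>j=1..n. real n ^ Suc m * inverse (real (j + n * k) ^ Suc m))"
    proof (rule sum.cong[OF refl])
      fix j
      have "real j / real n + real k = real (j + n * k) / real n" using n by (simp add: field_simps)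
      then show "inverse ((real j / real n + real k) ^ Suc m) = real n ^ Suc m * inverse (real (j + n * k) ^ Suc m)"
        by (simp only: power_divide inverse_divide) (simp add: divide_inverse)
    qed
    also have "\<dots> = (\<Sum>l\<in>{k * n..<k * n + n}. real n ^ Suc m * inverse ((1 + real l) ^ Suc m))"
      by (rule sum.reindex_bij_witness[of _ "\<lambda>l. Suc l - n * k" "\<lambda>j. j + n * k - 1"]) (auto simp: mult.commute of_nat_diff)
    finally show "(\<Sum>j=1..n. inverse ((real j / real n + real k) ^ Suc m))
        = real n ^ Suc m * (\<Sum>l\<in>{k * n..<k * n + n}. inverse ((1 + real l) ^ Suc m))"
      by (simp add: sum_distrib_left)
  qed
  have s2: "(\<lambda>k. real n ^ Suc m * (\<Sum>l\<in>{k * n..<k * n + n}. inverse ((1 + real l) ^ Suc m)))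
      sums (real n ^ Suc m * ((-1) ^ Suc m * Polygamma m 1 / fact m))"
    by (intro sums_mult sums_group P n) auto
  have "(\<Sum>j=1..n. (-1) ^ Suc m * Polygamma m (real j / real n) / fact m)
      = real n ^ Suc m * ((-1) ^ Suc m * Polygamma m 1 / fact m)"
    by (rule sums_unique2[OF s1[unfolded eq] s2])
  then have "((-1) ^ Suc m / fact m) * (\<Sum>j=1..n. Polygamma m (real j / real n))
      = ((-1) ^ Suc m / fact m) * (real n ^ Suc m * Polygamma m 1)"
    by (simp add: sum_distrib_left sum_divide_distrib mult_ac)
  then show ?thesis by simp
qed

text \<open>Inclusion-exclusion over the divisors of the denominator isolates the reduced fractions.
  In every row A, 1 - A, B, 1 - B are made of complete sets of these: for denominators 5, 8, 10, 12
  there are four of them, which ties A to B, while for 2, 3, 4, 6 the pairs A, 1 - A and B, 1 - B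
  are complete separately. This is why the sums below are elementary.\<close>

lemma distribution_relations:
  fixes P :: "real \<Rightarrow> real"
  assumes P: "\<And>n. n > 0 \<Longrightarrow> (\<Sum>j=1..n. P (real j / real n)) = c n"
  shows "P (1/2) = c 2 - c 1"
    and "P (1/3) + P (2/3) = c 3 - c 1"
    and "P (1/4) + P (3/4) = c 4 - c 2"
    and "P (1/6) + P (5/6) = c 6 - c 3 - c 2 + c 1"
    and "P (1/5) + P (4/5) + P (2/5) + P (3/5) = c 5 - c 1"
    and "P (1/8) + P (7/8) + P (3/8) + P (5/8) = c 8 - c 4"
    and "P (1/10) + P (9/10) + P (3/10) + P (7/10) = c 10 - c 5 - c 2 + c 1"
    and "P (1/12) + P (11/12) + P (5/12) + P (7/12) = c 12 - c 6 - c 4 + c 2"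
  using P[of 1] P[of 2] P[of 3] P[of 4] P[of 5] P[of 6] P[of 8] P[of 10] P[of 12]
  by (simp_all add: eval_nat_numeral)

text \<open>With P the n-th polygamma function this is the derivative of order n + 1 of log R at s =
  0; the weight -4 belongs to the factor \<open>rGamma (s + 1) ^ 4\<close> of R.\<close>

definition quad_sum :: "(real \<Rightarrow> real) \<Rightarrow> real \<Rightarrow> real \<Rightarrow> real" where
  "quad_sum P A B = P A + P (1 - A) + P B + P (1 - B) - 4 * P 1"

lemma Polygamma_2_1: "Polygamma 2 (1::real) = - 2 * zeta3"
proof -
  have "(\<lambda>k. inverse ((1 + real k) ^ Suc 2)) sums ((-1) ^ Suc 2 * Polygamma 2 1 / fact 2)"
    using Polygamma_LIMSEQ[of "1::real" 2] by simp
  then have "(\<Sum>k. inverse ((1 + real k) ^ 3)) = - (Polygamma 2 1 / 2)"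
    using sums_unique by (fastforce simp: eval_nat_numeral)
  moreover have "(\<Sum>k. inverse ((1 + real k) ^ 3)) = zeta3"
    unfolding zeta3_def by (simp add: inverse_eq_divide add.commute)
  ultimately show ?thesis by simp
qed

lemma Polygamma_1_1: "Polygamma 1 (1::real) = pi ^ 2 / 6"
proof -
  have "(\<lambda>k. inverse ((1 + real k) ^ Suc 1)) sums ((-1) ^ Suc 1 * Polygamma 1 1 / fact 1)"
    using Polygamma_LIMSEQ[of "1::real" 1] by simp
  then have "(\<lambda>k. 1 / (real k + 1) ^ 2) sums Polygamma 1 1"
    by (simp add: inverse_eq_divide add.commute power2_eq_square)
  then show ?thesis using inverse_squares_sums sums_unique2 by (force simp: add.commute)
qed

text \<open>Doubling the angle exchanges the two cosines. Subtracting the two duplication formulas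
  and cancelling the nonzero difference gives their sum; substituting back gives the
  product.\<close>

lemma cos_fifths:
  "cos (2 * pi / 5) + cos (4 * pi / 5) = - 1 / 2" "cos (2 * pi / 5) * cos (4 * pi / 5) = - 1 / 4"
proof -
  define x y where "x = cos (2 * pi / 5)" and "y = cos (4 * pi / 5)"
  have yx: "y = 2 * x ^ 2 - 1"
    using cos_double_cos[of "2 * pi / 5"] by (simp add: x_def y_def)
  have "x = 2 * y ^ 2 - 1"
  proof -
    have e: "8 * pi / 5 = 2 * pi - 2 * pi / 5" by simp
    have "cos (8 * pi / 5) = x" unfolding e cos_diff x_def by simp
    then show ?thesis using cos_double_cos[of "4 * pi / 5"] by (simp add: x_def y_def)
  qed
  with yx have "y - x = 2 * x ^ 2 - 2 * y ^ 2" by linarith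
  then have "(y - x) * (2 * (x + y) + 1) = 0" by (simp add: algebra_simps power2_eq_square)
  moreover have "y < x" unfolding x_def y_def by (rule cos_monotone_0_pi) auto
  ultimately have s: "x + y = - 1 / 2" by auto
  have "y = - 1 / 2 - x" using s by simp
  then have "x ^ 2 + x / 2 = 1 / 4" using yx by linarith
  moreover have "x * y = - (x ^ 2 + x / 2)"
    unfolding \<open>y = - 1 / 2 - x\<close> by (simp add: algebra_simps power2_eq_square)
  ultimately have "x * y = - 1 / 4" by simp
  with s show "cos (2 * pi / 5) + cos (4 * pi / 5) = - 1 / 2" "cos (2 * pi / 5) * cos (4 * pi / 5) = - 1 / 4"
    by (simp_all add: x_def y_def)
qed

lemma sin_squared_pi: "sin (pi * a) ^ 2 = (1 - cos (2 * pi * a)) / 2" for a :: real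
  using cos_double_sin[of "pi * a"] by (simp add: mult_ac)

lemma ln_power_mult: "ln (2 ^ a * 3 ^ b * 5 ^ c) = real a * ln 2 + real b * ln 3 + real c * ln (5::real)"
  by (simp add: ln_mult ln_realpow)

lemma ln_small:
  "ln 4 = 2 * ln (2::real)" "ln 6 = ln 2 + ln (3::real)" "ln 8 = 3 * ln (2::real)"
  "ln 10 = ln 2 + ln (5::real)" "ln 12 = 2 * ln 2 + ln (3::real)"
  using ln_power_mult[of 2 0 0] ln_power_mult[of 1 1 0] ln_power_mult[of 3 0 0]
    ln_power_mult[of 1 0 1] ln_power_mult[of 2 1 0] by simp_all

lemma ln_conifold:
  "ln 3125 = 5 * ln (5::real)" "ln 800000 = 8 * ln 2 + 5 * ln (5::real)" "ln 256 = 8 * ln (2::real)"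
  "ln 729 = 6 * ln (3::real)" "ln 432 = 4 * ln 2 + 3 * ln (3::real)" "ln 1024 = 10 * ln (2::real)"
  "ln 65536 = 16 * ln (2::real)" "ln 11664 = 4 * ln 2 + 6 * ln (3::real)"
  "ln 2985984 = 12 * ln 2 + 6 * ln (3::real)" "ln 4096 = 12 * ln (2::real)"
  "ln 1728 = 6 * ln 2 + 3 * ln (3::real)" "ln 27648 = 10 * ln 2 + 3 * ln (3::real)"
  "ln 186624 = 8 * ln 2 + 6 * ln (3::real)" "ln 6912 = 8 * ln 2 + 3 * ln (3::real)"
  using ln_power_mult[of 0 0 5] ln_power_mult[of 8 0 5] ln_power_mult[of 8 0 0]
    ln_power_mult[of 0 6 0] ln_power_mult[of 4 3 0] ln_power_mult[of 10 0 0]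
    ln_power_mult[of 16 0 0] ln_power_mult[of 4 6 0] ln_power_mult[of 12 6 0]
    ln_power_mult[of 12 0 0] ln_power_mult[of 6 3 0] ln_power_mult[of 10 3 0]
    ln_power_mult[of 8 6 0] ln_power_mult[of 8 3 0]
  by simp_all

lemma cy_table_cases:
  assumes "(A, B, C, H3, c2H, c3, d1, d2) \<in> cy_table"
    and "Q (1/5) (2/5) 3125 5 50 (-200) 5 5" "Q (1/10) (3/10) 800000 1 34 (-288) 1 1"
    "Q (1/2) (1/2) 256 16 64 (-128) 16 8" "Q (1/3) (1/3) 729 9 54 (-144) 9 3"
    "Q (1/3) (1/2) 432 12 60 (-144) 12 1" "Q (1/4) (1/2) 1024 8 56 (-176) 8 2"
    "Q (1/8) (3/8) 65536 2 44 (-296) 2 2" "Q (1/6) (1/3) 11664 3 42 (-204) 3 1"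
    "Q (1/12) (5/12) 2985984 1 46 (-484) 1 1" "Q (1/4) (1/4) 4096 4 40 (-144) 4 4"
    "Q (1/4) (1/3) 1728 6 48 (-156) 6 1" "Q (1/6) (1/4) 27648 2 32 (-156) 2 1"
    "Q (1/6) (1/6) 186624 1 22 (-120) 1 1" "Q (1/6) (1/2) 6912 4 52 (-256) 4 1"
  shows "Q A B C H3 c2H c3 d1 d2"
proof -
  have n: "8 * 10 ^ 5 = (800000::int)" "12 ^ 6 = (2985984::int)" "2 ^ 8 * 3 ^ 6 = (186624::int)" by simp_all
  show ?thesis
    using assms(1) unfolding cy_table_def n insert_iff empty_iff prod.inject
    by (elim disjE conjE FalseE; simp only: assms(2-))
qed

text \<open>C is exactly the number that kills the linear Taylor coefficient of R(s) C^s at 0. Its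
  prime factorisation comes from the terms n log n of the multiplication formula.\<close>

lemma cy_row_Digamma:
  assumes "(A, B, C, H3, c2H, c3, d1, d2) \<in> cy_table"
  shows "quad_sum Digamma A B = - ln (of_int C)"
proof -
  note r = distribution_relations[of Digamma "\<lambda>n. real n * Digamma 1 - real n * ln (real n)", OF sum_Digamma,
      unfolded of_nat_numeral of_nat_1 ln_small ln_one]
  show ?thesis using assms
    by (rule cy_table_cases) (use r in \<open>simp_all add: quad_sum_def ln_conifold\<close>)
qed

text \<open>Since psi'(1) = pi^2/6, the second derivative of log R at 0 is a rational multiple of
  pi^2; the rational number is c2.H / (3 H^3).\<close>

lemma cy_row_Polygamma_1:
  assumes "(A, B, C, H3, c2H, c3, d1, d2) \<in> cy_table"
  shows "of_int H3 * quad_sum (Polygamma 1) A B = pi ^ 2 / 3 * of_int c2H"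
proof -
  note r = distribution_relations[of "Polygamma 1" "\<lambda>n. real n ^ Suc 1 * Polygamma 1 1", OF sum_Polygamma,
      unfolded of_nat_numeral of_nat_1 Polygamma_1_1]
  have 1: "Polygamma (Suc 0) 1 = pi ^ 2 / 6" using Polygamma_1_1 by simp
  show ?thesis using assms
    by (rule cy_table_cases) (use r in \<open>simp_all add: quad_sum_def 1\<close>)
qed

text \<open>The third derivative of log R at 0 is a rational multiple of psi''(1) = -2
  zeta(3).\<close>

lemma cy_row_Polygamma_2:
  assumes "(A, B, C, H3, c2H, c3, d1, d2) \<in> cy_table"
  shows "of_int H3 * quad_sum (Polygamma 2) A B = 6 * of_int c3 * zeta3"
proof -
  note r = distribution_relations[of "Polygamma 2" "\<lambda>n. real n ^ Suc 2 * Polygamma 2 1", OF sum_Polygamma,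
      unfolded of_nat_numeral of_nat_1 Polygamma_2_1]
  show ?thesis using assms
    by (rule cy_table_cases) (use r in \<open>simp_all add: quad_sum_def Polygamma_2_1\<close>)
qed

lemma sin_squared_values:
  "sin (pi * (1/2)) ^ 2 = 1" "sin (pi * (1/3)) ^ 2 = 3/4"
  "sin (pi * (1/4)) ^ 2 = 1/2" "sin (pi * (1/6)) ^ 2 = 1/4"
  by (simp_all add: sin_60 sin_45 sin_30 power_divide)

lemma sin_squared_pairs:
  "sin (pi * (1/5)) ^ 2 + sin (pi * (2/5)) ^ 2 = 5/4" "sin (pi * (1/5)) ^ 2 * sin (pi * (2/5)) ^ 2 = 5/16"
  "sin (pi * (1/10)) ^ 2 + sin (pi * (3/10)) ^ 2 = 3/4" "sin (pi * (1/10)) ^ 2 * sin (pi * (3/10)) ^ 2 = 1/16"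
  "sin (pi * (1/8)) ^ 2 + sin (pi * (3/8)) ^ 2 = 1" "sin (pi * (1/8)) ^ 2 * sin (pi * (3/8)) ^ 2 = 1/8"
  "sin (pi * (1/12)) ^ 2 + sin (pi * (5/12)) ^ 2 = 1" "sin (pi * (1/12)) ^ 2 * sin (pi * (5/12)) ^ 2 = 1/16"
proof -
  have cpm: "cos (pi - x) = - cos x" for x :: real by (simp add: cos_diff)
  have h: "sin (pi * a) ^ 2 + sin (pi * b) ^ 2 = 1 - (x + y) / 2 \<and>
      sin (pi * a) ^ 2 * sin (pi * b) ^ 2 = (1 - (x + y) + x * y) / 4"
    if "cos (2 * pi * a) = x" "cos (2 * pi * b) = y" for a b x y :: real
    unfolding sin_squared_pi that by (simp add: field_simps)
  have "2 * pi * (1 / 10) = pi - 4 * pi / 5" "2 * pi * (3 / 10) = pi - 2 * pi / 5"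
    "2 * pi * (3 / 8) = pi - pi / 4" "2 * pi * (5 / 12) = pi - pi / 6" by simp_all
  then have c: "cos (2 * pi * (1 / 10)) = - cos (4 * pi / 5)" "cos (2 * pi * (3 / 10)) = - cos (2 * pi / 5)"
    "cos (2 * pi * (3 / 8)) = - cos (pi / 4)" "cos (2 * pi * (5 / 12)) = - cos (pi / 6)"
    by (simp_all only: cpm)
  have c': "cos (2 * pi * (1 / 5)) = cos (2 * pi / 5)" "cos (2 * pi * (2 / 5)) = cos (4 * pi / 5)"
    "cos (2 * pi * (1 / 8)) = cos (pi / 4)" "cos (2 * pi * (1 / 12)) = cos (pi / 6)"
    by simp_all
  have s2: "cos (pi / 4) * cos (pi / 4) = 1 / 2" and s3: "cos (pi / 6) * cos (pi / 6) = 3 / 4"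
    by (simp_all add: cos_45 cos_30)
  show "sin (pi * (1/5)) ^ 2 + sin (pi * (2/5)) ^ 2 = 5/4" "sin (pi * (1/5)) ^ 2 * sin (pi * (2/5)) ^ 2 = 5/16"
    using h[OF c'(1,2)] unfolding cos_fifths by simp_all
  have "- cos (4 * pi / 5) + - cos (2 * pi / 5) = 1 / 2" using cos_fifths(1) by linarith
  moreover have "- cos (4 * pi / 5) * - cos (2 * pi / 5) = - 1 / 4" using cos_fifths(2) by (simp add: mult.commute)
  ultimately show "sin (pi * (1/10)) ^ 2 + sin (pi * (3/10)) ^ 2 = 3/4" "sin (pi * (1/10)) ^ 2 * sin (pi * (3/10)) ^ 2 = 1/16"
    using h[OF c(1,2)] by simp_all
  show "sin (pi * (1/8)) ^ 2 + sin (pi * (3/8)) ^ 2 = 1" "sin (pi * (1/8)) ^ 2 * sin (pi * (3/8)) ^ 2 = 1/8"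
    using h[OF c'(3) c(3)] s2 by simp_all
  show "sin (pi * (1/12)) ^ 2 + sin (pi * (5/12)) ^ 2 = 1" "sin (pi * (1/12)) ^ 2 * sin (pi * (5/12)) ^ 2 = 1/16"
    using h[OF c'(4) c(4)] s3 by simp_all
qed

text \<open>The elementary symmetric functions of sin^2(pi A) and sin^2(pi B) are, up to sign, the
  coefficients of the periodic function that removes the poles of R. Their values express the jump
  at the conifold point through H^3 and c2.H.\<close>

lemma cy_row_sin:
  assumes "(A, B, C, H3, c2H, c3, d1, d2) \<in> cy_table"
  shows "sin (pi * A) ^ 2 + sin (pi * B) ^ 2 = of_int (c2H + 2 * H3) / 48"
    and "sin (pi * A) ^ 2 * sin (pi * B) ^ 2 = of_int H3 / 16"
  using assms
  by (rule cy_table_cases; simp only: sin_squared_pairs sin_squared_values; simp)+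

section \<open>Mellin--Barnes solutions\<close>

definition sinc_pi :: "complex \<Rightarrow> complex" where
  "sinc_pi s = (if s = 0 then of_real pi else sin (of_real pi * s) / s)"

text \<open>\<open>m\<close> is the order of the poles and \<open>k\<close> tilts the strip: against
  R the integral converges for -(k + m) pi < arg x < (m - k) pi. The period is 1 when k + m is
  even.\<close>

definition kern :: "int \<Rightarrow> nat \<Rightarrow> complex \<Rightarrow> complex" where
  "kern k m s = exp (\<i> * of_real (of_int k * pi) * s) / sin (of_real pi * s) ^ m"

text \<open>For m at most 4 this is s^4 times \<open>kern k m s\<close> with the removable
  singularity at 0 filled in; \<open>kern\<close> itself involves a division by zero there when m >
  0.\<close>

definition kern_reg :: "int \<Rightarrow> nat \<Rightarrow> complex \<Rightarrow> complex" where
  "kern_reg k m s = s ^ (4 - m) * exp (\<i> * of_real (of_int k * pi) * s) / sinc_pi s ^ m"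

lemma sinc_pi_mult: "s * sinc_pi s = sin (of_real pi * s)"
  by (simp add: sinc_pi_def)

lemma holomorphic_sinc_pi [holomorphic_intros]: "sinc_pi holomorphic_on S"
proof -
  have "sinc_pi holomorphic_on UNIV"
  proof (rule pole_theorem_0[where g = "\<lambda>s. sin (of_real pi * s)" and a = 0])
    have "((\<lambda>s. sin (complex_of_real pi * s)) has_field_derivative of_real pi) (at 0)"
      by (auto intro!: derivative_eq_intros)
    then show "sinc_pi 0 = deriv (\<lambda>s. sin (complex_of_real pi * s)) 0"
      by (simp add: sinc_pi_def DERIV_imp_deriv)
  qed (auto simp: sinc_pi_def intro!: holomorphic_intros)
  then show ?thesis by (rule holomorphic_on_subset) simp
qed

lemma sin_pi_eq_0_strip:
  assumes "\<bar>Re s\<bar> < 1" "sin (of_real pi * s) = 0"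
  shows "s = 0"
proof -
  obtain n :: int where "of_real pi * s = of_real (of_int n * pi)"
    using assms(2) sin_eq_0[of "of_real pi * s"] by auto
  then have n: "s = of_int n" by (simp add: mult.commute)
  then have "\<bar>real_of_int n\<bar> < 1" using assms(1) by simp
  then have "n = 0" by linarith
  then show ?thesis using n by simp
qed

lemma sinc_pi_nonzero: "\<bar>Re s\<bar> < 1 \<Longrightarrow> sinc_pi s \<noteq> 0"
  using sin_pi_eq_0_strip[of s] by (auto simp: sinc_pi_def)

lemma kern_reg_eq:
  assumes "s \<noteq> 0" "m \<le> 4"
  shows "kern_reg k m s = s ^ 4 * kern k m s"
proof -
  have "s ^ 4 = s ^ (4 - m) * s ^ m" using assms by (simp flip: power_add)
  then show ?thesis using assms
    by (simp add: kern_reg_def kern_def sinc_pi_def power_divide)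
qed

lemma holomorphic_kern_reg: "kern_reg k m holomorphic_on {s. - 1 < Re s \<and> Re s < 1}"
  unfolding kern_reg_def using sinc_pi_nonzero by (intro holomorphic_intros) (auto simp: abs_less_iff)

lemma holomorphic_kern: "kern k m holomorphic_on {s. - 1 < Re s \<and> Re s < 1} - {0}"
  unfolding kern_def using sin_pi_eq_0_strip by (intro holomorphic_intros) (force simp: abs_less_iff)+

text \<open>Numerator and denominator pick up the signs (-1)^k and (-1)^m, which agree.\<close>

lemma kern_plus1:
  assumes "even (k + int m)"
  shows "kern k m (s + 1) = kern k m s"
proof -
  have "exp (\<i> * of_real (of_int k * pi) * (s + 1)) = exp (\<i> * of_real (of_int k * pi) * s) * exp (\<i> * of_real (of_int k * pi))"
    by (simp add: distrib_left exp_add)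
  also have "exp (\<i> * of_real (of_int k * pi)) = (- 1) ^ m"
  proof (cases "even m")
    case True
    then obtain l where "k = 2 * l" using assms by auto
    then have "\<i> * complex_of_real (of_int k * pi) = 2 * of_int l * of_real pi * \<i>" by simp
    then have "exp (\<i> * complex_of_real (of_int k * pi)) = 1"
      using exp_integer_2pi[of "of_int l"] by (simp add: mult_ac)
    then show ?thesis using True by simp
  next
    case False
    then obtain l where l: "k = 2 * l + 1" using assms by (auto elim: oddE)
    have "\<i> * complex_of_real (of_int k * pi) = (2 * of_int l + 1) * of_real pi * \<i>" using l by (simp add: algebra_simps)
    then have "exp (\<i> * complex_of_real (of_int k * pi)) = - 1"
      using exp_integer_2pi_plus1[of "of_int l"] by (simp add: mult_ac)
    then show ?thesis using False by simp
  qed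
  finally have e: "exp (\<i> * of_real (of_int k * pi) * (s + 1)) = exp (\<i> * of_real (of_int k * pi) * s) * (- 1) ^ m" .
  have "sin (of_real pi * (s + 1)) = - sin (of_real pi * s)"
    by (simp add: distrib_left sin_add sin_of_real cos_of_real)
  then have "sin (of_real pi * (s + 1)) ^ m = (- 1) ^ m * sin (of_real pi * s) ^ m"
    by (simp add: power_minus[of "sin _"])
  then show ?thesis unfolding kern_def e by simp
qed

lemma norm_sin_ge:
  assumes "\<bar>Im z\<bar> \<ge> 1"
  shows "norm (sin z) \<ge> exp \<bar>Im z\<bar> / 4"
proof -
  define y where "y = \<bar>Im z\<bar>"
  have "norm (sin z) = norm (exp (\<i> * z) - exp (- (\<i> * z))) / 2"
    by (simp add: sin_exp_eq norm_divide norm_mult)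
  moreover have "\<bar>norm (exp (\<i> * z)) - norm (exp (- (\<i> * z)))\<bar> \<le> norm (exp (\<i> * z) - exp (- (\<i> * z)))"
    by (rule norm_triangle_ineq3)
  moreover have "\<bar>norm (exp (\<i> * z)) - norm (exp (- (\<i> * z)))\<bar> = exp y - exp (- y)"
    by (cases "Im z \<ge> 0") (auto simp: norm_exp_eq_Re y_def abs_if)
  moreover have "2 \<le> exp y * exp y"
  proof -
    have "2 \<le> 1 + 2 * y" using assms by (simp add: y_def)
    also have "\<dots> \<le> exp (2 * y)" by (rule exp_ge_add_one_self)
    finally show ?thesis by (simp flip: exp_add)
  qed
  then have "exp (- y) \<le> exp y / 2" by (simp add: exp_minus field_simps)
  ultimately show ?thesis unfolding y_def by linarith
qed

lemma norm_kern_le: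
  assumes "\<bar>Im s\<bar> \<ge> 1"
  shows "norm (kern k m s) \<le> 4 ^ m * exp (- of_int k * pi * Im s - real m * pi * \<bar>Im s\<bar>)"
proof -
  have "pi * \<bar>Im s\<bar> \<ge> 1 * 1" using assms pi_ge_two by (intro mult_mono) auto
  then have "exp (pi * \<bar>Im s\<bar>) / 4 \<le> norm (sin (of_real pi * s))"
    using norm_sin_ge[of "of_real pi * s"] by (simp add: abs_mult)
  then have "(exp (pi * \<bar>Im s\<bar>) / 4) ^ m \<le> norm (sin (of_real pi * s) ^ m)"
    unfolding norm_power by (intro power_mono) auto
  then have "norm (kern k m s) \<le> norm (exp (\<i> * of_real (of_int k * pi) * s)) / (exp (pi * \<bar>Im s\<bar>) / 4) ^ m"
    unfolding kern_def norm_divide using \<open>exp (pi * \<bar>Im s\<bar>) / 4 \<le> norm (sin (of_real pi * s))\<close>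
    by (intro divide_left_mono mult_pos_pos)
      (auto intro!: zero_less_power order_less_le_trans[of 0 "exp (pi * \<bar>Im s\<bar>) / 4" "norm (sin (of_real pi * s))"])
  also have "\<dots> = 4 ^ m * (exp (- of_int k * pi * Im s) / exp (pi * \<bar>Im s\<bar>) ^ m)"
    by (simp add: norm_exp_eq_Re power_divide)
  also have "exp (pi * \<bar>Im s\<bar>) ^ m = exp (real m * pi * \<bar>Im s\<bar>)"
    by (simp flip: exp_of_nat_mult add: mult.assoc)
  also have "exp (- of_int k * pi * Im s) / \<dots> = exp (- of_int k * pi * Im s - real m * pi * \<bar>Im s\<bar>)"
    by (simp add: exp_diff)
  finally show ?thesis .
qed

text \<open>The two entries of the minimum are the decay rates for Im s tending to plus and to minus
  infinity. Both are positive precisely when \<open>v\<close> lies in the open strip of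
  convergence.\<close>

lemma norm_kern_decay:
  assumes "\<bar>Im s\<bar> \<ge> 1"
  shows "norm (kern k m s) * exp (- Im s * v)
    \<le> 4 ^ m * exp (- min (v + (of_int k + real m) * pi) ((real m - of_int k) * pi - v) * \<bar>Im s\<bar>)"
proof -
  let ?t = "Im s" and ?\<mu> = "min (v + (of_int k + real m) * pi) ((real m - of_int k) * pi - v)"
  have "norm (kern k m s) * exp (- ?t * v) \<le> 4 ^ m * exp (- of_int k * pi * ?t - real m * pi * \<bar>?t\<bar>) * exp (- ?t * v)"
    by (intro mult_right_mono norm_kern_le assms) auto
  also have "\<dots> = 4 ^ m * exp (- of_int k * pi * ?t - real m * pi * \<bar>?t\<bar> - ?t * v)"
    by (simp add: mult.assoc flip: exp_add)
  also have "\<dots> \<le> 4 ^ m * exp (- ?\<mu> * \<bar>?t\<bar>)"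
  proof (intro mult_left_mono, subst exp_le_cancel_iff)
    show "- of_int k * pi * ?t - real m * pi * \<bar>?t\<bar> - ?t * v \<le> - ?\<mu> * \<bar>?t\<bar>"
    proof (cases "?t \<ge> 0")
      case True
      have "?\<mu> * ?t \<le> (v + (of_int k + real m) * pi) * ?t" using True by (intro mult_right_mono) auto
      then show ?thesis using True by (simp add: algebra_simps)
    next
      case False
      define x where "x = - ?t"
      have x: "x \<ge> 0" "\<bar>?t\<bar> = x" "?t = - x" using False by (auto simp: x_def)
      have "?\<mu> * x \<le> ((real m - of_int k) * pi - v) * x" using x by (intro mult_right_mono) auto
      then show ?thesis using x(1) unfolding x(2,3) by (simp add: algebra_simps)
    qed
  qed auto
  finally show ?thesis .
qed

lemma line_int_cong: "(\<And>t. f (Complex c t) = g (Complex c t)) \<Longrightarrow> line_int c f = line_int c g"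
  by (simp add: line_int_def)

lemma line_int_shift_holomorphic:
  assumes "c' < c" "c < d" "d < d'"
    and "f holomorphic_on {s. c' < Re s \<and> Re s < d'}"
    and "\<And>s. c \<le> Re s \<Longrightarrow> Re s \<le> d \<Longrightarrow> \<bar>Im s\<bar> \<ge> 1 \<Longrightarrow> norm (f s) \<le> K / (1 + Im s ^ 2)"
  shows "line_int c f = line_int d f"
  using line_int_shift[where P = "{}" and f = f and K = K, OF assms(1-3)] assms(4,5) by simp

lemma exp_decay_tail:
  assumes cont: "continuous_on UNIV (\<lambda>t. f (Complex c t))" and \<epsilon>: "\<epsilon> > 0"
    and tail: "\<And>t. \<bar>t\<bar> \<ge> 1 \<Longrightarrow> norm (f (Complex c t)) * exp (- t * Im u) \<le> K * exp (- \<epsilon> * \<bar>t\<bar>)"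
  shows "exp_decay c f u"
proof -
  have "compact ((\<lambda>t. norm (f (Complex c t)) * exp (- t * Im u)) ` {-1..1})"
    by (intro compact_continuous_image continuous_intros continuous_on_subset[OF cont]) auto
  then obtain B where B: "\<And>t. t \<in> {-1..1} \<Longrightarrow> \<bar>norm (f (Complex c t)) * exp (- t * Im u)\<bar> \<le> B"
    using compact_imp_bounded bounded_iff by (metis (no_types, lifting) imageI real_norm_def)
  have B0: "B \<ge> 0" using order_trans[OF abs_ge_zero B[of 0]] by simp
  have "norm (f (Complex c t)) * exp (- t * Im u) \<le> (\<bar>K\<bar> + B * exp \<epsilon>) * exp (- \<epsilon> * \<bar>t\<bar>)" for t
  proof (cases "\<bar>t\<bar> \<ge> 1")
    case True
    note tail[OF True]
    also have "K * exp (- \<epsilon> * \<bar>t\<bar>) \<le> (\<bar>K\<bar> + B * exp \<epsilon>) * exp (- \<epsilon> * \<bar>t\<bar>)"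
      using B0 by (intro mult_right_mono) (auto intro: add_increasing2)
    finally show ?thesis .
  next
    case False
    then have "t \<in> {-1..1}" by (auto simp: abs_if split: if_splits)
    then have "norm (f (Complex c t)) * exp (- t * Im u) \<le> B" using B by fastforce
    also have "\<dots> \<le> B * (exp \<epsilon> * exp (- \<epsilon> * \<bar>t\<bar>))"
    proof -
      have "1 \<le> exp (\<epsilon> + - \<epsilon> * \<bar>t\<bar>)" using False \<epsilon> by (simp add: algebra_simps)
      then have "1 \<le> exp \<epsilon> * exp (- \<epsilon> * \<bar>t\<bar>)" unfolding exp_add .
      from mult_left_mono[OF this B0] show ?thesis by simp
    qed
    also have "\<dots> \<le> (\<bar>K\<bar> + B * exp \<epsilon>) * exp (- \<epsilon> * \<bar>t\<bar>)" by (simp add: distrib_right)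
    finally show ?thesis .
  qed
  then show ?thesis unfolding exp_decay_def using \<epsilon> by blast
qed

section \<open>The coefficient function R and its contour integrals\<close>

locale mellin_barnes = frobenius +
  assumes AB: "1/12 \<le> A" "A \<le> 1/2" "1/12 \<le> B" "B \<le> 1/2"
begin

definition R :: "complex \<Rightarrow> complex" where
  "R s = hyp_pair A s * hyp_pair B s"

text \<open>Halfway between the kernel pole at 0 and -1/12. As no parameter of the table is below
  1/12, R is holomorphic to the right of -1/12.\<close>

abbreviation c0 :: real where "c0 \<equiv> - (1 / 24)"

lemma holomorphic_R: "R holomorphic_on {s. - (1 / 12) < Re s}"
  unfolding R_def using AB by (intro holomorphic_on_mult holomorphic_hyp_pair) auto

lemma R_0: "R 0 = 1"
  using AB by (simp add: R_def hyp_pair_0)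

lemma R_plus1:
  assumes "Re s > - (1 / 12)"
  shows "(s + 1) ^ 4 * R (s + 1) = (s + A) * (s + 1 - A) * ((s + B) * (s + 1 - B)) * R s"
proof -
  have e: "(s + 1) ^ 2 * hyp_pair A (s + 1) = (s + A) * (s + 1 - A) * hyp_pair A s"
    "(s + 1) ^ 2 * hyp_pair B (s + 1) = (s + B) * (s + 1 - B) * hyp_pair B s"
    by (rule hyp_pair_plus1; use assms AB in auto)+
  have "(s + 1) ^ 4 = (s + 1) ^ 2 * (s + 1) ^ 2" by (simp flip: power_add)
  then have "(s + 1) ^ 4 * R (s + 1) = ((s + 1) ^ 2 * hyp_pair A (s + 1)) * ((s + 1) ^ 2 * hyp_pair B (s + 1))"
    by (simp only: R_def mult_ac)
  also have "\<dots> = ((s + A) * (s + 1 - A) * ((s + B) * (s + 1 - B))) * R s"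
    unfolding e R_def by (simp only: mult_ac)
  finally show ?thesis .
qed

text \<open>Each of the two pairs contributes one factor 1/s, so R is O(1/|s|^2) at infinity: just
  enough for integrals to converge on the boundary of their strips.\<close>

lemma R_bound: "\<exists>K. \<forall>s. Re s \<ge> c0 \<longrightarrow> norm (s ^ 2 * R s) \<le> K"
proof -
  obtain K1 where K1: "\<forall>s. Re s \<ge> - (1/24) \<longrightarrow> norm (s * hyp_pair A s) \<le> K1"
    using hyp_pair_bound[of "1/24" A] AB by auto
  obtain K2 where K2: "\<forall>s. Re s \<ge> - (1/24) \<longrightarrow> norm (s * hyp_pair B s) \<le> K2"
    using hyp_pair_bound[of "1/24" B] AB by auto
  have "norm (s ^ 2 * R s) \<le> K1 * K2" if "Re s \<ge> c0" for s
  proof -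
    have "norm (s ^ 2 * R s) = norm (s * hyp_pair A s) * norm (s * hyp_pair B s)"
      by (simp add: R_def norm_mult power2_eq_square)
    also have "\<dots> \<le> K1 * K2"
      using K1 K2 that by (intro mult_mono) (auto intro: order_trans[OF norm_ge_zero])
    finally show ?thesis .
  qed
  then show ?thesis by blast
qed

lemma norm_R_le: "\<exists>K. \<forall>s. Re s \<ge> c0 \<and> \<bar>Im s\<bar> \<ge> 1 \<longrightarrow> norm (R s) \<le> K / (1 + Im s ^ 2)"
proof -
  obtain K where K: "\<And>s. Re s \<ge> c0 \<Longrightarrow> norm (s ^ 2 * R s) \<le> K" using R_bound by blast
  have "norm (R s) \<le> 2 * K / (1 + Im s ^ 2)" if s: "Re s \<ge> c0" "\<bar>Im s\<bar> \<ge> 1" for s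
  proof -
    have "1 \<le> \<bar>Im s\<bar> ^ 2" by (rule one_le_power[OF s(2)])
    moreover have "\<bar>Im s\<bar> ^ 2 \<le> norm s ^ 2" by (intro power_mono abs_Im_le_cmod) auto
    ultimately have "1 + Im s ^ 2 \<le> 2 * norm s ^ 2" by simp
    then have "(1 + Im s ^ 2) * norm (R s) \<le> 2 * norm s ^ 2 * norm (R s)" by (intro mult_right_mono) auto
    also have "\<dots> \<le> 2 * K" using K[OF s(1)] by (simp add: norm_mult norm_power)
    finally show ?thesis by (simp add: field_simps add_pos_nonneg)
  qed
  then show ?thesis by blast
qed

definition mb :: "int \<Rightarrow> nat \<Rightarrow> complex \<Rightarrow> complex" where
  "mb k m = mellin c0 (\<lambda>s. R s * kern k m s)"

lemma continuous_R_kern: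
  assumes "c0 \<le> c" "c < 1" "c \<noteq> 0"
  shows "continuous_on UNIV (\<lambda>t. R (Complex c t) * kern k m (Complex c t))"
proof (rule continuous_on_Complex_line[where f = "\<lambda>s. R s * kern k m s"])
  show "continuous_on ({s. - (1 / 12) < Re s} \<inter> ({s. - 1 < Re s \<and> Re s < 1} - {0})) (\<lambda>s. R s * kern k m s)"
    by (intro continuous_on_mult)
      (blast intro: continuous_on_subset[OF holomorphic_on_imp_continuous_on[OF holomorphic_R]]
         continuous_on_subset[OF holomorphic_on_imp_continuous_on[OF holomorphic_kern]])+
qed (use assms in \<open>auto simp: complex_eq_iff\<close>)

text \<open>Exponential and quadratic decay are kept side by side: inside the strip the first one is
  used, while on its boundary the rate is zero and only the second remains.\<close>

lemma R_kern_decay: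
  "\<exists>K\<ge>0. \<forall>s. Re s \<ge> c0 \<and> \<bar>Im s\<bar> \<ge> 1 \<longrightarrow> norm (R s * kern k m s) * exp (- Im s * v)
    \<le> K * exp (- min (v + (of_int k + real m) * pi) ((real m - of_int k) * pi - v) * \<bar>Im s\<bar>) / (1 + Im s ^ 2)"
proof -
  obtain K where K: "\<And>s. Re s \<ge> c0 \<Longrightarrow> \<bar>Im s\<bar> \<ge> 1 \<Longrightarrow> norm (R s) \<le> K / (1 + Im s ^ 2)"
    using norm_R_le by blast
  let ?\<mu> = "min (v + (of_int k + real m) * pi) ((real m - of_int k) * pi - v)"
  have "norm (R s * kern k m s) * exp (- Im s * v) \<le> \<bar>K\<bar> * 4 ^ m * exp (- ?\<mu> * \<bar>Im s\<bar>) / (1 + Im s ^ 2)"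
    if s: "Re s \<ge> c0" "\<bar>Im s\<bar> \<ge> 1" for s
  proof -
    have "norm (R s) \<le> \<bar>K\<bar> / (1 + Im s ^ 2)"
      by (rule order_trans[OF K[OF s]]) (simp add: divide_right_mono)
    then have "norm (R s) * (norm (kern k m s) * exp (- Im s * v)) \<le> (\<bar>K\<bar> / (1 + Im s ^ 2)) * (4 ^ m * exp (- ?\<mu> * \<bar>Im s\<bar>))"
      by (rule mult_mono) (use norm_kern_decay[OF s(2)] in auto)
    then show ?thesis by (simp add: norm_mult mult_ac)
  qed
  then show ?thesis by (intro exI[of _ "\<bar>K\<bar> * 4 ^ m"]) auto
qed

lemma exp_decay_R_kern:
  assumes u: "- ((of_int k + real m) * pi) < Im u" "Im u < (real m - of_int k) * pi"
    and c: "c0 \<le> c" "c < 1" "c \<noteq> 0"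
  shows "exp_decay c (\<lambda>s. R s * kern k m s) u"
proof -
  obtain K where K: "K \<ge> 0" "\<And>s. Re s \<ge> c0 \<Longrightarrow> \<bar>Im s\<bar> \<ge> 1 \<Longrightarrow>
      norm (R s * kern k m s) * exp (- Im s * Im u) \<le> K * exp (- min (Im u + (of_int k + real m) * pi) ((real m - of_int k) * pi - Im u) * \<bar>Im s\<bar>) / (1 + Im s ^ 2)"
    using R_kern_decay[of k m "Im u"] by blast
  show ?thesis
  proof (rule exp_decay_tail[OF continuous_R_kern[OF c]])
    show "min (Im u + (of_int k + real m) * pi) ((real m - of_int k) * pi - Im u) > 0" using u by auto
    fix t :: real assume t: "\<bar>t\<bar> \<ge> 1"
    have "norm (R (Complex c t) * kern k m (Complex c t)) * exp (- t * Im u)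
        \<le> K * exp (- min (Im u + (of_int k + real m) * pi) ((real m - of_int k) * pi - Im u) * \<bar>t\<bar>) / (1 + t ^ 2)"
      using K(2)[of "Complex c t"] c t by simp
    also have "\<dots> \<le> K * exp (- min (Im u + (of_int k + real m) * pi) ((real m - of_int k) * pi - Im u) * \<bar>t\<bar>) / 1"
      using K(1) by (intro divide_left_mono) (auto intro: add_pos_nonneg)
    finally show "norm (R (Complex c t) * kern k m (Complex c t)) * exp (- t * Im u)
        \<le> K * exp (- min (Im u + (of_int k + real m) * pi) ((real m - of_int k) * pi - Im u) * \<bar>t\<bar>)" by simp
  qed
qed

lemma strip_bound:
  assumes u: "- ((of_int k + real m) * pi) < Im u" "Im u < (real m - of_int k) * pi"
  shows "\<exists>K. \<forall>s. c0 \<le> Re s \<and> Re s \<le> 1 \<and> \<bar>Im s\<bar> \<ge> 1 \<longrightarrow>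
    norm (s ^ n * (R s * kern k m s) * exp (s * u)) \<le> K / (1 + Im s ^ 2)"
proof -
  define \<epsilon> where "\<epsilon> = min (Im u + (of_int k + real m) * pi) ((real m - of_int k) * pi - Im u)"
  have \<epsilon>: "\<epsilon> > 0" using u by (simp add: \<epsilon>_def)
  obtain K where K: "K \<ge> 0" "\<And>s. Re s \<ge> c0 \<Longrightarrow> \<bar>Im s\<bar> \<ge> 1 \<Longrightarrow>
      norm (R s * kern k m s) * exp (- Im s * Im u) \<le> K * exp (- \<epsilon> * \<bar>Im s\<bar>) / (1 + Im s ^ 2)"
    using R_kern_decay[of k m "Im u"] unfolding \<epsilon>_def by blast
  obtain M where M: "\<And>t. (1 + \<bar>t\<bar>) ^ n * exp (- \<epsilon> * \<bar>t\<bar>) \<le> M"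
    using power_mult_exp_decay[OF \<epsilon>, of n] by blast
  have "norm (s ^ n * (R s * kern k m s) * exp (s * u)) \<le> exp \<bar>Re u\<bar> * M * K / (1 + Im s ^ 2)"
    if s: "c0 \<le> Re s" "Re s \<le> 1" "\<bar>Im s\<bar> \<ge> 1" for s
  proof -
    have "norm s \<le> 1 + \<bar>Im s\<bar>" using cmod_le[of s] s by linarith
    then have n: "norm (s ^ n) \<le> (1 + \<bar>Im s\<bar>) ^ n" unfolding norm_power by (intro power_mono) auto
    have "Re s * Re u \<le> \<bar>Re s\<bar> * \<bar>Re u\<bar>" by (metis abs_ge_self abs_mult)
    also have "\<dots> \<le> 1 * \<bar>Re u\<bar>" using s by (intro mult_right_mono) auto
    finally have e: "exp (Re s * Re u) \<le> exp \<bar>Re u\<bar>" by simp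
    have "norm (s ^ n * (R s * kern k m s) * exp (s * u))
        = exp (Re s * Re u) * (norm (s ^ n) * (norm (R s * kern k m s) * exp (- Im s * Im u)))"
      using norm_exp_mult[of "s ^ n * (R s * kern k m s)" "Re s" "Im s" u] by (simp add: norm_mult mult_ac)
    also have "\<dots> \<le> exp \<bar>Re u\<bar> * ((1 + \<bar>Im s\<bar>) ^ n * (K * exp (- \<epsilon> * \<bar>Im s\<bar>) / (1 + Im s ^ 2)))"
      using K(1) by (intro mult_mono e n K(2) s mult_nonneg_nonneg divide_nonneg_nonneg) auto
    also have "\<dots> = exp \<bar>Re u\<bar> * K / (1 + Im s ^ 2) * ((1 + \<bar>Im s\<bar>) ^ n * exp (- \<epsilon> * \<bar>Im s\<bar>))" by simp
    also have "\<dots> \<le> exp \<bar>Re u\<bar> * K / (1 + Im s ^ 2) * M"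
      using K(1) by (intro mult_left_mono M) auto
    finally show ?thesis by (simp add: mult_ac)
  qed
  then show ?thesis by blast
qed

text \<open>theta is d/du for u = log(C z), and d/du brings down a factor s; inserting s^n therefore
  gives the n-th entry of the chain.\<close>

definition upper_chain :: "int \<Rightarrow> nat \<Rightarrow> nat \<Rightarrow> complex \<Rightarrow> complex" where
  "upper_chain k m n z = mellin c0 (\<lambda>s. s ^ n * (R s * kern k m s)) (Ln (of_int C * z))"

lemma Im_Ln_upper: "Im z > 0 \<Longrightarrow> 0 < Im (Ln (of_int C * z)) \<and> Im (Ln (of_int C * z)) < pi"
  using C Im_Ln_pos_lt_imp[of "of_int C * z"] Im_Ln_pos_lt[of "of_int C * z"] by (auto simp: )

text \<open>The bounds on \<open>k\<close> make the strip of convergence contain 0 < arg x <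
  pi.\<close>

lemma upper_strip:
  assumes km: "- int m \<le> k" "k \<le> int m - 2" and z: "Im z > 0"
  shows "- ((of_int k + real m) * pi) < Im (Ln (of_int C * z))" "Im (Ln (of_int C * z)) < (real m - of_int k) * pi"
proof -
  have "0 \<le> of_int k + real m" "1 \<le> real m - of_int k" using km by linarith+
  then have "0 * pi \<le> (of_int k + real m) * pi" "1 * pi \<le> (real m - of_int k) * pi"
    by (intro mult_right_mono; simp)+
  then show "- ((of_int k + real m) * pi) < Im (Ln (of_int C * z))" "Im (Ln (of_int C * z)) < (real m - of_int k) * pi"
    using Im_Ln_upper[OF z] by linarith+
qed

lemma upper_chain:
  assumes km: "- int m \<le> k" "k \<le> int m - 2"
  shows "theta_chain {z. Im z > 0} (upper_chain k m)"
  unfolding theta_chain_def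
proof (intro allI ballI)
  fix n z assume "z \<in> {z. Im z > 0}"
  then have z: "Im z > 0" by simp
  let ?u = "Ln (of_int C * z)"
  note u = upper_strip[OF km z]
  have dec: "exp_decay c0 (\<lambda>s. s ^ n * (R s * kern k m s)) ?u"
  proof (induction n)
    case 0
    show ?case using exp_decay_R_kern[OF u, of c0] by simp
  next
    case (Suc n)
    from exp_decay_mult_s[OF this] show ?case by (simp add: mult.assoc)
  qed
  have cont: "continuous_on UNIV (\<lambda>t. Complex c0 t ^ n * (R (Complex c0 t) * kern k m (Complex c0 t)))"
    by (intro continuous_on_mult continuous_on_power continuous_R_kern
        continuous_on_Complex_line[of UNIV "\<lambda>s. s"]) auto
  have nr: "of_int C * z \<notin> \<real>\<^sub>\<le>\<^sub>0" using z C by (auto simp: complex_nonpos_Reals_iff)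
  have "((\<lambda>z. Ln (of_int C * z)) has_field_derivative inverse (of_int C * z) * of_int C) (at z)"
    using nr by (auto intro!: derivative_eq_intros simp: divide_inverse)
  from DERIV_chain2[OF mellin_has_field_derivative[OF cont dec] this]
  have "(upper_chain k m n has_field_derivative mellin c0 (\<lambda>s. s * (s ^ n * (R s * kern k m s))) ?u
      * (inverse (of_int C * z) * of_int C)) (at z)"
    unfolding upper_chain_def .
  moreover have "inverse (of_int C * z) * of_int C = 1 / z" using C z by (auto simp: field_simps)
  ultimately show "(upper_chain k m n has_field_derivative upper_chain k m (Suc n) z / z) (at z)"
    by (simp add: upper_chain_def mult.assoc)
qed

lemma tpoly_powers: "tpoly A B (\<lambda>n. s ^ n) = (s + A) * (s + 1 - A) * ((s + B) * (s + 1 - B))"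
  unfolding tpoly_def tshift_def by (simp add: algebra_simps)

lemma integrable_s_power_R_kern:
  assumes u: "- ((of_int k + real m) * pi) < Im u" "Im u < (real m - of_int k) * pi"
    and c: "c0 \<le> c" "c < 1" "c \<noteq> 0"
  shows "integrable lborel (\<lambda>t. Complex c t ^ n * (R (Complex c t) * kern k m (Complex c t)) * exp (Complex c t * u))"
proof (rule mellin_integrable[of "\<lambda>s. s ^ n * (R s * kern k m s)"])
  show "continuous_on UNIV (\<lambda>t. Complex c t ^ n * (R (Complex c t) * kern k m (Complex c t)))"
    by (intro continuous_on_mult continuous_on_power continuous_R_kern c
        continuous_on_Complex_line[of UNIV "\<lambda>s. s"]) auto
  show "exp_decay c (\<lambda>s. s ^ n * (R s * kern k m s)) u"
  proof (induction n)
    case 0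
    show ?case using exp_decay_R_kern[OF u c] by simp
  next
    case (Suc n)
    from exp_decay_mult_s[OF this] show ?case by (simp add: mult.assoc)
  qed
qed

text \<open>Shifting the contour by \<open>1\<close> turns the recurrence for \<open>R\<close> into the differential equation; the
  factor \<open>s\<^sup>4\<close> cancels the only pole in the strip.\<close>

lemma upper_solution:
  assumes km: "- int m \<le> k" "k \<le> int m - 2" "even (k + int m)" "m \<le> 4" and z: "Im z > 0"
  shows "picard_fuchs A B C (upper_chain k m 0) z = 0"
proof -
  define u where "u = Ln (of_int C * z)"
  note u = upper_strip[OF km(1,2) z, folded u_def]
  have "z \<noteq> 0" using z by auto
  then have eu: "exp u = of_int C * z" using C by (simp add: u_def)
  define f where "f = (\<lambda>s. R s * kern k m s)"
  define H where "H = (\<lambda>s. s ^ 4 * f s * exp (s * u))"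
  have int: "integrable lborel (\<lambda>t. Complex c0 t ^ n * f (Complex c0 t) * exp (Complex c0 t * u))" for n
    unfolding f_def by (rule integrable_s_power_R_kern[OF u]) auto
  have G: "upper_chain k m n z = (LINT t|lborel. Complex c0 t ^ n * f (Complex c0 t) * exp (Complex c0 t * u))" for n
    by (simp add: upper_chain_def mellin_def line_int_def u_def f_def)
  have "tpoly A B (\<lambda>n. upper_chain k m n z)
      = (LINT t|lborel. tpoly A B (\<lambda>n. Complex c0 t ^ n) * (f (Complex c0 t) * exp (Complex c0 t * u)))"
  proof -
    have "(LINT t|lborel. tpoly A B (\<lambda>n. Complex c0 t ^ n) * (f (Complex c0 t) * exp (Complex c0 t * u)))
      = (LINT t|lborel. Complex c0 t ^ 4 * f (Complex c0 t) * exp (Complex c0 t * u)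
        + 2 * (Complex c0 t ^ 3 * f (Complex c0 t) * exp (Complex c0 t * u))
        + of_real (1 + A * (1 - A) + B * (1 - B)) * (Complex c0 t ^ 2 * f (Complex c0 t) * exp (Complex c0 t * u))
        + of_real (A * (1 - A) + B * (1 - B)) * (Complex c0 t ^ 1 * f (Complex c0 t) * exp (Complex c0 t * u))
        + of_real (A * (1 - A) * (B * (1 - B))) * (Complex c0 t ^ 0 * f (Complex c0 t) * exp (Complex c0 t * u)))"
      unfolding tpoly_expand by (rule Bochner_Integration.integral_cong[OF refl]) (simp only: distrib_right mult.assoc)
    also have "\<dots> = tpoly A B (\<lambda>n. upper_chain k m n z)"
      unfolding tpoly_expand G using int[of 0] int[of 1] int[of 2] int[of 3] int[of 4]
      by (simp only: Bochner_Integration.integral_add integral_mult_right_zero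
        Bochner_Integration.integrable_add integrable_mult_right)
    finally show ?thesis by simp
  qed
  then have "of_int C * z * tpoly A B (\<lambda>n. upper_chain k m n z)
      = (LINT t|lborel. exp u * (tpoly A B (\<lambda>n. Complex c0 t ^ n) * (f (Complex c0 t) * exp (Complex c0 t * u))))"
    by (simp only: eu integral_mult_right_zero)
  also have "\<dots> = line_int (c0 + 1) H"
    unfolding line_int_def
  proof (rule Bochner_Integration.integral_cong[OF refl])
    fix t
    let ?s = "Complex c0 t"
    have s1: "Complex (c0 + 1) t = ?s + 1" by (simp add: complex_eq_iff)
    have R1: "(?s + 1) ^ 4 * R (?s + 1) = tpoly A B (\<lambda>n. ?s ^ n) * R ?s"
      unfolding tpoly_powers by (rule R_plus1) simp
    have "H (?s + 1) = ((?s + 1) ^ 4 * R (?s + 1)) * kern k m (?s + 1) * exp ((?s + 1) * u)"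
      by (simp add: H_def f_def)
    also have "\<dots> = exp u * (tpoly A B (\<lambda>n. ?s ^ n) * (f ?s * exp (?s * u)))"
      unfolding R1 kern_plus1[OF km(3)] by (simp add: f_def distrib_right exp_add)
    finally show "exp u * (tpoly A B (\<lambda>n. ?s ^ n) * (f ?s * exp (?s * u))) = H (Complex (c0 + 1) t)"
      unfolding s1 by simp
  qed
  also have "\<dots> = line_int c0 H"
  proof -
    \<comment> \<open>With \<open>kern_reg\<close> in place of s^4 times \<open>kern\<close> the
      integrand is holomorphic at 0 too, so the shift crosses no singularity.\<close>
    let ?H = "\<lambda>s. R s * kern_reg k m s * exp (s * u)"
    have H: "?H s = H s" if "s \<noteq> 0" for s using kern_reg_eq[OF that km(4)] by (simp add: H_def f_def)
    obtain K where K: "\<And>s. c0 \<le> Re s \<Longrightarrow> Re s \<le> 1 \<Longrightarrow> \<bar>Im s\<bar> \<ge> 1 \<Longrightarrow> norm (H s) \<le> K / (1 + Im s ^ 2)"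
      using strip_bound[OF u, of 4] unfolding H_def f_def by blast
    have "line_int c0 ?H = line_int (c0 + 1) ?H"
    proof (rule line_int_shift_holomorphic)
      have "R holomorphic_on {s. - (1 / 12) < Re s \<and> Re s < 1}"
        "kern_reg k m holomorphic_on {s. - (1 / 12) < Re s \<and> Re s < 1}"
        by (rule holomorphic_on_subset[OF holomorphic_R] holomorphic_on_subset[OF holomorphic_kern_reg]; auto)+
      then show "?H holomorphic_on {s. - (1 / 12) < Re s \<and> Re s < 1}" by (intro holomorphic_intros)
      fix s assume s: "c0 \<le> Re s" "Re s \<le> c0 + 1" "\<bar>Im s\<bar> \<ge> 1"
      then have "s \<noteq> 0" by auto
      then show "norm (?H s) \<le> K / (1 + Im s ^ 2)" unfolding H[OF \<open>s \<noteq> 0\<close>] using K s by auto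
    qed auto
    moreover have "line_int c ?H = line_int c H" if "c \<noteq> 0" for c
      by (rule line_int_cong, rule H) (use that in \<open>auto simp: complex_eq_iff\<close>)
    ultimately show ?thesis by simp
  qed
  also have "\<dots> = upper_chain k m 4 z" by (simp add: G line_int_def H_def)
  finally have eq: "of_int C * z * tpoly A B (\<lambda>n. upper_chain k m n z) = upper_chain k m 4 z" .
  have "picard_fuchs A B C (upper_chain k m 0) z
      = upper_chain k m 4 z - of_int C * z * tpoly A B (\<lambda>n. upper_chain k m n z)"
    by (rule picard_fuchs_chain[OF _ _ upper_chain[OF km(1,2)]]) (use z open_halfspace_Im_gt in auto)
  then show ?thesis using eq by simp
qed

end

section \<open>Residues at s = 0 and asymptotics at z = 0\<close>

context mellin_barnes
begin

lemma Ln_C_mult: "z \<noteq> 0 \<Longrightarrow> Ln (of_int C * z) = of_real (ln (of_int C)) + Ln z"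
proof -
  assume z: "z \<noteq> 0"
  have "Ln (complex_of_real (of_int C) * z) = Ln (complex_of_real (of_int C)) + Ln z"
    by (rule Ln_times_of_real) (use z C in auto)
  moreover have "Ln (complex_of_real (of_int C)) = complex_of_real (ln (of_int C))"
    by (rule Ln_of_real) (use C in simp)
  ultimately show ?thesis by (simp only: of_real_of_int_eq)
qed

text \<open>Between Re s = -1/24 and Re s = 1/2 the only pole is 0, of order at most 4. Its residue
  is the s^3 coefficient of a Taylor series times exp(s log z), hence a polynomial in log z of
  degree at most 3.\<close>

lemma upper_chain_expansion:
  assumes km: "- int m \<le> k" "k \<le> int m - 2" "m \<le> 4" and z: "Im z > 0"
    and P: "(\<lambda>s. kern_reg k m s * (R s * exp (of_real (ln (of_int C)) * s))) has_fps_expansion P"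
  shows "upper_chain k m 0 z = mellin (1/2) (\<lambda>s. R s * kern k m s) (Ln (of_int C * z))
    - 2 * of_real pi * (\<Sum>j<4. fps_nth P (3 - j) * Ln z ^ j / fact j)"
proof -
  define u where "u = Ln (of_int C * z)"
  note u = upper_strip[OF km(1,2) z, folded u_def]
  have z0: "z \<noteq> 0" using z by auto
  let ?f = "\<lambda>s. R s * kern k m s * exp (s * u)"
  obtain K where K: "\<And>s. c0 \<le> Re s \<Longrightarrow> Re s \<le> 1 \<Longrightarrow> \<bar>Im s\<bar> \<ge> 1 \<Longrightarrow> norm (?f s) \<le> K / (1 + Im s ^ 2)"
    using strip_bound[OF u, of 0] by auto
  have "line_int c0 ?f - line_int (1/2) ?f = - 2 * of_real pi * (\<Sum>p\<in>{0}. residue ?f p)"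
  proof (rule line_int_shift)
    have "R holomorphic_on {s. - (1 / 12) < Re s \<and> Re s < 1} - {0}"
      "kern k m holomorphic_on {s. - (1 / 12) < Re s \<and> Re s < 1} - {0}"
      by (rule holomorphic_on_subset[OF holomorphic_R] holomorphic_on_subset[OF holomorphic_kern]; auto)+
    then show "?f holomorphic_on {s. - (1 / 12) < Re s \<and> Re s < 1} - {0}" by (intro holomorphic_intros)
    show "norm (?f s) \<le> K / (1 + Im s ^ 2)" if "c0 \<le> Re s" "Re s \<le> 1/2" "\<bar>Im s\<bar> \<ge> 1" for s
      using K that by auto
  qed auto
  also have "(\<Sum>p\<in>{0}. residue ?f p) = residue ?f 0" by simp
  also have "residue ?f 0 = residue (\<lambda>s. (kern_reg k m s * (R s * exp (of_real (ln (of_int C)) * s)) * exp (Ln z * s)) / s ^ Suc 3) 0"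
  proof (rule residue_cong)
    have "?f s = (kern_reg k m s * (R s * exp (of_real (ln (of_int C)) * s)) * exp (Ln z * s)) / s ^ Suc 3" if "s \<noteq> 0" for s
      using that kern_reg_eq[OF that km(3), of k] Ln_C_mult[OF z0]
      by (simp add: u_def distrib_left exp_add mult_ac eval_nat_numeral)
    then show "\<forall>\<^sub>F s in at 0. ?f s = (kern_reg k m s * (R s * exp (of_real (ln (of_int C)) * s)) * exp (Ln z * s)) / s ^ Suc 3"
      by (auto simp: eventually_at_filter)
  qed auto
  also have "\<dots> = fps_nth (P * fps_exp (Ln z)) 3"
    by (intro residue_fps_expansion_over_power_at_0 fps_expansion_intros P)
  also have "\<dots> = (\<Sum>j<4. fps_nth P (3 - j) * Ln z ^ j / fact j)"
    by (simp add: fps_mult_nth eval_nat_numeral)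
  finally show ?thesis
    by (simp add: upper_chain_def mellin_def u_def algebra_simps)
qed

text \<open>The integral left over on Re s = 1/2 is O(|z|^(1/2)) along the ray, so the residue
  polynomial gives the asymptotics up to o(1) and thereby the solution.\<close>

theorem upper_chain_eq:
  assumes km: "- int m \<le> k" "k \<le> int m - 2" "even (k + int m)" "m \<le> 4"
    and P: "(\<lambda>s. kern_reg k m s * (R s * exp (of_real (ln (of_int C)) * s))) has_fps_expansion P"
    and z: "z \<in> half_disc"
  shows "upper_chain k m 0 z = (\<Sum>j<4. (- 2 * of_real pi * fps_nth P (3 - j)) * y j z)"
proof (rule solution_identify[OF _ _ _ z])
  have "(upper_chain k m 0 has_field_derivative upper_chain k m (Suc 0) z / z) (at z)" if "z \<in> half_disc" for z
    using upper_chain[OF km(1,2)] that by (auto simp: theta_chain_def half_disc_def)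
  then show "upper_chain k m 0 holomorphic_on half_disc"
    using half_disc(1) by (auto simp: holomorphic_on_open)
  show "picard_fuchs A B C (upper_chain k m 0) z = 0" if "z \<in> half_disc" for z
    using upper_solution[OF km] that by (simp add: half_disc_def)
  let ?f = "\<lambda>s. R s * kern k m s"
  define I where "I = (LINT t|lborel. norm (?f (Complex (1/2) t)) * exp (- t * (pi/2)))"
  have le: "norm (mellin (1/2) ?f (Ln (of_int C * imag_ray r))) \<le> exp ((ln (of_int C) - r) / 2) * I" for r
  proof -
    define u where "u = Ln (of_int C * imag_ray r)"
    have "u = of_real (ln (of_int C)) + Ln (imag_ray r)"
      unfolding u_def by (rule Ln_C_mult) (simp add: imag_ray_def)
    then have u: "Re u = ln (of_int C) - r" "Im u = pi / 2" by (simp_all add: Ln_imag_ray)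
    have "norm (mellin (1/2) ?f u) \<le> (LINT t|lborel. norm (?f (Complex (1/2) t) * exp (Complex (1/2) t * u)))"
      unfolding mellin_def line_int_def by (rule integral_norm_bound)
    also have "\<dots> = (LINT t|lborel. exp ((ln (of_int C) - r) / 2) * (norm (?f (Complex (1/2) t)) * exp (- t * (pi/2))))"
      unfolding norm_exp_mult u by (rule Bochner_Integration.integral_cong[OF refl]) (simp add: mult_ac)
    finally show ?thesis by (simp add: u_def I_def)
  qed
  have lim0: "((\<lambda>r. mellin (1/2) ?f (Ln (of_int C * imag_ray r))) \<longlongrightarrow> 0) at_top"
  proof (rule Lim_null_comparison[OF always_eventually[OF allI[OF le]]])
    have "filterlim (\<lambda>r::real. - (r / 2)) at_bot at_top"
      by (intro filterlim_compose[OF filterlim_uminus_at_bot_at_top] filterlim_at_top_mult_tendsto_pos[OF tendsto_const, of "1/2", simplified] filterlim_ident)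
    then have "((\<lambda>r::real. exp (- (r / 2))) \<longlongrightarrow> 0) at_top"
      by (rule filterlim_compose[OF exp_at_bot])
    then have "((\<lambda>r::real. exp (ln (of_int C) / 2) * exp (- (r / 2)) * I) \<longlongrightarrow> exp (ln (of_int C) / 2) * 0 * I) at_top"
      by (intro tendsto_intros)
    then show "((\<lambda>r. exp ((ln (of_int C) - r) / 2) * I) \<longlongrightarrow> 0) at_top"
      by (simp add: diff_divide_distrib flip: exp_add)
  qed
  show "((\<lambda>r. upper_chain k m 0 (imag_ray r)
     - (\<Sum>j<4. (- 2 * of_real pi * fps_nth P (3 - j)) * Ln (imag_ray r) ^ j / fact j)) \<longlongrightarrow> 0) at_top"
  proof (rule Lim_transform_eventually[OF lim0], rule always_eventually, rule allI)
    fix r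
    have "Im (imag_ray r) > 0" by (simp add: imag_ray_def)
    from upper_chain_expansion[OF km(1,2,4) this P]
    show "mellin (1/2) ?f (Ln (of_int C * imag_ray r)) = upper_chain k m 0 (imag_ray r)
     - (\<Sum>j<4. (- 2 * of_real pi * fps_nth P (3 - j)) * Ln (imag_ray r) ^ j / fact j)"
      by (simp add: sum_distrib_left sum_negf mult.assoc)
  qed
qed

end

section \<open>The Frobenius expansion of the Mellin--Barnes solutions\<close>

lemma higher_deriv_chain:
  assumes S: "open S" and g: "\<And>n z. n < N \<Longrightarrow> z \<in> S \<Longrightarrow> (g n has_field_derivative g (Suc n) z) (at z)"
    and n: "n \<le> N" "z \<in> S"
  shows "(deriv ^^ n) (g 0) z = g n z"
  using n
proof (induction n arbitrary: z)
  case (Suc n)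
  have "\<forall>\<^sub>F w in nhds z. (deriv ^^ n) (g 0) w = g n w"
    by (rule eventually_mono[OF eventually_nhds_in_open[OF S Suc.prems(2)]]) (use Suc in simp)
  then have "deriv ((deriv ^^ n) (g 0)) z = deriv (g n) z" by (rule deriv_cong_ev) simp
  also have "\<dots> = g (Suc n) z" by (rule DERIV_imp_deriv, rule g) (use Suc.prems in auto)
  finally show ?case by simp
qed simp

lemma fps_mult_nth_small:
  fixes f g :: "complex fps"
  shows "fps_nth (f * g) 0 = fps_nth f 0 * fps_nth g 0"
    "fps_nth (f * g) 1 = fps_nth f 0 * fps_nth g 1 + fps_nth f 1 * fps_nth g 0"
    "fps_nth (f * g) 2 = fps_nth f 0 * fps_nth g 2 + fps_nth f 1 * fps_nth g 1 + fps_nth f 2 * fps_nth g 0"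
    "fps_nth (f * g) 3 = fps_nth f 0 * fps_nth g 3 + fps_nth f 1 * fps_nth g 2 + fps_nth f 2 * fps_nth g 1 + fps_nth f 3 * fps_nth g 0"
  by (simp_all add: fps_mult_nth eval_nat_numeral)

definition sinc_fps :: "complex fps" where "sinc_fps = fps_expansion sinc_pi 0"

lemma sinc_pi_has_fps_expansion: "sinc_pi has_fps_expansion sinc_fps"
  unfolding sinc_fps_def by (rule has_fps_expansion_fps_expansion[of UNIV]) (auto intro: holomorphic_sinc_pi)

lemma sinc_fps_nth: "fps_nth sinc_fps n = fps_nth (fps_sin (of_real pi)) (Suc n)"
proof -
  have "(\<lambda>s. s * sinc_pi s) has_fps_expansion fps_X * sinc_fps"
    by (intro fps_expansion_intros sinc_pi_has_fps_expansion)
  then have "(\<lambda>s. sin (of_real pi * s)) has_fps_expansion fps_X * sinc_fps" unfolding sinc_pi_mult .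
  from fps_nth_fps_expansion[OF this, of "Suc n"] fps_nth_fps_expansion[OF has_fps_expansion_sin, of "of_real pi" "Suc n"]
  show ?thesis by simp
qed

lemma sinc_fps_coeffs:
  "fps_nth sinc_fps 0 = of_real pi" "fps_nth sinc_fps 1 = 0"
  "fps_nth sinc_fps 2 = - (of_real pi ^ 3 / 6)" "fps_nth sinc_fps 3 = 0"
  by (simp_all add: sinc_fps_nth fps_sin_def fact_numeral)

lemma inverse_sinc_coeffs:
  "fps_nth (inverse sinc_fps) 0 = 1 / of_real pi" "fps_nth (inverse sinc_fps) 1 = 0"
  "fps_nth (inverse sinc_fps) 2 = of_real pi / 6" "fps_nth (inverse sinc_fps) 3 = 0"
proof -
  let ?I = "inverse sinc_fps"
  have I: "?I * sinc_fps = 1" by (rule inverse_mult_eq_1) (simp add: sinc_fps_coeffs)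
  note c = sinc_fps_coeffs
  have 0: "fps_nth ?I 0 * of_real pi = 1"
    using arg_cong[OF I, of "\<lambda>f. fps_nth f 0"] unfolding fps_mult_nth_small c by simp
  then show i0: "fps_nth ?I 0 = 1 / of_real pi" by (simp add: field_simps)
  have "fps_nth ?I 1 * of_real pi = 0"
    using arg_cong[OF I, of "\<lambda>f. fps_nth f 1"] unfolding fps_mult_nth_small c by simp
  then show i1: "fps_nth ?I 1 = 0" by simp
  have "fps_nth ?I 2 * of_real pi = of_real pi ^ 2 / 6"
    using arg_cong[OF I, of "\<lambda>f. fps_nth f 2"] unfolding fps_mult_nth_small c i0 i1
    by (simp add: field_simps eval_nat_numeral)
  then show i2: "fps_nth ?I 2 = of_real pi / 6" by (simp add: field_simps power2_eq_square)
  have "fps_nth ?I 3 * of_real pi = 0"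
    using arg_cong[OF I, of "\<lambda>f. fps_nth f 3"] unfolding fps_mult_nth_small c i0 i1 i2 by simp
  then show "fps_nth ?I 3 = 0" by simp
qed

section \<open>Taylor coefficients for a row of the table\<close>

locale mirror_case = frobenius +
  fixes H3 c2H c3 d1 d2 :: int
  assumes row: "(A, B, C, H3, c2H, c3, d1, d2) \<in> cy_table"

sublocale mirror_case \<subseteq> mellin_barnes
proof
  show "1/12 \<le> A" "A \<le> 1/2" "1/12 \<le> B" "B \<le> 1/2"
    using row by (rule cy_table_cases; simp)+
qed

context mirror_case
begin

lemma H3: "H3 > 0"
  using row by (rule cy_table_cases; simp)

definition polygamma_sum :: "nat \<Rightarrow> complex \<Rightarrow> complex" where
  "polygamma_sum n s = Polygamma n (s + A) + Polygamma n (s + 1 - A) + Polygamma n (s + B) + Polygamma n (s + 1 - B)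
     - 4 * Polygamma n (s + 1)"

lemma polygamma_sum_0: "polygamma_sum n 0 = of_real (quad_sum (Polygamma n) A B)"
proof -
  have p: "complex_of_real (Polygamma n x) = Polygamma n (of_real x)" if "x > 0" for x
    using Polygamma_of_real[of x n, where 'a = complex] that by simp
  show ?thesis using p[of A] p[of B] p[of "1 - A"] p[of "1 - B"] p[of 1] AB
    by (simp add: polygamma_sum_def quad_sum_def)
qed

lemma polygamma_sum_deriv:
  assumes "Re s > - (1 / 12)"
  shows "(polygamma_sum n has_field_derivative polygamma_sum (Suc n) s) (at s)"
proof -
  have "s + A \<notin> \<int>\<^sub>\<le>\<^sub>0" "s + 1 - A \<notin> \<int>\<^sub>\<le>\<^sub>0" "s + B \<notin> \<int>\<^sub>\<le>\<^sub>0" "s + 1 - B \<notin> \<int>\<^sub>\<le>\<^sub>0" "s + 1 \<notin> \<int>\<^sub>\<le>\<^sub>0"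
    using assms AB nonpos_Int_Re[of "s + A"] nonpos_Int_Re[of "s + 1 - A"]
      nonpos_Int_Re[of "s + B"] nonpos_Int_Re[of "s + 1 - B"] nonpos_Int_Re[of "s + 1"] by auto
  then show ?thesis unfolding polygamma_sum_def
    by (auto intro!: derivative_eq_intros)
qed

lemma hyp_pair_deriv:
  assumes "Re s > - (1 / 12)" "1 / 12 \<le> a" "a \<le> 1 / 2"
  shows "(hyp_pair a has_field_derivative
     hyp_pair a s * (Digamma (s + a) + Digamma (s + 1 - a) - 2 * Digamma (s + 1))) (at s)"
proof -
  have n: "s + a \<notin> \<int>\<^sub>\<le>\<^sub>0" "s + 1 - a \<notin> \<int>\<^sub>\<le>\<^sub>0" "s + 1 \<notin> \<int>\<^sub>\<le>\<^sub>0"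
    using assms nonpos_Int_Re[of "s + a"] nonpos_Int_Re[of "s + 1 - a"] nonpos_Int_Re[of "s + 1"] by auto
  have "((\<lambda>s. rGamma (s + 1)) has_field_derivative - rGamma (s + 1) * Digamma (s + 1) * 1) (at s)"
    by (rule DERIV_chain2[OF has_field_derivative_rGamma_no_nonpos_int]) (use n in \<open>auto intro!: derivative_eq_intros\<close>)
  then have "((\<lambda>s. Gamma (s + a) * Gamma (s + 1 - a) * rGamma (s + 1) ^ 2) has_field_derivative
      Gamma (s + a) * Gamma (s + 1 - a) * rGamma (s + 1) ^ 2
        * (Digamma (s + a) + Digamma (s + 1 - a) - 2 * Digamma (s + 1))) (at s)"
    using n by (auto intro!: derivative_eq_intros simp: algebra_simps power2_eq_square)
  from DERIV_cmult[OF this, of "of_real (sin (pi * a) / pi)"]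
  show ?thesis unfolding hyp_pair_def[abs_def] by (simp only: mult.assoc)
qed

abbreviation lnC :: complex where "lnC \<equiv> of_real (ln (of_int C))"

text \<open>R(s) C^s and its first three derivatives, written through the complete Bell polynomials
  of the logarithmic derivatives. The last branch of the conditional is meant for n = 3.\<close>

definition E :: "nat \<Rightarrow> complex \<Rightarrow> complex" where
  "E n s = R s * exp (lnC * s) * (let g = polygamma_sum 0 s + lnC; p1 = polygamma_sum 1 s; p2 = polygamma_sum 2 s in
     if n = 0 then 1 else if n = 1 then g else if n = 2 then g ^ 2 + p1 else g ^ 3 + 3 * g * p1 + p2)"

lemma E_deriv:
  assumes "n < 3" "Re s > - (1 / 12)"
  shows "(E n has_field_derivative E (Suc n) s) (at s)"
proof -
  have "(R has_field_derivative R s * polygamma_sum 0 s) (at s)"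
    unfolding R_def polygamma_sum_def
    by (rule derivative_eq_intros hyp_pair_deriv AB assms refl)+ (simp add: algebra_simps)
  then have E0: "((\<lambda>s. R s * exp (lnC * s)) has_field_derivative R s * exp (lnC * s) * (polygamma_sum 0 s + lnC)) (at s)"
    by (auto intro!: derivative_eq_intros simp: algebra_simps)
  note d = E0 polygamma_sum_deriv[OF assms(2), of 0] polygamma_sum_deriv[OF assms(2), of 1]
  from assms(1) consider "n = 0" | "n = 1" | "n = 2" by linarith
  then show ?thesis
  proof cases
    case 1
    then show ?thesis using E0 by (simp add: E_def[abs_def])
  next
    case 2
    define X where "X = (\<lambda>s. R s * exp (lnC * s))"
    have X: "(X has_field_derivative X s * (polygamma_sum 0 s + lnC)) (at s)" using E0 by (simp add: X_def)
    have "((\<lambda>s. X s * (polygamma_sum 0 s + lnC)) has_field_derivative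
        X s * ((polygamma_sum 0 s + lnC) ^ 2 + polygamma_sum 1 s)) (at s)"
      by (rule derivative_eq_intros X d refl)+ (simp add: algebra_simps power2_eq_square)
    then show ?thesis unfolding 2 by (simp add: E_def[abs_def] X_def)
  next
    case 3
    define X where "X = (\<lambda>s. R s * exp (lnC * s))"
    have X: "(X has_field_derivative X s * (polygamma_sum 0 s + lnC)) (at s)" using E0 by (simp add: X_def)
    have "((\<lambda>s. X s * ((polygamma_sum 0 s + lnC) ^ 2 + polygamma_sum 1 s)) has_field_derivative
        X s * ((polygamma_sum 0 s + lnC) ^ 3 + 3 * (polygamma_sum 0 s + lnC) * polygamma_sum 1 s + polygamma_sum 2 s)) (at s)"
      by (rule derivative_eq_intros X d refl)+ (simp add: algebra_simps power2_eq_square power3_eq_cube numeral_2_eq_2)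
    then show ?thesis unfolding 3 by (simp add: E_def[abs_def] X_def)
  qed
qed

definition E_fps :: "complex fps" where "E_fps = fps_expansion (E 0) 0"

text \<open>\<open>r2\<close> and \<open>r3\<close> are the second and third Taylor coefficients of
  R(s) C^s at 0; the first one vanishes by the choice of C.\<close>

definition r2 :: complex where "r2 = of_real (pi ^ 2 / 6 * of_int c2H / of_int H3)"
definition r3 :: complex where "r3 = of_real (of_int c3 * zeta3 / of_int H3)"

lemma E_has_fps_expansion: "(\<lambda>s. R s * exp (lnC * s)) has_fps_expansion E_fps"
proof -
  have "E 0 has_fps_expansion E_fps" unfolding E_fps_def
  proof (rule has_fps_expansion_fps_expansion)
    show "open {s. - (1 / 12) < Re s}" by (rule open_halfspace_Re_gt)
    show "E 0 holomorphic_on {s. - (1 / 12) < Re s}"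
      using E_deriv[of 0] open_halfspace_Re_gt by (auto simp: holomorphic_on_open)
  qed simp
  then show ?thesis by (simp add: E_def[abs_def])
qed

lemma E_fps_coeffs: "fps_nth E_fps 0 = 1" "fps_nth E_fps 1 = 0" "fps_nth E_fps 2 = r2" "fps_nth E_fps 3 = r3"
proof -
  have g0: "polygamma_sum 0 0 + lnC = 0"
    using cy_row_Digamma[OF row] by (simp add: polygamma_sum_0)
  have nth: "fps_nth E_fps n = E n 0 / fact n" if "n \<le> 3" for n
  proof -
    have "(deriv ^^ n) (E 0) 0 = E n 0"
      by (rule higher_deriv_chain[where S = "{s. - (1 / 12) < Re s}" and N = 3])
        (use E_deriv open_halfspace_Re_gt that in auto)
    then show ?thesis by (simp add: E_fps_def fps_expansion_def)
  qed
  have "quad_sum (Polygamma 1) A B = pi ^ 2 / 3 * of_int c2H / of_int H3"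
    using cy_row_Polygamma_1[OF row] H3 by (simp add: field_simps)
  then have q1: "r2 = of_real (quad_sum (Polygamma 1) A B / 2)" by (simp only: r2_def) simp
  have "quad_sum (Polygamma 2) A B = 6 * of_int c3 * zeta3 / of_int H3"
    using cy_row_Polygamma_2[OF row] H3 by (simp add: field_simps)
  then have q2: "r3 = of_real (quad_sum (Polygamma 2) A B / 6)" by (simp only: r3_def) simp
  show "fps_nth E_fps 0 = 1" "fps_nth E_fps 1 = 0"
    using nth[of 0] nth[of 1] g0 by (simp_all add: E_def Let_def R_0)
  have "E 2 0 = of_real (quad_sum (Polygamma 1) A B)" "E 3 0 = of_real (quad_sum (Polygamma 2) A B)"
    using g0 polygamma_sum_0 by (simp_all add: E_def Let_def R_0)
  then show "fps_nth E_fps 2 = r2" "fps_nth E_fps 3 = r3"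
    using nth[of 2] nth[of 3] by (simp_all add: q1 q2 fact_numeral)
qed

definition P :: "int \<Rightarrow> nat \<Rightarrow> complex fps" where
  "P k m = fps_X ^ (4 - m) * fps_exp (\<i> * of_real (of_int k * pi)) * inverse sinc_fps ^ m * E_fps"

lemma kern_reg_has_fps_expansion:
  "(\<lambda>s. kern_reg k m s * (R s * exp (lnC * s))) has_fps_expansion P k m"
proof -
  have "(\<lambda>s. s ^ (4 - m) * exp (\<i> * of_real (of_int k * pi) * s) * inverse (sinc_pi s) ^ m * (R s * exp (lnC * s)))
      has_fps_expansion P k m"
    unfolding P_def
    by (intro fps_expansion_intros sinc_pi_has_fps_expansion E_has_fps_expansion) (simp add: sinc_fps_coeffs)
  then show ?thesis by (simp add: kern_reg_def divide_inverse power_inverse)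
qed

text \<open>The expansion pi s / sin(pi s) = 1 + pi^2 s^2 / 6 + ... is combined with that of R(s)
  C^s. In the third kernel the quadratic term -pi^2/2 of the exponential cancels 3 pi^2/6 from the
  sines, leaving \<open>r2\<close> alone; in the fourth, 4 pi^2/6 survives as 2 pi^2/3.\<close>

lemma upper_chain_values:
  assumes z: "z \<in> half_disc"
  shows "upper_chain (- 1) 1 0 z = - 2 * y0 z"
    and "upper_chain 0 2 0 z = - 2 / of_real pi * y1 z"
    and "upper_chain 1 3 0 z = - 2 / of_real pi ^ 2 * (y2 z + \<i> * of_real pi * y1 z + r2 * y0 z)"
    and "upper_chain 0 4 0 z = - 2 / of_real pi ^ 3 * (y3 z + (2 * of_real pi ^ 2 / 3 + r2) * y1 z + r3 * y0 z)"
proof -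
  note c = fps_mult_nth_small inverse_sinc_coeffs E_fps_coeffs
  have X: "fps_nth (fps_X ^ n) j = (if j = n then 1 else (0::complex))" for n j by simp
  have ex: "fps_nth (fps_exp a) 0 = 1" "fps_nth (fps_exp a) 1 = a" "fps_nth (fps_exp a) 2 = a ^ 2 / 2"
    "fps_nth (fps_exp a) 3 = a ^ 3 / 6" for a :: complex by (simp_all add: fps_exp_def eval_nat_numeral)
  have pw: "inverse sinc_fps ^ 1 = inverse sinc_fps" "inverse sinc_fps ^ 2 = inverse sinc_fps * inverse sinc_fps"
    "inverse sinc_fps ^ 3 = inverse sinc_fps * inverse sinc_fps * inverse sinc_fps"
    "inverse sinc_fps ^ 4 = inverse sinc_fps * inverse sinc_fps * (inverse sinc_fps * inverse sinc_fps)"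
    by (simp_all add: eval_nat_numeral mult.assoc)
  have val: "upper_chain k m 0 z = - 2 * of_real pi * (fps_nth (P k m) 3 * y0 z + fps_nth (P k m) 2 * y1 z
      + fps_nth (P k m) 1 * y2 z + fps_nth (P k m) 0 * y3 z)"
    if "- int m \<le> k" "k \<le> int m - 2" "even (k + int m)" "m \<le> 4" for k m
    unfolding upper_chain_eq[OF that kern_reg_has_fps_expansion z] sum4 y_simps
    by (simp add: algebra_simps)
  have P11: "fps_nth (P (- 1) 1) 0 = 0" "fps_nth (P (- 1) 1) 1 = 0" "fps_nth (P (- 1) 1) 2 = 0"
    "fps_nth (P (- 1) 1) 3 = 1 / of_real pi"
    unfolding P_def pw c X ex by simp_all
  have P02: "fps_nth (P 0 2) 0 = 0" "fps_nth (P 0 2) 1 = 0" "fps_nth (P 0 2) 2 = 1 / of_real pi ^ 2"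
    "fps_nth (P 0 2) 3 = 0"
    unfolding P_def pw c X ex by (simp_all add: power2_eq_square)
  have P13: "fps_nth (P 1 3) 0 = 0" "fps_nth (P 1 3) 1 = 1 / of_real pi ^ 3" "fps_nth (P 1 3) 2 = \<i> / of_real pi ^ 2"
    "fps_nth (P 1 3) 3 = r2 / of_real pi ^ 3"
    unfolding P_def pw c X ex by (simp_all add: eval_nat_numeral field_simps)
  have P04: "fps_nth (P 0 4) 0 = 1 / of_real pi ^ 4" "fps_nth (P 0 4) 1 = 0"
    "fps_nth (P 0 4) 2 = 2 / (3 * of_real pi ^ 2) + r2 / of_real pi ^ 4" "fps_nth (P 0 4) 3 = r3 / of_real pi ^ 4"
    unfolding P_def pw c X ex by (simp_all add: eval_nat_numeral field_simps)
  show "upper_chain (- 1) 1 0 z = - 2 * y0 z"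
    by (subst val) (simp_all add: P11[unfolded One_nat_def])
  show "upper_chain 0 2 0 z = - 2 / of_real pi * y1 z"
    by (subst val) (simp_all add: P02[unfolded One_nat_def] power2_eq_square)
  show "upper_chain 1 3 0 z = - 2 / of_real pi ^ 2 * (y2 z + \<i> * of_real pi * y1 z + r2 * y0 z)"
    by (subst val) (simp_all add: P13[unfolded One_nat_def] power2_eq_square power3_eq_cube field_simps)
  show "upper_chain 0 4 0 z = - 2 / of_real pi ^ 3 * (y3 z + (2 * of_real pi ^ 2 / 3 + r2) * y1 z + r3 * y0 z)"
    by (subst val) (simp_all add: P04[unfolded One_nat_def] power2_eq_square power3_eq_cube power4_eq_xxxx field_simps)
qed

end

section \<open>Crossing the cut beyond the conifold point\<close>

lemma tendsto_mult_Ln_0: "((\<lambda>w::complex. w * Ln w) \<longlongrightarrow> 0) (at 0)"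
proof (rule Lim_null_comparison)
  have "norm (w * Ln w) \<le> 2 * sqrt (norm w) + pi * norm w" if w: "w \<noteq> 0" "norm w < 1" for w :: complex
  proof -
    define r where "r = norm w"
    have r: "0 < r" "r < 1" using w by (auto simp: r_def)
    have "norm (Ln w) \<le> \<bar>Re (Ln w)\<bar> + \<bar>Im (Ln w)\<bar>" by (rule cmod_le)
    also have "\<bar>Re (Ln w)\<bar> = - ln r" using r w by (simp add: r_def)
    also have "\<bar>Im (Ln w)\<bar> \<le> pi" using mpi_less_Im_Ln[OF w(1)] Im_Ln_le_pi[OF w(1)] by (simp add: abs_le_iff)
    also have "- ln r \<le> 2 / sqrt r"
    proof -
      have "ln (1 / sqrt r) \<le> 1 / sqrt r" using ln_bound[of "1 / sqrt r"] r by simp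
      then show ?thesis using r by (simp add: ln_div ln_sqrt)
    qed
    finally have "norm (Ln w) \<le> 2 / sqrt r + pi" by simp
    then have "norm (w * Ln w) \<le> r * (2 / sqrt r + pi)"
      unfolding norm_mult r_def[symmetric] using r by (intro mult_left_mono) auto
    also have "\<dots> = 2 * (r / sqrt r) + pi * r" by (simp add: algebra_simps)
    also have "r / sqrt r = sqrt r" using r by (simp add: real_div_sqrt)
    finally show ?thesis by (simp add: r_def)
  qed
  then show "\<forall>\<^sub>F w in at 0. norm (w * Ln w) \<le> 2 * sqrt (norm (w::complex)) + pi * norm w"
    unfolding eventually_at by (intro exI[of _ 1]) auto
  have "((\<lambda>w::complex. 2 * sqrt (norm w) + pi * norm w) \<longlongrightarrow> 2 * sqrt (norm (0::complex)) + pi * norm (0::complex)) (at 0)"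
    by (intro tendsto_intros)
  then show "((\<lambda>w::complex. 2 * sqrt (norm w) + pi * norm w) \<longlongrightarrow> 0) (at 0)" by simp
qed

text \<open>The closed right half plane meets the cut only at 0, where w log w tends to 0, which is
  also the value of \<open>w * Ln w\<close> there.\<close>

lemma continuous_on_mult_Ln: "continuous_on {w. Re w \<ge> 0} (\<lambda>w. w * Ln w)"
  unfolding continuous_on_eq_continuous_within
proof
  fix w :: complex assume w: "w \<in> {w. Re w \<ge> 0}"
  show "continuous (at w within {w. Re w \<ge> 0}) (\<lambda>w. w * Ln w)"
  proof (cases "w = 0")
    case True
    have "isCont (\<lambda>w::complex. w * Ln w) 0" using tendsto_mult_Ln_0 by (simp add: isCont_def)
    then show ?thesis using True by (auto intro: continuous_at_imp_continuous_within)
  next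
    case False
    then have "w \<notin> \<real>\<^sub>\<le>\<^sub>0" using w by (auto simp: complex_nonpos_Reals_iff complex_eq_iff)
    then have "isCont (\<lambda>w. w * Ln w) w" by (intro continuous_intros) auto
    then show ?thesis by (rule continuous_at_imp_continuous_within)
  qed
qed

lemma Ln_times_i: "Re w > 0 \<Longrightarrow> Ln (\<i> * w) = Ln w + \<i> * of_real (pi / 2)"
  "Re w > 0 \<Longrightarrow> Ln (- \<i> * w) = Ln w - \<i> * of_real (pi / 2)"
proof -
  assume w: "Re w > 0"
  then have w0: "w \<noteq> 0" by auto
  have "\<bar>Im (Ln w)\<bar> < pi / 2" using Re_Ln_pos_lt[OF w0] w by auto
  then have b: "- pi < Im (Ln w + \<i> * of_real (pi / 2))" "Im (Ln w + \<i> * of_real (pi / 2)) \<le> pi"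
    "- pi < Im (Ln w - \<i> * of_real (pi / 2))" "Im (Ln w - \<i> * of_real (pi / 2)) \<le> pi" by auto
  have e: "exp (\<i> * complex_of_real (pi / 2)) = \<i>"
    unfolding exp_Euler cos_of_real sin_of_real by simp
  have "exp (Ln w + \<i> * of_real (pi / 2)) = \<i> * w" "exp (Ln w - \<i> * of_real (pi / 2)) = - \<i> * w"
    unfolding exp_add exp_diff e using w0 by (simp_all add: field_simps)
  then show "Ln (\<i> * w) = Ln w + \<i> * of_real (pi / 2)" "Ln (- \<i> * w) = Ln w - \<i> * of_real (pi / 2)"
    using Ln_exp[OF b(1,2)] Ln_exp[OF b(3,4)] by simp_all
qed

context mellin_barnes
begin

abbreviation slit_plane :: "complex set" where "slit_plane \<equiv> - \<real>\<^sub>\<le>\<^sub>0"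

lemma Im_Ln_slit: "z \<in> slit_plane \<Longrightarrow> \<bar>Im (Ln (of_int C * z))\<bar> < pi"
  and C_slit: "z \<in> slit_plane \<Longrightarrow> of_int C * z \<notin> \<real>\<^sub>\<le>\<^sub>0"
proof -
  assume z: "z \<in> slit_plane"
  show n: "of_int C * z \<notin> \<real>\<^sub>\<le>\<^sub>0" using z C by (auto simp: complex_nonpos_Reals_iff zero_less_mult_iff mult_le_0_iff)
  have "z \<noteq> 0" using z by auto
  then have n0: "of_int C * z \<noteq> 0" using C by simp
  have "Im (Ln (of_int C * z)) \<noteq> pi" using n n0 Im_Ln_eq_pi[OF n0] by (auto simp: complex_nonpos_Reals_iff)
  then show "\<bar>Im (Ln (of_int C * z))\<bar> < pi"
    using mpi_less_Im_Ln[OF n0] Im_Ln_le_pi[OF n0] by (auto simp: abs_less_iff)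
qed

definition V :: "int \<Rightarrow> nat \<Rightarrow> complex \<Rightarrow> complex" where
  "V k m z = mb k m (Ln (of_int C * z))"

lemma V_upper_chain: "V k m = upper_chain k m 0"
  by (simp add: fun_eq_iff V_def mb_def upper_chain_def)

lemma V_holomorphic:
  assumes S: "open S" "S \<subseteq> slit_plane"
    and v: "\<And>z. z \<in> S \<Longrightarrow> - ((of_int k + real m) * pi) < Im (Ln (of_int C * z))"
      "\<And>z. z \<in> S \<Longrightarrow> Im (Ln (of_int C * z)) < (real m - of_int k) * pi"
  shows "V k m holomorphic_on S"
proof -
  have "\<exists>d. (V k m has_field_derivative d) (at z)" if z: "z \<in> S" for z
  proof -
    have "(mb k m has_field_derivative mellin c0 (\<lambda>s. s * (R s * kern k m s)) (Ln (of_int C * z))) (at (Ln (of_int C * z)))"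
      unfolding mb_def
      by (rule mellin_has_field_derivative[OF continuous_R_kern exp_decay_R_kern]) (use v[OF z] in auto)
    moreover have "((\<lambda>z. Ln (of_int C * z)) has_field_derivative inverse (of_int C * z) * of_int C) (at z)"
      using C_slit z S by (auto intro!: derivative_eq_intros simp: divide_inverse)
    ultimately show ?thesis unfolding V_def[abs_def] by (intro exI) (rule DERIV_chain2)
  qed
  then show ?thesis using S(1) by (simp add: holomorphic_on_open)
qed

text \<open>The hypothesis makes the strip contain |arg x| < pi. It holds for the kernels (0, 2),
  (1, 3) and (0, 4), whose integrals therefore pass the conifold point without a
  singularity.\<close>

lemma V_holomorphic_slit_plane:
  assumes "\<bar>k\<bar> + 1 \<le> int m"
  shows "V k m holomorphic_on slit_plane"
proof (rule V_holomorphic)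
  show "open slit_plane" by (simp add: open_Compl)
  have "1 \<le> of_int k + real m" "1 \<le> real m - of_int k" using assms by linarith+
  then have m: "1 * pi \<le> (of_int k + real m) * pi" "1 * pi \<le> (real m - of_int k) * pi"
    by (intro mult_right_mono; simp)+
  fix z assume "z \<in> slit_plane"
  then have "\<bar>Im (Ln (of_int C * z))\<bar> < pi" by (rule Im_Ln_slit)
  then show "- ((of_int k + real m) * pi) < Im (Ln (of_int C * z))" "Im (Ln (of_int C * z)) < (real m - of_int k) * pi"
    using m by linarith+
qed simp

text \<open>On the closed strip the exponential rate may be zero, but the tail of the twisted kernel
  stays bounded and R supplies an integrable majorant. The restriction to |Im u| at most pi makes
  the bound uniform on the middle segment.\<close>

lemma mb_continuous:
  "continuous_on {u. - ((of_int k + real m) * pi) \<le> Im u \<and> Im u \<le> (real m - of_int k) * pi \<and> \<bar>Im u\<bar> \<le> pi} (mb k m)"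
proof -
  let ?U = "{u. - ((of_int k + real m) * pi) \<le> Im u \<and> Im u \<le> (real m - of_int k) * pi \<and> \<bar>Im u\<bar> \<le> pi}"
  obtain K where K: "\<And>s. Re s \<ge> c0 \<Longrightarrow> \<bar>Im s\<bar> \<ge> 1 \<Longrightarrow> norm (R s) \<le> K / (1 + Im s ^ 2)"
    using norm_R_le by blast
  let ?f = "\<lambda>t. R (Complex c0 t) * kern k m (Complex c0 t)"
  have "compact (?f ` {-1..1})"
    by (intro compact_continuous_image continuous_on_subset[OF continuous_R_kern]) auto
  then obtain B where B: "\<And>t. t \<in> {-1..1} \<Longrightarrow> norm (?f t) \<le> B"
    using compact_imp_bounded bounded_iff by (metis (no_types, lifting) imageI)
  have B0: "B \<ge> 0" using order_trans[OF norm_ge_zero B[of 0]] by simp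
  show ?thesis unfolding mb_def
  proof (rule continuous_on_mellin[OF continuous_R_kern])
    fix u t assume u: "u \<in> ?U"
    show "norm (?f t) * exp (- t * Im u) \<le> (\<bar>K\<bar> * 4 ^ m + 2 * B * exp pi) / (1 + t ^ 2)"
    proof (cases "\<bar>t\<bar> \<ge> 1")
      case True
      have "norm (kern k m (Complex c0 t)) * exp (- t * Im u) \<le> 4 ^ m * exp (- min (Im u + (of_int k + real m) * pi) ((real m - of_int k) * pi - Im u) * \<bar>t\<bar>)"
        using norm_kern_decay[of "Complex c0 t" k m "Im u"] True by simp
      also have "\<dots> \<le> 4 ^ m * 1"
        using u by (intro mult_left_mono) (auto intro!: mult_nonneg_nonneg)
      finally have "norm (kern k m (Complex c0 t)) * exp (- t * Im u) \<le> 4 ^ m" by simp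
      moreover have "norm (R (Complex c0 t)) \<le> \<bar>K\<bar> / (1 + t ^ 2)"
        using K[of "Complex c0 t"] True by (intro order_trans[OF K]) (auto simp: divide_right_mono)
      ultimately have "norm (R (Complex c0 t)) * (norm (kern k m (Complex c0 t)) * exp (- t * Im u)) \<le> \<bar>K\<bar> / (1 + t ^ 2) * 4 ^ m"
        by (intro mult_mono) auto
      also have "\<dots> \<le> (\<bar>K\<bar> * 4 ^ m + 2 * B * exp pi) / (1 + t ^ 2)"
        using B0 by (simp add: divide_right_mono)
      finally show ?thesis by (simp add: norm_mult mult.assoc)
    next
      case False
      have "- t * Im u \<le> \<bar>t\<bar> * \<bar>Im u\<bar>" by (metis abs_ge_self abs_minus_cancel abs_mult mult_minus_left)
      also have "\<dots> \<le> 1 * pi" using False u by (intro mult_mono) auto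
      finally have "exp (- t * Im u) \<le> exp pi" by simp
      then have "norm (?f t) * exp (- t * Im u) \<le> B * exp pi"
        using B[of t] False B0 by (intro mult_mono) (auto simp: abs_if split: if_splits)
      also have "\<dots> \<le> (\<bar>K\<bar> * 4 ^ m + 2 * B * exp pi) / (1 + t ^ 2)"
      proof -
        have "t ^ 2 \<le> 1" using False by (simp add: abs_square_le_1)
        then have "B * exp pi * (1 + t ^ 2) \<le> B * exp pi * 2" using B0 by (intro mult_left_mono) auto
        also have "\<dots> \<le> \<bar>K\<bar> * 4 ^ m + 2 * B * exp pi" by simp
        finally show ?thesis by (simp add: field_simps add_pos_nonneg)
      qed
      finally show ?thesis .
    qed
  qed auto
qed

text \<open>The integral with constant kernel. It is used only for real u = log x, where it measures
  the jump between the two continuations of \<open>y0\<close>.\<close>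

definition J :: "complex \<Rightarrow> complex" where
  "J = mellin c0 R"

lemma continuous_R_line: "c0 \<le> c \<Longrightarrow> continuous_on UNIV (\<lambda>t. R (Complex c t))"
  by (rule continuous_on_Complex_line[OF holomorphic_on_imp_continuous_on[OF holomorphic_R]]) auto

lemma R_quadratic: "\<exists>K. \<forall>t. norm (R (Complex c0 t)) \<le> K / (1 + t ^ 2)"
proof -
  obtain K where K: "\<And>s. Re s \<ge> c0 \<Longrightarrow> \<bar>Im s\<bar> \<ge> 1 \<Longrightarrow> norm (R s) \<le> K / (1 + Im s ^ 2)"
    using norm_R_le by blast
  show ?thesis
    by (rule norm_le_quadratic_decay_extend[OF continuous_R_line, of _ K]) (use K[of "Complex c0 _"] in auto)
qed

lemma J_continuous: "continuous_on {u. Im u = 0} J"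
proof -
  obtain K where "\<And>t. norm (R (Complex c0 t)) \<le> K / (1 + t ^ 2)" using R_quadratic by blast
  then show ?thesis unfolding J_def by (intro continuous_on_mellin continuous_R_line) auto
qed

lemma line_int_exp_le:
  assumes u: "Im u = 0" and f: "\<And>t. norm (f (Complex c t)) \<le> K / (1 + t ^ 2)"
    and K: "K \<ge> 0"
  shows "norm (line_int c (\<lambda>s. f s * exp (s * u))) \<le> exp (c * Re u) * (K * (LINT t|lborel. 1 / (1 + (t::real) ^ 2)))"
proof -
  have "norm (line_int c (\<lambda>s. f s * exp (s * u))) \<le> (LINT t|lborel. exp (c * Re u) * (K * (1 / (1 + t ^ 2))))"
    unfolding line_int_def
  proof (rule order_trans[OF integral_norm_bound], rule integral_mono')
    show "integrable lborel (\<lambda>t::real. exp (c * Re u) * (K * (1 / (1 + t ^ 2))))"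
      by (intro integrable_mult_right integrable_inverse_one_plus_square)
    fix t
    show "norm (f (Complex c t) * exp (Complex c t * u)) \<le> exp (c * Re u) * (K * (1 / (1 + t ^ 2)))"
      unfolding norm_exp_mult u using mult_right_mono[OF f[of t], of "exp (c * Re u)"] by (simp add: mult_ac)
  qed (use K in auto)
  then show ?thesis by (simp only: integral_mult_right_zero)
qed

text \<open>R has no poles on the right, so the line moves to Re s = n + 1 without residues, and for
  x < 1 the factor x^(n + 1) tends to 0.\<close>

lemma J_eq_0:
  assumes u: "Im u = 0" "Re u < 0"
  shows "J u = 0"
proof -
  obtain K where K: "\<And>s. Re s \<ge> c0 \<Longrightarrow> \<bar>Im s\<bar> \<ge> 1 \<Longrightarrow> norm (R s) \<le> K / (1 + Im s ^ 2)"
    using norm_R_le by blast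
  obtain K2 where K2: "\<And>s. Re s \<ge> c0 \<Longrightarrow> norm (s ^ 2 * R s) \<le> K2" using R_bound by blast
  have K20: "K2 \<ge> 0" using order_trans[OF norm_ge_zero K2[of 0]] by simp
  define I where "I = (LINT t|lborel. 1 / (1 + (t::real) ^ 2))"
  have le: "norm (J u) \<le> exp (real (Suc n) * Re u) * (K2 * I)" for n
  proof -
    have "J u = line_int (real (Suc n)) (\<lambda>s. R s * exp (s * u))"
      unfolding J_def mellin_def
    proof (rule line_int_shift_holomorphic[where c' = "- (1/12)" and d' = "real (Suc n) + 1" and K = "exp ((real (Suc n) + 1) * \<bar>Re u\<bar>) * \<bar>K\<bar>"])
      have "R holomorphic_on {s. - (1 / 12) < Re s \<and> Re s < real (Suc n) + 1}"
        by (rule holomorphic_on_subset[OF holomorphic_R]) auto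
      then show "(\<lambda>s. R s * exp (s * u)) holomorphic_on {s. - (1 / 12) < Re s \<and> Re s < real (Suc n) + 1}"
        by (intro holomorphic_intros)
      fix s assume s: "c0 \<le> Re s" "Re s \<le> real (Suc n)" "\<bar>Im s\<bar> \<ge> 1"
      have "norm (R s) \<le> \<bar>K\<bar> / (1 + Im s ^ 2)"
        using s by (intro order_trans[OF K]) (auto simp: divide_right_mono)
      moreover have "Re s * Re u \<le> (real (Suc n) + 1) * \<bar>Re u\<bar>"
        by (rule order_trans[OF abs_ge_self]) (use s in \<open>auto simp: abs_mult intro!: mult_right_mono\<close>)
      ultimately have "norm (R s) * exp (Re s * Re u) \<le> \<bar>K\<bar> / (1 + Im s ^ 2) * exp ((real (Suc n) + 1) * \<bar>Re u\<bar>)"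
        by (intro mult_mono) auto
      then show "norm (R s * exp (s * u)) \<le> exp ((real (Suc n) + 1) * \<bar>Re u\<bar>) * \<bar>K\<bar> / (1 + Im s ^ 2)"
        using norm_exp_mult[of "R s" "Re s" "Im s" u] u by (simp add: mult.commute)
    qed auto
    also have "norm \<dots> \<le> exp (real (Suc n) * Re u) * (K2 * (LINT t|lborel. 1 / (1 + (t::real) ^ 2)))"
    proof (rule line_int_exp_le[OF u(1) _ K20])
      fix t
      let ?s = "Complex (real (Suc n)) t"
      have "1 + t ^ 2 \<le> norm ?s ^ 2" by (simp add: cmod_power2)
      then have "(1 + t ^ 2) * norm (R ?s) \<le> norm ?s ^ 2 * norm (R ?s)" by (intro mult_right_mono) auto
      also have "\<dots> \<le> K2" using K2[of ?s] by (simp add: norm_mult norm_power)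
      finally show "norm (R ?s) \<le> K2 / (1 + t ^ 2)" by (simp add: field_simps add_pos_nonneg)
    qed
    finally show ?thesis by (simp add: I_def)
  qed
  have "(\<lambda>n. exp (Re u) ^ Suc n * (K2 * I)) \<longlonglongrightarrow> 0 * (K2 * I)"
    using u by (intro tendsto_intros LIMSEQ_Suc LIMSEQ_power_zero) auto
  then have "norm (J u) \<le> 0"
    using le by (intro tendsto_lowerbound[of "\<lambda>n. exp (Re u) ^ Suc n * (K2 * I)" 0])
      (auto simp del: power_Suc of_nat_Suc simp flip: exp_of_nat_mult)
  then show ?thesis by simp
qed

end

section \<open>Closing the contour to the left: the jump as a solution\<close>

context mellin_barnes
begin

definition R_left :: "complex \<Rightarrow> complex" where
  "R_left s = hyp_pair_left A s * hyp_pair_left B s"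

definition al :: complex where "al = of_real (sin (pi * A) ^ 2)"
definition be :: complex where "be = of_real (sin (pi * B) ^ 2)"

lemma R_left_bound: "\<exists>K. \<forall>s. Re s \<le> c0 \<longrightarrow> norm (s ^ 2 * R_left s) \<le> K"
proof -
  obtain K1 where K1: "\<forall>s. Re s \<le> - (1/24) \<longrightarrow> norm (s * hyp_pair_left A s) \<le> K1"
    using hyp_pair_left_bound[of A "1/24"] AB by auto
  obtain K2 where K2: "\<forall>s. Re s \<le> - (1/24) \<longrightarrow> norm (s * hyp_pair_left B s) \<le> K2"
    using hyp_pair_left_bound[of B "1/24"] AB by auto
  have "norm (s ^ 2 * R_left s) \<le> K1 * K2" if "Re s \<le> c0" for s
  proof -
    have "norm (s ^ 2 * R_left s) = norm (s * hyp_pair_left A s) * norm (s * hyp_pair_left B s)"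
      by (simp add: R_left_def norm_mult power2_eq_square)
    also have "\<dots> \<le> K1 * K2"
      using K1 K2 that by (intro mult_mono) (auto intro: order_trans[OF norm_ge_zero])
    finally show ?thesis .
  qed
  then show ?thesis by blast
qed

text \<open>R is multiplied by the factors 1 - sin^2(pi a)/sin^2(pi s), a = A and a = B. Expanding
  them leaves one constant kernel and two kernels that converge for all |arg x| < pi.\<close>

lemma R_left_eq:
  assumes "Re s = c0"
  shows "R_left s = R s + al * be * (R s * kern 0 4 s) - (al + be) * (R s * kern 0 2 s)"
proof -
  define S where "S = sin (complex_of_real pi * s)"
  have S: "S \<noteq> 0" using sin_pi_eq_0_strip[of s] assms by (auto simp: S_def)
  have e: "hyp_pair_left A s * S ^ 2 = hyp_pair A s * (S ^ 2 - al)"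
    "hyp_pair_left B s * S ^ 2 = hyp_pair B s * (S ^ 2 - be)"
    unfolding al_def be_def S_def
    by (rule hyp_pair_left_eq; use S assms AB in \<open>simp add: S_def\<close>)+
  have "R_left s * S ^ 4 = (hyp_pair_left A s * S ^ 2) * (hyp_pair_left B s * S ^ 2)"
    by (simp add: R_left_def power4_eq_xxxx power2_eq_square)
  also have "\<dots> = (hyp_pair A s * (S ^ 2 - al)) * (hyp_pair B s * (S ^ 2 - be))" unfolding e ..
  also have "\<dots> = R s * ((S ^ 2 - al) * (S ^ 2 - be))" by (simp add: R_def)
  finally have "R_left s = R s * ((S ^ 2 - al) * (S ^ 2 - be)) / S ^ 4" using S by (simp add: field_simps)
  also have "(S ^ 2 - al) * (S ^ 2 - be) = S ^ 4 + al * be - (al + be) * S ^ 2"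
    by (simp add: algebra_simps power4_eq_xxxx power2_eq_square)
  also have "R s * (S ^ 4 + al * be - (al + be) * S ^ 2) / S ^ 4
      = R s + al * be * (R s * (1 / S ^ 4)) - (al + be) * (R s * (1 / S ^ 2))"
    using S by (simp add: field_simps power4_eq_xxxx power2_eq_square)
  finally show ?thesis by (simp add: kern_def S_def)
qed

text \<open>\<open>R_left\<close> has no poles for Re s < 0, so the line moves to Re s = -n - 1
  without residues, and for x > 1 the factor x^(-n - 1) tends to 0.\<close>

lemma left_eq_0:
  assumes u: "Im u = 0" "Re u > 0"
  shows "mellin c0 R_left u = 0"
proof -
  obtain K where K: "\<And>s. Re s \<le> c0 \<Longrightarrow> norm (s ^ 2 * R_left s) \<le> K" using R_left_bound by blast
  have K0: "K \<ge> 0" using order_trans[OF norm_ge_zero K[of "-1"]] by simp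
  have q: "norm (R_left s) \<le> 2 * K / (1 + Im s ^ 2)" if s: "Re s \<le> c0" "1 \<le> norm s" for s
  proof -
    have "Im s ^ 2 \<le> norm s ^ 2" using power_mono[OF abs_Im_le_cmod[of s], of 2] by simp
    moreover have "1 \<le> norm s ^ 2" using s by (simp add: one_le_power)
    ultimately have "1 + Im s ^ 2 \<le> 2 * norm s ^ 2" by simp
    then have "(1 + Im s ^ 2) * norm (R_left s) \<le> 2 * norm s ^ 2 * norm (R_left s)" by (intro mult_right_mono) auto
    also have "\<dots> \<le> 2 * K" using K[OF s(1)] by (simp add: norm_mult norm_power)
    finally show ?thesis by (simp add: field_simps add_pos_nonneg)
  qed
  define I where "I = (LINT t|lborel. 1 / (1 + (t::real) ^ 2))"
  have le: "norm (mellin c0 R_left u) \<le> exp (- real (Suc n) * Re u) * (2 * K * I)" for n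
  proof -
    have "line_int (- real (Suc n)) (\<lambda>s. R_left s * exp (s * u)) = mellin c0 R_left u"
      unfolding mellin_def
    proof (rule line_int_shift_holomorphic[where c' = "- real (Suc n) - 1" and d' = 0 and K = "exp ((real (Suc n) + 1) * \<bar>Re u\<bar>) * (2 * K)"])
      have "R_left holomorphic_on {s. Re s < 0}"
        unfolding R_left_def by (intro holomorphic_on_mult holomorphic_hyp_pair_left)
      then have "R_left holomorphic_on {s. - real (Suc n) - 1 < Re s \<and> Re s < 0}"
        by (rule holomorphic_on_subset) auto
      then show "(\<lambda>s. R_left s * exp (s * u)) holomorphic_on {s. - real (Suc n) - 1 < Re s \<and> Re s < 0}"
        by (intro holomorphic_intros)
      fix s assume s: "- real (Suc n) \<le> Re s" "Re s \<le> c0" "\<bar>Im s\<bar> \<ge> 1"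
      have "1 \<le> norm s" using s(3) abs_Im_le_cmod[of s] by linarith
      from q[OF s(2) this] have "norm (R_left s) \<le> 2 * K / (1 + Im s ^ 2)" .
      moreover have "Re s * Re u \<le> (real (Suc n) + 1) * \<bar>Re u\<bar>"
      proof -
        have "\<bar>Re s\<bar> \<le> real (Suc n) + 1" using s by (simp add: abs_le_iff)
        then have "\<bar>Re s\<bar> * \<bar>Re u\<bar> \<le> (real (Suc n) + 1) * \<bar>Re u\<bar>" by (rule mult_right_mono) simp
        then show ?thesis using abs_ge_self[of "Re s * Re u"] by (simp only: abs_mult)
      qed
      ultimately have "norm (R_left s) * exp (Re s * Re u) \<le> 2 * K / (1 + Im s ^ 2) * exp ((real (Suc n) + 1) * \<bar>Re u\<bar>)"
        using K0 by (intro mult_mono) auto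
      then show "norm (R_left s * exp (s * u)) \<le> exp ((real (Suc n) + 1) * \<bar>Re u\<bar>) * (2 * K) / (1 + Im s ^ 2)"
        using norm_exp_mult[of "R_left s" "Re s" "Im s" u] u by (simp add: mult_ac)
    qed auto
    then have "mellin c0 R_left u = line_int (- real (Suc n)) (\<lambda>s. R_left s * exp (s * u))" by simp
    also have "norm \<dots> \<le> exp (- real (Suc n) * Re u) * (2 * K * (LINT t|lborel. 1 / (1 + (t::real) ^ 2)))"
    proof (rule line_int_exp_le[OF u(1)])
      fix t
      have "1 \<le> norm (Complex (- real (Suc n)) t)" using abs_Re_le_cmod[of "Complex (- real (Suc n)) t"] by simp
      then show "norm (R_left (Complex (- real (Suc n)) t)) \<le> 2 * K / (1 + t ^ 2)"
        using q[of "Complex (- real (Suc n)) t"] by simp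
    qed (use K0 in simp)
    finally show ?thesis by (simp add: I_def)
  qed
  have "(\<lambda>n. exp (- Re u) ^ Suc n * (2 * K * I)) \<longlonglongrightarrow> 0 * (2 * K * I)"
    using u by (intro tendsto_intros LIMSEQ_Suc LIMSEQ_power_zero) auto
  then have "norm (mellin c0 R_left u) \<le> 0"
    using le by (intro tendsto_lowerbound[of "\<lambda>n. exp (- Re u) ^ Suc n * (2 * K * I)" 0])
      (auto simp del: power_Suc of_nat_Suc simp flip: exp_of_nat_mult)
  then show ?thesis by simp
qed

lemma mellin_integrable_boundary:
  assumes cont: "continuous_on UNIV (\<lambda>t. f (Complex c t))"
    and bound: "\<And>t. \<bar>t\<bar> \<ge> 1 \<Longrightarrow> norm (f (Complex c t)) * exp (- t * Im u) \<le> K / (1 + t ^ 2)"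
  shows "integrable lborel (\<lambda>t. f (Complex c t) * exp (Complex c t * u))"
proof -
  have b: "norm (f (Complex c t) * exp (Complex c t * u)) \<le> K * exp (c * Re u) / (1 + t ^ 2)" if "\<bar>t\<bar> \<ge> 1" for t
    unfolding norm_exp_mult using mult_right_mono[OF bound[OF that], of "exp (c * Re u)"] by (simp add: mult_ac)
  note c = continuous_mellin_integrand[OF cont, of u]
  show ?thesis
    using norm_le_quadratic_decay_extend[OF c b] integrable_quadratic_decay[OF c] by blast
qed

lemma integrable_boundary:
  assumes v: "- ((of_int k + real m) * pi) \<le> Im u" "Im u \<le> (real m - of_int k) * pi"
  shows "integrable lborel (\<lambda>t. R (Complex c0 t) * kern k m (Complex c0 t) * exp (Complex c0 t * u))"
proof -
  let ?\<mu> = "min (Im u + (of_int k + real m) * pi) ((real m - of_int k) * pi - Im u)"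
  obtain K where "K \<ge> 0" "\<forall>s. Re s \<ge> c0 \<and> \<bar>Im s\<bar> \<ge> 1 \<longrightarrow>
      norm (R s * kern k m s) * exp (- Im s * Im u) \<le> K * exp (- ?\<mu> * \<bar>Im s\<bar>) / (1 + Im s ^ 2)"
    using R_kern_decay by blast
  then have K: "K \<ge> 0" "\<And>t. \<bar>t\<bar> \<ge> 1 \<Longrightarrow>
      norm (R (Complex c0 t) * kern k m (Complex c0 t)) * exp (- t * Im u) \<le> K * exp (- ?\<mu> * \<bar>t\<bar>) / (1 + t ^ 2)"
    by (auto dest: spec[of _ "Complex c0 _"])
  show ?thesis
  proof (rule mellin_integrable_boundary[OF continuous_R_kern])
    fix t :: real assume t: "\<bar>t\<bar> \<ge> 1"
    note K(2)[OF t]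
    also have "K * exp (- ?\<mu> * \<bar>t\<bar>) / (1 + t ^ 2) \<le> K * 1 / (1 + t ^ 2)"
      using K(1) v by (intro divide_right_mono mult_left_mono) (auto intro!: mult_nonneg_nonneg)
    finally show "norm (R (Complex c0 t) * kern k m (Complex c0 t)) * exp (- t * Im u) \<le> K / (1 + t ^ 2)" by simp
  qed auto
qed

lemma J_integrable: "Im u = 0 \<Longrightarrow> integrable lborel (\<lambda>t. R (Complex c0 t) * exp (Complex c0 t * u))"
proof -
  assume u: "Im u = 0"
  obtain K where "\<And>t. norm (R (Complex c0 t)) \<le> K / (1 + t ^ 2)" using R_quadratic by blast
  then show ?thesis by (intro mellin_integrable_boundary continuous_R_line) (use u in auto)
qed

text \<open>Up to the factor \<open>-1/2\<close> the left-hand side is the difference of the boundary values of the two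
  continuations of \<open>y\<^sub>0\<close> on the positive axis.\<close>

lemma mb_jump:
  assumes u: "Im u = 0"
  shows "mb 1 1 u - mb (- 1) 1 u = 2 * \<i> * J u"
proof -
  have "mb 1 1 u - mb (- 1) 1 u = (LINT t|lborel. R (Complex c0 t) * kern 1 1 (Complex c0 t) * exp (Complex c0 t * u)
      - R (Complex c0 t) * kern (- 1) 1 (Complex c0 t) * exp (Complex c0 t * u))"
    unfolding mb_def mellin_def line_int_def
    by (rule Bochner_Integration.integral_diff[symmetric]) (rule integrable_boundary; use u in simp)+
  also have "\<dots> = (LINT t|lborel. 2 * \<i> * (R (Complex c0 t) * exp (Complex c0 t * u)))"
  proof (rule Bochner_Integration.integral_cong[OF refl])
    fix t
    define s where "s = Complex c0 t"
    have S: "sin (complex_of_real pi * s) \<noteq> 0" using sin_pi_eq_0_strip[of s] by (auto simp: s_def complex_eq_iff)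
    have "exp (\<i> * (of_real pi * s)) - exp (- (\<i> * (of_real pi * s))) = 2 * \<i> * sin (of_real pi * s)"
      unfolding sin_exp_eq by simp
    then have "kern 1 1 s - kern (- 1) 1 s = 2 * \<i>"
      using S by (simp add: kern_def mult.assoc flip: diff_divide_distrib)
    then have k: "kern 1 1 s = 2 * \<i> + kern (- 1) 1 s" by (simp only: diff_eq_eq)
    show "R s * kern 1 1 s * exp (s * u) - R s * kern (- 1) 1 s * exp (s * u) = 2 * \<i> * (R s * exp (s * u))"
      unfolding k by (simp add: algebra_simps)
  qed
  also have "\<dots> = 2 * \<i> * J u" by (simp only: J_def mellin_def line_int_def integral_mult_right_zero)
  finally show ?thesis .
qed

text \<open>The vanishing integral of \<open>R_left\<close>, split by kernels. It expresses the jump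
  for x > 1 through functions that are holomorphic across the positive axis.\<close>

lemma J_relation:
  assumes u: "Im u = 0" "Re u > 0"
  shows "J u + al * be * mb 0 4 u - (al + be) * mb 0 2 u = 0"
proof -
  have i: "integrable lborel (\<lambda>t. R (Complex c0 t) * exp (Complex c0 t * u))"
    "integrable lborel (\<lambda>t. R (Complex c0 t) * kern 0 4 (Complex c0 t) * exp (Complex c0 t * u))"
    "integrable lborel (\<lambda>t. R (Complex c0 t) * kern 0 2 (Complex c0 t) * exp (Complex c0 t * u))"
    using J_integrable[OF u(1)] by (auto intro!: integrable_boundary simp: u)
  have "0 = mellin c0 R_left u" using left_eq_0[OF u] by simp
  also have "\<dots> = (LINT t|lborel. R (Complex c0 t) * exp (Complex c0 t * u)
      + al * be * (R (Complex c0 t) * kern 0 4 (Complex c0 t) * exp (Complex c0 t * u))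
      - (al + be) * (R (Complex c0 t) * kern 0 2 (Complex c0 t) * exp (Complex c0 t * u)))"
    unfolding mellin_def line_int_def
    by (rule Bochner_Integration.integral_cong[OF refl], subst R_left_eq) (simp_all add: algebra_simps)
  also have "\<dots> = J u + al * be * mb 0 4 u - (al + be) * mb 0 2 u"
    unfolding J_def mb_def mellin_def line_int_def
    using i by (simp only: Bochner_Integration.integral_add Bochner_Integration.integral_diff
        Bochner_Integration.integrable_add integral_mult_right_zero integrable_mult_right)
  finally show ?thesis by simp
qed

text \<open>The factor i makes W = -i J for x at least 1/C, which is the lower boundary value of the
  continued \<open>y0\<close> minus the upper one.\<close>

definition W :: "complex \<Rightarrow> complex" where
  "W z = \<i> * (al * be * V 0 4 z - (al + be) * V 0 2 z)"

lemma W_holomorphic: "W holomorphic_on slit_plane"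
  unfolding W_def by (intro holomorphic_intros V_holomorphic_slit_plane) auto

lemma Ln_C_real: "x > 0 \<Longrightarrow> Ln (of_int C * complex_of_real x) = of_real (ln (of_int C * x))"
proof -
  assume x: "x > 0"
  have "of_int C * complex_of_real x = of_real (of_int C * x)" by simp
  then show ?thesis using C x by (simp only: Ln_of_real mult_pos_pos of_int_0_less_iff)
qed

text \<open>The contour relation requires x > 1/C strictly; continuity of both sides adds the end
  point, which is the point that matters for pasting.\<close>

lemma W_eq_J:
  assumes x: "x \<ge> 1 / of_int C"
  shows "W (of_real x) = - \<i> * J (Ln (of_int C * of_real x))"
proof -
  have x0: "x > 0" using x C by (auto intro: less_le_trans[of 0 "1 / of_int C"])
  let ?f = "\<lambda>x. W (complex_of_real x) + \<i> * J (Ln (of_int C * of_real x))"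
  have eq: "?f x = 0" if "x > 1 / of_int C" for x
  proof -
    have "0 < 1 / real_of_int C" using C by simp
    then have "x > 0" using that by linarith
    have "of_int C * x > 1" using that C by (simp add: field_simps)
    then have "Re (Ln (of_int C * complex_of_real x)) > 0" "Im (Ln (of_int C * complex_of_real x)) = 0"
      unfolding Ln_C_real[OF \<open>x > 0\<close>] using ln_gt_zero[of "of_int C * x"] by simp_all
    from J_relation[OF this(2,1)] have Jx: "J (Ln (of_int C * of_real x))
        = - (al * be * V 0 4 (of_real x) - (al + be) * V 0 2 (of_real x))"
      by (simp add: V_def eq_neg_iff_add_eq_0 algebra_simps)
    show ?thesis unfolding W_def Jx mult_minus_right by (rule right_minus)
  qed
  have "continuous_on {0<..} ?f"
  proof (intro continuous_intros)
    show "continuous_on {0<..} (\<lambda>x::real. W (complex_of_real x))"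
      by (rule continuous_on_compose2[OF holomorphic_on_imp_continuous_on[OF W_holomorphic]])
        (auto intro!: continuous_intros)
    show "continuous_on {0<..} (\<lambda>x::real. J (Ln (of_int C * complex_of_real x)))"
      by (rule continuous_on_compose2[OF J_continuous])
        (use C in \<open>auto intro!: continuous_intros simp: Ln_C_real complex_nonpos_Reals_iff mult_le_0_iff\<close>)
  qed
  then have "continuous (at (1 / of_int C)) ?f"
    using C by (auto simp: continuous_on_eq_continuous_at)
  then have "(?f \<longlongrightarrow> ?f (1 / of_int C)) (at_right (1 / of_int C))"
    unfolding isCont_def by (rule tendsto_within_subset) simp
  moreover have "(?f \<longlongrightarrow> 0) (at_right (1 / of_int C))"
    by (rule tendsto_eventually) (use eq in \<open>auto simp: eventually_at_right_less eventually_at_filter\<close>)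
  ultimately have "?f (1 / of_int C) = 0" using tendsto_unique trivial_limit_at_right_real by blast
  then have "?f x = 0" using eq[of x] x by (cases "x = 1 / of_int C") auto
  then show ?thesis by (simp add: eq_neg_iff_add_eq_0)
qed

lemma J_disc:
  assumes x: "0 < x" "x \<le> 1 / of_int C"
  shows "J (Ln (of_int C * of_real x)) = 0"
proof -
  let ?f = "\<lambda>x::real. J (Ln (of_int C * of_real x))"
  have eq: "?f x = 0" if "0 < x" "x < 1 / of_int C" for x
  proof -
    have "of_int C * x < 1" "of_int C * x > 0" using that C by (simp_all add: field_simps)
    then show ?thesis unfolding Ln_C_real[OF that(1)]
      by (intro J_eq_0) (simp_all add: ln_less_zero)
  qed
  have "continuous_on {0<..} ?f"
    by (rule continuous_on_compose2[OF J_continuous])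
      (use C in \<open>auto intro!: continuous_intros simp: Ln_C_real complex_nonpos_Reals_iff mult_le_0_iff\<close>)
  then have "continuous (at (1 / of_int C)) ?f"
    using C by (auto simp: continuous_on_eq_continuous_at)
  then have "(?f \<longlongrightarrow> ?f (1 / of_int C)) (at_left (1 / of_int C))"
    unfolding isCont_def by (rule tendsto_within_subset) simp
  moreover have "(?f \<longlongrightarrow> 0) (at_left (1 / of_int C))"
  proof (rule tendsto_eventually)
    have "\<forall>\<^sub>F x in at_left (1 / of_int C). x \<in> {0<..<1 / real_of_int C}"
      by (rule eventually_at_leftI[of 0]) (use C in auto)
    then show "\<forall>\<^sub>F x in at_left (1 / of_int C). ?f x = 0" by eventually_elim (use eq in auto)
  qed
  ultimately have "?f (1 / of_int C) = 0" using tendsto_unique trivial_limit_at_left_real by blast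
  then show ?thesis using eq[of x] x by (cases "x = 1 / of_int C") auto
qed

end

section \<open>Pasting the two continuations across the positive axis\<close>

context mellin_barnes
begin

text \<open>For Im z >= 0 the number i(1 - C z) has non-negative real part. Hence Ln(i(1 - C z)) - i
  pi/2 is the branch of log(1 - C z) that continues from the upper half disc to the real axis on
  both sides of 1/C. The factor -1/2 turns the integral into \<open>y0\<close>;
  \<open>h_minus\<close> is the mirror image.\<close>

definition h_plus :: "complex \<Rightarrow> complex" where
  "h_plus z = - (1 / 2) * V (- 1) 1 z
     - W z * (Ln (\<i> * (1 - of_int C * z)) - \<i> * of_real (pi / 2)) / (2 * of_real pi * \<i>)"

definition h_minus :: "complex \<Rightarrow> complex" where
  "h_minus z = - (1 / 2) * V 1 1 z
     - W z * (Ln (- \<i> * (1 - of_int C * z)) + \<i> * of_real (pi / 2)) / (2 * of_real pi * \<i>)"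

definition h :: "complex \<Rightarrow> complex" where
  "h z = (if Im z \<le> 0 then h_minus z else h_plus z)"

text \<open>J vanishes on (0, 1/C] while W = -i J on [1/C, infinity), and the two meet at
  1/C.\<close>

lemma W_conifold: "W (1 / of_int C) = 0"
  using W_eq_J[of "1 / of_int C"] J_disc[of "1 / of_int C"] C by simp

text \<open>With the zero at 1/C split off, W log(1 - C z) becomes a holomorphic function times w
  log w and is continuous at 1/C.\<close>

lemma W_factor:
  obtains q where "q holomorphic_on slit_plane" "\<And>z. W z = (z - 1 / of_int C) * q z"
proof
  let ?a = "1 / complex_of_int C"
  show "(\<lambda>z. if z = ?a then deriv W ?a else (W z - W ?a) / (z - ?a)) holomorphic_on slit_plane"
    by (rule pole_lemma_open[OF W_holomorphic]) (simp add: open_Compl)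
  show "W z = (z - ?a) * (if z = ?a then deriv W ?a else (W z - W ?a) / (z - ?a))" for z
    by (auto simp: W_conifold)
qed

lemma Im_Ln_half:
  assumes "z \<in> slit_plane"
  shows "0 \<le> Im z \<Longrightarrow> 0 \<le> Im (Ln (of_int C * z))" "Im z \<le> 0 \<Longrightarrow> Im (Ln (of_int C * z)) \<le> 0"
proof -
  have n0: "of_int C * z \<noteq> 0" using C_slit[OF assms] by auto
  show "0 \<le> Im z \<Longrightarrow> 0 \<le> Im (Ln (of_int C * z))"
    using Im_Ln_pos_le[OF n0] Im_Ln_slit[OF assms] C by (simp add: abs_less_iff)
  show "Im (Ln (of_int C * z)) \<le> 0" if "Im z \<le> 0"
  proof (cases "Im z = 0")
    case True
    then have "of_int C * z = of_real (of_int C * Re z)" by (simp add: complex_eq_iff)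
    moreover have "of_int C * Re z > 0" using assms True C by (auto simp: complex_nonpos_Reals_iff)
    ultimately have "Ln (of_int C * z) = of_real (ln (of_int C * Re z))" by (simp only: Ln_of_real)
    then show ?thesis by simp
  next
    case False
    then have "\<not> 0 \<le> Im (of_int C * z)" using that C by (simp add: mult_le_0_iff zero_le_mult_iff)
    then show ?thesis using Im_Ln_pos_le[OF n0] Im_Ln_slit[OF assms] by (auto simp: abs_less_iff)
  qed
qed

lemma continuous_h_plus: "continuous_on {z \<in> slit_plane. 0 \<le> Im z} h_plus"
proof -
  let ?S = "{z \<in> slit_plane. 0 \<le> Im z}"
  obtain q where q: "q holomorphic_on slit_plane" "\<And>z. W z = (z - 1 / of_int C) * q z"
    using W_factor by metis
  \<comment> \<open>The strip of this kernel ends at arg x = 0, so continuity up to the real axis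
    comes from the closed-strip estimate.\<close>
  have V: "continuous_on ?S (V (- 1) 1)"
    unfolding V_def[abs_def]
  proof (rule continuous_on_compose2[OF mb_continuous[of "- 1" 1]])
    show "continuous_on ?S (\<lambda>z. Ln (of_int C * z))" using C_slit by (auto intro!: continuous_intros)
    show "(\<lambda>z. Ln (of_int C * z)) ` ?S \<subseteq> {u. - ((of_int (- 1) + real 1) * pi) \<le> Im u \<and> Im u \<le> (real 1 - of_int (- 1)) * pi \<and> \<bar>Im u\<bar> \<le> pi}"
    proof (rule image_subsetI)
      fix z assume "z \<in> ?S"
      then have "0 \<le> Im (Ln (of_int C * z))" "\<bar>Im (Ln (of_int C * z))\<bar> < pi"
        using Im_Ln_half[of z] Im_Ln_slit[of z] by auto
      then show "Ln (of_int C * z) \<in> {u. - ((of_int (- 1) + real 1) * pi) \<le> Im u \<and> Im u \<le> (real 1 - of_int (- 1)) * pi \<and> \<bar>Im u\<bar> \<le> pi}"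
        by (auto simp: abs_less_iff abs_le_iff)
    qed
  qed
  define LL where "LL = (\<lambda>z. (\<i> * (1 - of_int C * z)) * Ln (\<i> * (1 - of_int C * z)))"
  have L: "continuous_on ?S LL"
    unfolding LL_def by (rule continuous_on_compose2[OF continuous_on_mult_Ln]) (use C in \<open>auto intro!: continuous_intros\<close>)
  have qc: "continuous_on ?S q" "continuous_on ?S W"
    by (rule continuous_on_subset[OF holomorphic_on_imp_continuous_on], rule q W_holomorphic, blast)+
  have eq: "W z * (Ln (\<i> * (1 - of_int C * z)) - \<i> * of_real (pi / 2))
      = q z * (\<i> / of_int C) * LL z - W z * (\<i> * of_real (pi / 2))" for z
  proof -
    have "z - 1 / of_int C = (\<i> / of_int C) * (\<i> * (1 - of_int C * z))" using C by (simp add: field_simps)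
    with q(2)[of z] have "W z * Ln (\<i> * (1 - of_int C * z))
        = q z * (\<i> / of_int C) * ((\<i> * (1 - of_int C * z)) * Ln (\<i> * (1 - of_int C * z)))"
      by (simp only: mult_ac)
    then show ?thesis by (simp only: right_diff_distrib LL_def)
  qed
  have "continuous_on ?S (\<lambda>z. - (1 / 2) * V (- 1) 1 z - (q z * (\<i> / of_int C) * LL z - W z * (\<i> * of_real (pi / 2))) / (2 * of_real pi * \<i>))"
    by (intro continuous_intros V L qc) simp
  then show ?thesis by (rule continuous_on_eq) (simp only: h_plus_def eq)
qed

lemma continuous_h_minus: "continuous_on {z \<in> slit_plane. Im z \<le> 0} h_minus"
proof -
  let ?S = "{z \<in> slit_plane. Im z \<le> 0}"
  obtain q where q: "q holomorphic_on slit_plane" "\<And>z. W z = (z - 1 / of_int C) * q z"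
    using W_factor by metis
  have V: "continuous_on ?S (V 1 1)"
    unfolding V_def[abs_def]
  proof (rule continuous_on_compose2[OF mb_continuous[of "1" 1]])
    show "continuous_on ?S (\<lambda>z. Ln (of_int C * z))" using C_slit by (auto intro!: continuous_intros)
    show "(\<lambda>z. Ln (of_int C * z)) ` ?S \<subseteq> {u. - ((of_int (1) + real 1) * pi) \<le> Im u \<and> Im u \<le> (real 1 - of_int (1)) * pi \<and> \<bar>Im u\<bar> \<le> pi}"
    proof (rule image_subsetI)
      fix z assume "z \<in> ?S"
      then have "Im (Ln (of_int C * z)) \<le> 0" "\<bar>Im (Ln (of_int C * z))\<bar> < pi"
        using Im_Ln_half[of z] Im_Ln_slit[of z] by auto
      then show "Ln (of_int C * z) \<in> {u. - ((of_int (1) + real 1) * pi) \<le> Im u \<and> Im u \<le> (real 1 - of_int (1)) * pi \<and> \<bar>Im u\<bar> \<le> pi}"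
        by (auto simp: abs_less_iff abs_le_iff)
    qed
  qed
  define LL where "LL = (\<lambda>z. (- \<i> * (1 - of_int C * z)) * Ln (- \<i> * (1 - of_int C * z)))"
  have L: "continuous_on ?S LL"
    unfolding LL_def by (rule continuous_on_compose2[OF continuous_on_mult_Ln]) (use C in \<open>auto intro!: continuous_intros simp: mult_nonneg_nonpos\<close>)
  have qc: "continuous_on ?S q" "continuous_on ?S W"
    by (rule continuous_on_subset[OF holomorphic_on_imp_continuous_on], rule q W_holomorphic, blast)+
  have eq: "W z * (Ln (- \<i> * (1 - of_int C * z)) + \<i> * of_real (pi / 2))
      = q z * (- \<i> / of_int C) * LL z + W z * (\<i> * of_real (pi / 2))" for z
  proof -
    have "z - 1 / of_int C = (- \<i> / of_int C) * (- \<i> * (1 - of_int C * z))" using C by (simp add: field_simps)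
    with q(2)[of z] have "W z * Ln (- \<i> * (1 - of_int C * z))
        = q z * (- \<i> / of_int C) * ((- \<i> * (1 - of_int C * z)) * Ln (- \<i> * (1 - of_int C * z)))"
      by (simp only: mult_ac)
    then show ?thesis by (simp only: distrib_left LL_def)
  qed
  have "continuous_on ?S (\<lambda>z. - (1 / 2) * V 1 1 z - (q z * (- \<i> / of_int C) * LL z + W z * (\<i> * of_real (pi / 2))) / (2 * of_real pi * \<i>))"
    by (intro continuous_intros V L qc) simp
  then show ?thesis by (rule continuous_on_eq) (simp only: h_minus_def eq)
qed

text \<open>For x < 1/C neither the integrals nor the logarithms jump, and at 1/C the zero of W
  removes the logarithms. For x > 1/C the logarithms differ by 2 pi i, and the resulting term W
  cancels the jump -i J of the integrals.\<close>

lemma h_boundary: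
  assumes "z \<in> slit_plane" "Im z = 0"
  shows "h_minus z = h_plus z"
proof -
  define x where "x = Re z"
  have z: "z = of_real x" using assms by (simp add: x_def complex_eq_iff)
  have x: "x > 0" using assms by (auto simp: x_def complex_nonpos_Reals_iff)
  define w where "w = 1 - of_int C * x"
  have w: "1 - of_int C * z = of_real w" by (simp add: w_def z)
  define j where "j = J (Ln (of_int C * z))"
  have "V 1 1 z - V (- 1) 1 z = 2 * \<i> * j"
    unfolding V_def j_def by (rule mb_jump) (simp add: z Ln_C_real x)
  then have V: "V 1 1 z = V (- 1) 1 z + 2 * \<i> * j" by (simp add: diff_eq_eq add.commute)
  consider "w > 0" | "w = 0" | "w < 0" by linarith
  then show ?thesis
  proof cases
    case 1
    then have "x \<le> 1 / of_int C" using C by (simp add: w_def field_simps)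
    then have "j = 0" using J_disc x by (simp add: j_def z)
    then show ?thesis unfolding h_minus_def h_plus_def w V
      using Ln_times_i[of "of_real w"] 1 by simp
  next
    case 2
    then have xC: "x = 1 / of_int C" using C by (simp add: w_def field_simps)
    then have "j = 0" using J_disc[of x] x by (simp only: j_def z order.refl)
    moreover have "W z = 0" using W_conifold by (simp add: z xC)
    ultimately show ?thesis unfolding h_minus_def h_plus_def V by simp
  next
    case 3
    then have "x \<ge> 1 / of_int C" using C by (simp add: w_def field_simps)
    then have W: "W z = - \<i> * j" using W_eq_J by (simp add: j_def z)
    define v where "v = complex_of_real (- w)"
    have v: "Re v > 0" using 3 by (simp add: v_def)
    have "Ln (\<i> * of_real w) = Ln (- \<i> * v)" "Ln (- \<i> * of_real w) = Ln (\<i> * v)" by (simp_all add: v_def)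
    then have L: "Ln (\<i> * of_real w) = Ln v - \<i> * of_real (pi / 2)" "Ln (- \<i> * of_real w) = Ln v + \<i> * of_real (pi / 2)"
      using Ln_times_i[OF v] by simp_all
    show ?thesis unfolding h_minus_def h_plus_def w V W L by (simp add: field_simps)
  qed
qed

text \<open>A function continuous across a line and holomorphic on both sides is holomorphic; in
  this form the conifold point needs no separate treatment.\<close>

theorem h_holomorphic: "h holomorphic_on slit_plane"
proof (rule holomorphic_on_paste_across_line[where d = \<i> and k = 0])
  show op: "open slit_plane" by (simp add: open_Compl)
  have L: "(\<lambda>z. Ln (\<i> * (1 - of_int C * z))) holomorphic_on {z. 0 < Im z}"
    "(\<lambda>z. Ln (- \<i> * (1 - of_int C * z))) holomorphic_on {z. Im z < 0}"
    using C by (auto intro!: holomorphic_intros simp: complex_nonpos_Reals_iff mult_less_0_iff mult_le_0_iff zero_le_mult_iff)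
  have sub: "{z. 0 < Im z} \<subseteq> slit_plane" "{z. Im z < 0} \<subseteq> slit_plane" by (auto simp: complex_nonpos_Reals_iff)
  have Vp: "V (- 1) 1 holomorphic_on {z. 0 < Im z}"
    by (rule V_holomorphic[OF open_halfspace_Im_gt sub(1)]) (use Im_Ln_upper in force)+
  have Vm: "V 1 1 holomorphic_on {z. Im z < 0}"
  proof (rule V_holomorphic[OF open_halfspace_Im_lt sub(2)])
    fix z :: complex assume z: "z \<in> {z. Im z < 0}"
    then have zs: "z \<in> slit_plane" using sub(2) by blast
    then have n0: "of_int C * z \<noteq> 0" using C_slit by fastforce
    have "\<not> 0 \<le> Im (of_int C * z)" using z C by (simp add: zero_le_mult_iff)
    then have "Im (Ln (of_int C * z)) < 0"
      using Im_Ln_pos_le[OF n0] Im_Ln_slit[OF zs] by (auto simp: abs_less_iff)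
    then show "Im (Ln (of_int C * z)) < (real 1 - of_int 1) * pi" by simp
    have "- pi < Im (Ln (of_int C * z))" by (rule mpi_less_Im_Ln[OF n0])
    then have "- (2 * pi) < Im (Ln (of_int C * z))" using pi_gt_zero by linarith
    then show "- ((of_int 1 + real 1) * pi) < Im (Ln (of_int C * z))" by simp
  qed
  have "h_plus holomorphic_on {z. 0 < Im z}" unfolding h_plus_def[abs_def]
    by (intro holomorphic_intros Vp L holomorphic_on_subset[OF W_holomorphic sub(1)]) simp
  then show "h holomorphic_on slit_plane \<inter> {z. 0 < \<i> \<bullet> z}"
    by (rule holomorphic_transform[OF holomorphic_on_subset]) (auto simp: h_def inner_complex_def)
  have "h_minus holomorphic_on {z. Im z < 0}" unfolding h_minus_def[abs_def]
    by (intro holomorphic_intros Vm L holomorphic_on_subset[OF W_holomorphic sub(2)]) simp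
  then show "h holomorphic_on slit_plane \<inter> {z. \<i> \<bullet> z < 0}"
    by (rule holomorphic_transform[OF holomorphic_on_subset]) (auto simp: h_def inner_complex_def)
  show "continuous_on slit_plane h"
    unfolding h_def[abs_def]
    by (rule continuous_on_cases_le) (use continuous_h_minus continuous_h_plus h_boundary in \<open>auto intro!: continuous_intros\<close>)
qed simp

lemma half_disc_identity:
  assumes "f holomorphic_on slit_disc" "g holomorphic_on slit_disc" "\<And>z. z \<in> half_disc \<Longrightarrow> f z = g z"
    and z: "z \<in> slit_disc"
  shows "f z = g z"
proof (rule analytic_continuation_open[OF half_disc(1) slit_disc(1) _ slit_disc(3) half_disc(3) assms])
  show "half_disc \<noteq> {}"
    using eventually_happens'[OF _ imag_ray_half_disc] by auto
qed

lemma slit_disc_subset: "slit_disc \<subseteq> slit_plane"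
  by (auto simp: slit_disc_def)

lemma Re_slit_disc: "z \<in> slit_disc \<Longrightarrow> Re (1 - of_int C * z) > 0"
proof -
  assume z: "z \<in> slit_disc"
  then have "of_int C * norm z < 1" using C by (simp add: slit_disc_def field_simps)
  moreover have "of_int C * Re z \<le> of_int C * norm z"
    using C by (intro mult_left_mono complex_Re_le_cmod) simp
  ultimately show ?thesis by simp
qed

end

section \<open>The Frobenius functions beyond their disc\<close>

context mirror_case
begin

text \<open>On the slit disc Re(1 - C z) > 0, so the rotated logarithm in \<open>h_plus\<close> is
  the principal one. The identity then spreads from the upper half disc to the lower one, where
  \<open>h\<close> is built from the other kernel.\<close>

theorem y0_decomposition:
  assumes z: "z \<in> slit_disc"
  shows "y0 z = h z + W z * Ln (1 - of_int C * z) / (2 * of_real pi * \<i>)"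
proof (rule half_disc_identity[OF _ _ _ z])
  show "y0 holomorphic_on slit_disc" using y_holomorphic[of 0] by (simp add: y_simps)
  have "(\<lambda>z. Ln (1 - of_int C * z)) holomorphic_on slit_disc"
    using Re_slit_disc by (intro holomorphic_intros) (force simp: complex_nonpos_Reals_iff)
  then show "(\<lambda>z. h z + W z * Ln (1 - of_int C * z) / (2 * of_real pi * \<i>)) holomorphic_on slit_disc"
    by (intro holomorphic_on_add holomorphic_on_divide holomorphic_on_mult holomorphic_on_const
        holomorphic_on_subset[OF h_holomorphic slit_disc_subset]
        holomorphic_on_subset[OF W_holomorphic slit_disc_subset]) simp_all
  fix z assume z: "z \<in> half_disc"
  then have "Im z > 0" by (simp add: half_disc_def)
  have "Re (1 - of_int C * z) > 0" using Re_slit_disc z half_disc(3) by blast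
  from Ln_times_i(1)[OF this] have "h z = - (1 / 2) * V (- 1) 1 z - W z * Ln (1 - of_int C * z) / (2 * of_real pi * \<i>)"
    using \<open>Im z > 0\<close> by (simp add: h_def h_plus_def)
  moreover have "V (- 1) 1 z = - 2 * y0 z" unfolding V_upper_chain by (rule upper_chain_values(1)[OF z])
  ultimately show "y0 z = h z + W z * Ln (1 - of_int C * z) / (2 * of_real pi * \<i>)" by simp
qed

theorem
  assumes z: "z \<in> slit_disc"
  shows y1_extension: "y1 z = - of_real pi / 2 * V 0 2 z"
    and y2_extension: "y2 z + \<i> * of_real pi * y1 z + r2 * y0 z = - (of_real pi ^ 2) / 2 * V 1 3 z"
    and W_expansion: "W z = - \<i> / (8 * of_real pi ^ 3)
      * (of_int H3 * y3 z - of_int c2H * of_real pi ^ 2 / 6 * y1 z + of_int c3 * of_real zeta3 * y0 z)"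
proof -
  have yh: "y0 holomorphic_on slit_disc" "y1 holomorphic_on slit_disc" "y2 holomorphic_on slit_disc" "y3 holomorphic_on slit_disc"
    using y_holomorphic[of 0] y_holomorphic[of 1] y_holomorphic[of 2] y_holomorphic[of 3] by (simp_all add: y_simps)
  have Vh: "V 0 2 holomorphic_on slit_disc" "V 1 3 holomorphic_on slit_disc" "W holomorphic_on slit_disc"
    by (rule holomorphic_on_subset[OF _ slit_disc_subset], (rule V_holomorphic_slit_plane W_holomorphic; simp))+
  show "y1 z = - of_real pi / 2 * V 0 2 z"
    by (rule half_disc_identity[OF _ _ _ z])
      (auto intro!: holomorphic_intros yh Vh[unfolded V_upper_chain] simp: V_upper_chain upper_chain_values(2))
  show "y2 z + \<i> * of_real pi * y1 z + r2 * y0 z = - (of_real pi ^ 2) / 2 * V 1 3 z"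
    by (rule half_disc_identity[OF _ _ _ z])
      (auto intro!: holomorphic_intros yh Vh[unfolded V_upper_chain] simp: V_upper_chain upper_chain_values(3))
  show "W z = - \<i> / (8 * of_real pi ^ 3)
      * (of_int H3 * y3 z - of_int c2H * of_real pi ^ 2 / 6 * y1 z + of_int c3 * of_real zeta3 * y0 z)"
  proof (rule half_disc_identity[OF Vh(3) _ _ z])
    fix z assume z: "z \<in> half_disc"
    have H: "of_int H3 \<noteq> (0::complex)" using H3 by simp
    have "al + be = of_real (of_int (c2H + 2 * H3) / 48)" "al * be = of_real (of_int H3 / 16)"
      unfolding al_def be_def using cy_row_sin[OF row] by (simp_all only: flip: of_real_add of_real_mult)
    then have s: "al + be = (of_int c2H + 2 * of_int H3) / 48" "al * be = of_int H3 / 16" by simp_all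
    have r: "r2 = of_real pi ^ 2 / 6 * of_int c2H / of_int H3" "r3 = of_int c3 * of_real zeta3 / of_int H3"
      by (simp_all add: r2_def r3_def)
    \<comment> \<open>In the coefficient of \<open>y1\<close> the term 2 pi^2/3 of the kernel
      1/sin^4 cancels the part 2 H^3/48 of the other kernel, and pi^2/6 - pi^2/3 = -pi^2/6 remains
      in front of c2.H.\<close>
    show "W z = - \<i> / (8 * of_real pi ^ 3)
      * (of_int H3 * y3 z - of_int c2H * of_real pi ^ 2 / 6 * y1 z + of_int c3 * of_real zeta3 * y0 z)"
      unfolding W_def V_upper_chain upper_chain_values(2,4)[OF z] s r
      using H by (simp add: field_simps power2_eq_square power3_eq_cube)
  qed (auto intro!: holomorphic_intros yh)
qed

end

section \<open>The monodromy matrices\<close>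

lemma mat_of_rows_list_4_2:
  "mat_of_rows_list 4 [r0, r1, r2, r3] = Matrix.mat 4 4 (\<lambda>(i, j). [r0, r1, r2, r3] ! i ! j)"
  "mat_of_rows_list 2 [r0, r1] = Matrix.mat 2 2 (\<lambda>(i, j). [r0, r1] ! i ! j)"
  by (simp_all add: mat_of_rows_list_def eval_nat_numeral)

lemma Ln_divide_pos_real:
  assumes "r > 0" "z \<noteq> 0"
  shows "Ln (z / of_real r) = Ln z - of_real (ln r)"
proof -
  have "Ln (of_real (1 / r) * z) = Ln (complex_of_real (1 / r)) + Ln z"
    by (rule Ln_times_of_real) (use assms in auto)
  moreover have "Ln (complex_of_real (1 / r)) = of_real (ln (1 / r))"
    by (rule Ln_of_real) (use assms in auto)
  ultimately show ?thesis using assms by (simp add: ln_div)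
qed

text \<open>Replacing log z by log z + x acts on the Frobenius basis as exp(x N) with N nilpotent.
  The coefficient of log^l z in \<open>y j\<close> is g_(j - l) / l! with g_0 = y0, holomorphic on
  the whole disc, which is the shape needed for continuation.\<close>

lemma (in frobenius) y_log_polynomial:
  "\<exists>G :: nat \<Rightarrow> nat \<Rightarrow> complex \<Rightarrow> complex. (\<forall>j l. j < 4 \<longrightarrow> G j l holomorphic_on ball 0 (1 / C)) \<and>
    (\<forall>z\<in>slit_disc. \<forall>x.
      (\<Sum>l<4. G 0 l z * (Ln z + x) ^ l) = y0 z \<and>
      (\<Sum>l<4. G 1 l z * (Ln z + x) ^ l) = y1 z + x * y0 z \<and>
      (\<Sum>l<4. G 2 l z * (Ln z + x) ^ l) = y2 z + x * y1 z + x ^ 2 / 2 * y0 z \<and>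
      (\<Sum>l<4. G 3 l z * (Ln z + x) ^ l) = y3 z + x * y2 z + x ^ 2 / 2 * y1 z + x ^ 3 / 6 * y0 z)"
proof -
  obtain g1 g2 g3 where y0: "y0 holomorphic_on ball 0 (1 / C)"
    and g: "\<And>g. g \<in> {g1, g2, g3} \<Longrightarrow> g holomorphic_on ball 0 (1 / C)"
    and ys: "\<And>z. z \<in> slit_disc \<Longrightarrow> y1 z = y0 z * Ln z + g1 z"
      "\<And>z. z \<in> slit_disc \<Longrightarrow> y2 z = y0 z * Ln z ^ 2 / 2 + g1 z * Ln z + g2 z"
      "\<And>z. z \<in> slit_disc \<Longrightarrow> y3 z = y0 z * Ln z ^ 3 / 6 + g1 z * Ln z ^ 2 / 2 + g2 z * Ln z + g3 z"
    using frob unfolding frobenius_basis_def slit_disc_def by blast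
  define gg where "gg = (\<lambda>i::nat. if i = 0 then y0 else if i = 1 then g1 else if i = 2 then g2 else g3)"
  define G where "G = (\<lambda>j l z. if l \<le> j then gg (j - l) z / fact l else (0::complex))"
  have "gg i holomorphic_on ball 0 (1 / C)" for i using y0 g by (simp add: gg_def)
  then have hol: "G j l holomorphic_on ball 0 (1 / C)" for j l
    unfolding G_def by (cases "l \<le> j") (auto intro!: holomorphic_intros)
  have eqs: "(\<Sum>l<4. G 0 l z * (Ln z + x) ^ l) = y0 z"
      "(\<Sum>l<4. G 1 l z * (Ln z + x) ^ l) = y1 z + x * y0 z"
      "(\<Sum>l<4. G 2 l z * (Ln z + x) ^ l) = y2 z + x * y1 z + x ^ 2 / 2 * y0 z"
      "(\<Sum>l<4. G 3 l z * (Ln z + x) ^ l) = y3 z + x * y2 z + x ^ 2 / 2 * y1 z + x ^ 3 / 6 * y0 z"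
    if z: "z \<in> slit_disc" for z x
    unfolding sum4 ys[OF z]
    by (simp_all add: G_def gg_def fact_numeral field_simps power2_eq_square power3_eq_cube)
  show ?thesis
    by (intro exI[of _ G] conjI allI impI ballI; simp only: hol eqs)
qed

context mirror_case
begin

abbreviation fs :: "(complex \<Rightarrow> complex) list" where
  "fs \<equiv> ordered_basis H3 c2H c3 y0 y1 y2 y3"

abbreviation w :: complex where "w \<equiv> 2 * of_real pi * \<i>"

definition basis_coeff :: "nat \<Rightarrow> nat \<Rightarrow> complex" where
  "basis_coeff i j = [[0, 1 / w, 0, 0], [1, 0, 0, 0],
     [- (of_int c2H / 24), of_int H3 / (2 * w), of_int H3 / w ^ 2, 0],
     [- (of_int c3 * of_real zeta3 / w ^ 3), - (of_int c2H / (24 * w)), 0, - (of_int H3 / w ^ 3)]] ! i ! j"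

lemma length_fs: "length fs = 4" by (simp add: ordered_basis_def)

lemma basis_coeff_simps:
  "basis_coeff 0 0 = 0" "basis_coeff 0 1 = 1 / w" "basis_coeff 0 2 = 0" "basis_coeff 0 3 = 0"
  "basis_coeff 1 0 = 1" "basis_coeff 1 1 = 0" "basis_coeff 1 2 = 0" "basis_coeff 1 3 = 0"
  "basis_coeff 2 0 = - (of_int c2H / 24)" "basis_coeff 2 1 = of_int H3 / (2 * w)"
  "basis_coeff 2 2 = of_int H3 / w ^ 2" "basis_coeff 2 3 = 0"
  "basis_coeff 3 0 = - (of_int c3 * of_real zeta3 / w ^ 3)" "basis_coeff 3 1 = - (of_int c2H / (24 * w))"
  "basis_coeff 3 2 = 0" "basis_coeff 3 3 = - (of_int H3 / w ^ 3)"
  by (simp_all add: basis_coeff_def)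

lemma fs_eq:
  "(fs ! 0) z = y1 z / w" "(fs ! 1) z = y0 z"
  "(fs ! 2) z = of_int H3 / w ^ 2 * y2 z + of_int H3 / (2 * w) * y1 z - of_int c2H / 24 * y0 z"
  "(fs ! 3) z = - (of_int H3 / w ^ 3) * y3 z - of_int c2H / (24 * w) * y1 z - of_int c3 / w ^ 3 * of_real zeta3 * y0 z"
  by (simp_all add: ordered_basis_def field_simps)

lemma fs_expansion:
  assumes "i < 4"
  shows "(fs ! i) z = (\<Sum>j<4. basis_coeff i j * y j z)"
proof -
  consider "i = 0" | "i = 1" | "i = 2" | "i = 3" using assms by linarith
  then show ?thesis
    by cases (simp_all only: sum4 basis_coeff_simps fs_eq y_simps, simp_all)
qed

lemma fs_holomorphic: "i < 4 \<Longrightarrow> fs ! i holomorphic_on slit_disc"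
proof -
  assume i: "i < 4"
  have "(\<lambda>z. \<Sum>j\<in>{..<4}. basis_coeff i j * y j z) holomorphic_on slit_disc"
    by (intro holomorphic_intros y_holomorphic) auto
  then show ?thesis by (rule holomorphic_transform) (simp add: fs_expansion[OF i])
qed

text \<open>In terms of the Frobenius basis the coefficient matrix is triangular up to reordering,
  with nonzero pivots because H^3 > 0; the equations for y3, y2, y1, y0 are solved in this
  order.\<close>

lemma fs_independent: "\<forall>c. (\<forall>z\<in>slit_disc. (\<Sum>i<4. c i * (fs ! i) z) = 0) \<longrightarrow> (\<forall>i<4. c i = 0)"
proof (intro allI impI)
  fix c :: "nat \<Rightarrow> complex" and i :: nat
  assume c: "\<forall>z\<in>slit_disc. (\<Sum>i<4. c i * (fs ! i) z) = 0" and i: "i < 4"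
  have "\<forall>j<4. (\<Sum>i<4. c i * basis_coeff i j) = 0"
  proof (rule y_independent[THEN spec, THEN mp], intro ballI)
    fix z assume "z \<in> half_disc"
    then have "z \<in> slit_disc" using half_disc(3) by blast
    have "(\<Sum>j<4. (\<Sum>i<4. c i * basis_coeff i j) * y j z) = (\<Sum>i<4. c i * (\<Sum>j<4. basis_coeff i j * y j z))"
      unfolding sum4 by (simp only: distrib_left distrib_right mult.assoc add_ac)
    also have "\<dots> = (\<Sum>i<4. c i * (fs ! i) z)" by (intro sum.cong refl) (simp add: fs_expansion)
    finally show "(\<Sum>j<4. (\<Sum>i<4. c i * basis_coeff i j) * y j z) = 0" using c \<open>z \<in> slit_disc\<close> by simp
  qed
  then have e: "(\<Sum>i<4. c i * basis_coeff i 0) = 0" "(\<Sum>i<4. c i * basis_coeff i 1) = 0"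
    "(\<Sum>i<4. c i * basis_coeff i 2) = 0" "(\<Sum>i<4. c i * basis_coeff i 3) = 0" by simp_all
  have c3: "c 3 = 0" using e(4) H3 unfolding sum4 basis_coeff_simps by simp
  have c2: "c 2 = 0" using e(3) H3 unfolding sum4 basis_coeff_simps by simp
  have c0: "c 0 = 0" using e(2) c2 c3 unfolding sum4 basis_coeff_simps by simp
  have c1: "c 1 = 0" using e(1) c0 c2 c3 unfolding sum4 basis_coeff_simps by simp
  show "c i = 0" using i c0 c1 c2 c3 by (auto simp: less4)
qed

lemma fs_solution_basis:
  assumes "b \<in> slit_disc"
  shows "solution_basis (picard_fuchs A B C) b fs"
proof (rule solution_basisI[OF slit_disc(1-3) assms slit_disc(4) fs_holomorphic _ length_fs fs_independent])
  fix i z assume i: "i < (4::nat)" and z: "z \<in> slit_disc"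
  have "fs ! i = (\<lambda>z. \<Sum>j\<in>{..<4}. basis_coeff i j * y j z)" by (rule ext) (rule fs_expansion[OF i])
  then show "picard_fuchs A B C (fs ! i) z = 0"
    by (simp only:) (rule picard_fuchs_sum[OF slit_disc(1,2) _ _ z]; use y_holomorphic y_solution in auto)
qed

lemma real_slit_disc: "0 < b \<Longrightarrow> b < 1 / of_int C \<Longrightarrow> complex_of_real b \<in> slit_disc"
  by (simp add: slit_disc_def complex_nonpos_Reals_iff)

text \<open>Along the circle the logarithm starts at log b and gains 2 pi i, so the shift formula
  for the Frobenius basis is used with x = 0 at the start and x = \<open>w\<close> at the
  end.\<close>

lemma circle_continuation:
  assumes b: "0 < b" "b < 1 / of_int C" and i: "i < 4"
    and e: "\<And>z. z \<in> slit_disc \<Longrightarrow> g z = basis_coeff i 0 * y0 z + basis_coeff i 1 * (y1 z + w * y0 z)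
      + basis_coeff i 2 * (y2 z + w * y1 z + w ^ 2 / 2 * y0 z)
      + basis_coeff i 3 * (y3 z + w * y2 z + w ^ 2 / 2 * y1 z + w ^ 3 / 6 * y0 z)"
  shows "continues_along (circlepath 0 b) (fs ! i) g"
proof -
  obtain G :: "nat \<Rightarrow> nat \<Rightarrow> complex \<Rightarrow> complex"
    where G0: "\<forall>j l. j < 4 \<longrightarrow> G j l holomorphic_on ball 0 (1 / C)"
      and G1: "\<forall>z\<in>slit_disc. \<forall>x.
      (\<Sum>l<4. G 0 l z * (Ln z + x) ^ l) = y0 z \<and>
      (\<Sum>l<4. G 1 l z * (Ln z + x) ^ l) = y1 z + x * y0 z \<and>
      (\<Sum>l<4. G 2 l z * (Ln z + x) ^ l) = y2 z + x * y1 z + x ^ 2 / 2 * y0 z \<and>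
      (\<Sum>l<4. G 3 l z * (Ln z + x) ^ l) = y3 z + x * y2 z + x ^ 2 / 2 * y1 z + x ^ 3 / 6 * y0 z"
    using y_log_polynomial by (elim exE conjE) (rule that)
  have G: "G j l holomorphic_on ball 0 (1 / C)" if "j < 4" for j l using G0 that by simp
  note Gy = G1[rule_format, THEN conjunct1] G1[rule_format, THEN conjunct2, THEN conjunct1]
    G1[rule_format, THEN conjunct2, THEN conjunct2, THEN conjunct1]
    G1[rule_format, THEN conjunct2, THEN conjunct2, THEN conjunct2]
  define H where "H = (\<lambda>l z. \<Sum>j\<in>{..<4}. basis_coeff i j * G j l z)"
  have HG: "(\<Sum>l<4. H l z * (Ln z + x) ^ l) = basis_coeff i 0 * y0 z + basis_coeff i 1 * (y1 z + x * y0 z)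
      + basis_coeff i 2 * (y2 z + x * y1 z + x ^ 2 / 2 * y0 z)
      + basis_coeff i 3 * (y3 z + x * y2 z + x ^ 2 / 2 * y1 z + x ^ 3 / 6 * y0 z)"
    if z: "z \<in> slit_disc" for z x
  proof -
    have "(\<Sum>l<4. H l z * (Ln z + x) ^ l) = (\<Sum>j<4. basis_coeff i j * (\<Sum>l<4. G j l z * (Ln z + x) ^ l))"
      unfolding H_def sum4 by (simp only: distrib_left distrib_right mult.assoc add_ac)
    then show ?thesis unfolding sum4[of "\<lambda>j. basis_coeff i j * _ j"] Gy[OF z] .
  qed
  have bs: "complex_of_real b \<in> slit_disc" by (rule real_slit_disc[OF b])
  define q where "q = (\<lambda>t::real. of_real (ln b) + w * of_real t)"
  have ev: "\<forall>\<^sub>F z in nhds (complex_of_real b). z \<in> slit_disc"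
    by (rule eventually_nhds_in_open[OF slit_disc(1) bs])
  have c01: "circlepath 0 b 0 = of_real b" "circlepath 0 b 1 = of_real b"
    using pathstart_circlepath[of 0 b] pathfinish_circlepath[of 0 b] by (simp_all add: pathstart_def pathfinish_def)
  have Ln: "Ln ((z - 0) / (of_real b - 0)) = Ln z - of_real (ln b)" if "z \<in> slit_disc" for z
    using Ln_divide_pos_real[OF b(1), of z] that slit_disc(2) by auto
  show ?thesis
  proof (rule continues_along_log_polynomial[where U = "ball 0 (1 / C)" and p = 0 and q = q and h = H and n = 4])
    show "path_image (circlepath 0 b) \<subseteq> ball 0 (1 / C)" using b by (auto simp: path_image_circlepath)
    show "H l holomorphic_on ball 0 (1 / C)" for l unfolding H_def by (intro holomorphic_intros G) auto
    show "path q" unfolding q_def path_def by (intro continuous_intros)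
    have "exp (of_real (ln b)) = complex_of_real b" using b(1) by (simp add: exp_of_real)
    then show "circlepath 0 b t = 0 + exp (q t)" for t
      by (simp add: q_def circlepath exp_add mult_ac)
    show "\<forall>\<^sub>F z in nhds (circlepath 0 b 0). (fs ! i) z = (\<Sum>l<4. H l z * (q 0 + Ln ((z - 0) / (circlepath 0 b 0 - 0))) ^ l)"
      unfolding c01
    proof (rule eventually_mono[OF ev])
      fix z assume z: "z \<in> slit_disc"
      have "(\<Sum>l<4. H l z * (Ln z + 0) ^ l) = (\<Sum>j<4. basis_coeff i j * y j z)"
        unfolding HG[OF z] sum4 y_simps by simp
      then show "(fs ! i) z = (\<Sum>l<4. H l z * (q 0 + Ln ((z - 0) / (of_real b - 0))) ^ l)"
        unfolding Ln[OF z] fs_expansion[OF i] q_def by simp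
    qed
    show "\<forall>\<^sub>F z in nhds (circlepath 0 b 1). g z = (\<Sum>l<4. H l z * (q 1 + Ln ((z - 0) / (circlepath 0 b 1 - 0))) ^ l)"
      unfolding c01
    proof (rule eventually_mono[OF ev])
      fix z assume z: "z \<in> slit_disc"
      show "g z = (\<Sum>l<4. H l z * (q 1 + Ln ((z - 0) / (of_real b - 0))) ^ l)"
        unfolding Ln[OF z] e[OF z] HG[OF z, symmetric] q_def by (simp add: add.commute)
    qed
  qed auto
qed

theorem monodromy_at_zero:
  assumes b: "0 < b" "b < 1 / of_int C"
  shows "monodromy_matrix (picard_fuchs A B C) (circlepath 0 b) fs
    (monodromy_zero (of_int H3) (of_int H3 / 6 + of_int c2H / 12))"
  unfolding monodromy_matrix_def length_fs
proof (intro conjI allI impI)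
  let ?M = "monodromy_zero (of_int H3) (of_int H3 / 6 + of_int c2H / 12)"
  show "solution_basis (picard_fuchs A B C) (pathstart (circlepath 0 b)) fs"
    using fs_solution_basis[OF real_slit_disc[OF b]] by simp
  show "?M \<in> carrier_mat 4 4" by (simp add: monodromy_zero_def mat_of_rows_list_4_2)
  fix i :: nat assume i: "i < 4"
  have w0: "w \<noteq> 0" by simp
  show "continues_along (circlepath 0 b) (fs ! i) (\<lambda>z. \<Sum>j<4. ?M $$ (i, j) * (fs ! j) z)"
  proof (rule circle_continuation[OF b i])
    fix z
    define L where "L = [[1, 1, 0, 0], [0, 1, 0, 0], [of_int H3, of_int H3, 1, 0],
        [0, - (of_int H3 / 6 + of_int c2H / 12), - 1, 1 :: complex]]"
    have M: "?M $$ (i, 0) = L ! i ! 0" "?M $$ (i, 1) = L ! i ! 1" "?M $$ (i, 2) = L ! i ! 2" "?M $$ (i, 3) = L ! i ! 3"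
      using i by (simp_all add: monodromy_zero_def mat_of_rows_list_4_2 L_def)
    \<comment> \<open>Naming 2 pi i reduces each entry of the matrix to a rational identity in a
      nonzero variable \<open>v\<close>.\<close>
    define v where "v = w"
    have v: "v \<noteq> 0" by (simp add: v_def)
    consider "i = 0" | "i = 1" | "i = 2" | "i = 3" using i by linarith
    then show "(\<Sum>j<4. ?M $$ (i, j) * (fs ! j) z) = basis_coeff i 0 * y0 z + basis_coeff i 1 * (y1 z + w * y0 z)
      + basis_coeff i 2 * (y2 z + w * y1 z + w ^ 2 / 2 * y0 z)
      + basis_coeff i 3 * (y3 z + w * y2 z + w ^ 2 / 2 * y1 z + w ^ 3 / 6 * y0 z)"
      unfolding sum4 fs_eq M L_def
      by cases (simp_all only: basis_coeff_simps v_def[symmetric],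
          use v in \<open>simp_all add: field_simps power2_eq_square power3_eq_cube\<close>)
  qed
qed simp

end

section \<open>The loop around the conifold point\<close>

context mirror_case
begin

text \<open>A continuous logarithm of gamma - 1/C along the path grows by 2 pi i times the winding
  number. Since \<open>a\<close> and \<open>c\<close> are single-valued on the slit plane, which
  contains the path, only the logarithm changes.\<close>

lemma conifold_continuation:
  assumes b: "0 < b" "b < 1 / of_int C"
    and \<gamma>: "path \<gamma>" "\<gamma> 0 = of_real b" "\<gamma> 1 = of_real b" "path_image \<gamma> \<subseteq> slit_plane - {1 / of_int C}"
      "winding_number \<gamma> (1 / of_int C) = 1"
    and a: "a holomorphic_on slit_plane" and c: "c holomorphic_on slit_plane"
    and f: "\<And>z. z \<in> slit_disc \<Longrightarrow> f z = a z + c z * Ln (1 - of_int C * z)"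
    and g: "\<And>z. z \<in> slit_disc \<Longrightarrow> g z = f z + w * c z"
  shows "continues_along \<gamma> f g"
proof -
  let ?p = "1 / complex_of_int C"
  have p: "?p \<notin> path_image \<gamma>" using \<gamma>(4) by blast
  obtain q where q: "path q" "pathfinish q - pathstart q = 2 * of_real pi * \<i> * winding_number \<gamma> ?p"
    "\<And>t. t \<in> {0..1} \<Longrightarrow> \<gamma> t = ?p + exp (q t)"
    using winding_number_as_continuous_log[OF \<gamma>(1) p] by blast
  have q1: "q 1 = q 0 + w" using q(2) \<gamma>(5) by (simp add: pathstart_def pathfinish_def diff_eq_eq add.commute)
  \<comment> \<open>The constant difference between log(1 - C z) and the chosen logarithm of z -
    1/C; it absorbs the factor -C and the choice of branch.\<close>
  define \<kappa> where "\<kappa> = of_real (ln (1 - of_int C * b)) - q 0"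
  define h where "h = (\<lambda>i::nat. if i = 0 then (\<lambda>z. a z + c z * \<kappa>) else c)"
  have bs: "complex_of_real b \<in> slit_disc" by (rule real_slit_disc[OF b])
  have ev: "\<forall>\<^sub>F z in nhds (complex_of_real b). z \<in> slit_disc"
    by (rule eventually_nhds_in_open[OF slit_disc(1) bs])
  have pos: "1 - of_int C * b > 0" using b C by (simp add: field_simps)
  have Ln: "Ln ((z - ?p) / (of_real b - ?p)) = Ln (1 - of_int C * z) - of_real (ln (1 - of_int C * b))"
    if z: "z \<in> slit_disc" for z
  proof -
    have C0: "complex_of_int C \<noteq> 0" using C by simp
    have "(z - ?p) / (of_real b - ?p) = (of_int C * (z - ?p)) / (of_int C * (of_real b - ?p))" using C0 by simp
    also have "of_int C * (z - ?p) = - (1 - of_int C * z)" using C0 by (simp add: algebra_simps)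
    also have "of_int C * (of_real b - ?p) = - (1 - of_int C * of_real b)" using C0 by (simp add: algebra_simps)
    also have "- (1 - of_int C * z) / - (1 - of_int C * of_real b) = (1 - of_int C * z) / complex_of_real (1 - of_int C * b)"
      unfolding minus_divide_divide by simp
    finally have "(z - ?p) / (of_real b - ?p) = (1 - of_int C * z) / complex_of_real (1 - of_int C * b)" .
    moreover have "1 - of_int C * z \<noteq> 0" using Re_slit_disc[OF z] by (metis less_irrefl zero_complex.sel(1))
    ultimately show ?thesis using Ln_divide_pos_real[OF pos] by simp
  qed
  have sum2: "(\<Sum>i<2. h i z * x ^ i) = a z + c z * \<kappa> + c z * x" for z x
    by (simp add: eval_nat_numeral h_def)
  show ?thesis
  proof (rule continues_along_log_polynomial[where U = slit_plane and p = ?p and q = q and h = h and n = 2])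
    show "open slit_plane" by (simp add: open_Compl)
    show "path_image \<gamma> \<subseteq> slit_plane" using \<gamma>(4) by blast
    show "h i holomorphic_on slit_plane" for i
      unfolding h_def using a c by (auto intro!: holomorphic_intros)
    show "\<forall>\<^sub>F z in nhds (\<gamma> 0). f z = (\<Sum>i<2. h i z * (q 0 + Ln ((z - ?p) / (\<gamma> 0 - ?p))) ^ i)"
      unfolding \<gamma>(2) sum2
      by (rule eventually_mono[OF ev], unfold Ln f) (simp add: \<kappa>_def algebra_simps)
    show "\<forall>\<^sub>F z in nhds (\<gamma> 1). g z = (\<Sum>i<2. h i z * (q 1 + Ln ((z - ?p) / (\<gamma> 1 - ?p))) ^ i)"
      unfolding \<gamma>(3) sum2
      by (rule eventually_mono[OF ev], unfold Ln g f q1) (simp add: \<kappa>_def algebra_simps)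
  qed (use \<gamma> q in auto)
qed

text \<open>Three basis functions are built from integrals holomorphic on the whole slit plane, so
  they contain no logarithm at 1/C.\<close>

lemma fs_extension:
  assumes z: "z \<in> slit_disc"
  shows "(fs ! 0) z = - of_real pi / (2 * w) * V 0 2 z"
    and "(fs ! 2) z = - of_int H3 * of_real pi ^ 2 / (2 * w ^ 2) * V 1 3 z"
    and "(fs ! 3) z = W z"
proof -
  show "(fs ! 0) z = - of_real pi / (2 * w) * V 0 2 z"
    unfolding fs_eq y1_extension[OF z] by (simp add: field_simps)
  have H: "of_int H3 \<noteq> (0::complex)" using H3 by simp
  have "- of_int H3 * of_real pi ^ 2 / (2 * w ^ 2) * V 1 3 z = of_int H3 / w ^ 2 * (- (of_real pi ^ 2) / 2 * V 1 3 z)"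
    by (simp add: mult_ac)
  also have "\<dots> = of_int H3 / w ^ 2 * (y2 z + \<i> * of_real pi * y1 z + r2 * y0 z)"
    unfolding y2_extension[OF z] ..
  also have "\<dots> = (fs ! 2) z"
    unfolding fs_eq r2_def using H by (simp add: field_simps power2_eq_square)
  finally show "(fs ! 2) z = - of_int H3 * of_real pi ^ 2 / (2 * w ^ 2) * V 1 3 z" by simp
  show "(fs ! 3) z = W z"
    unfolding fs_eq W_expansion[OF z] by (simp add: field_simps power2_eq_square power3_eq_cube)
qed

text \<open>Only the second basis function, \<open>y0\<close>, carries a logarithm, with coefficient
  W / (2 pi i). One turn adds W, the fourth basis function; this is the single off-diagonal
  entry.\<close>

theorem monodromy_at_conifold:
  assumes b: "0 < b" "b < 1 / of_int C"
    and \<gamma>: "path \<gamma>" "pathstart \<gamma> = of_real b" "pathfinish \<gamma> = of_real b"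
      "path_image \<gamma> \<subseteq> slit_plane - {1 / of_int C}" "winding_number \<gamma> (1 / of_int C) = 1"
  shows "monodromy_matrix (picard_fuchs A B C) \<gamma> fs monodromy_conifold"
  unfolding monodromy_matrix_def length_fs
proof (intro conjI allI impI)
  show "pathfinish \<gamma> = pathstart \<gamma>" using \<gamma> by simp
  show "solution_basis (picard_fuchs A B C) (pathstart \<gamma>) fs"
    unfolding \<gamma>(2) by (rule fs_solution_basis[OF real_slit_disc[OF b]])
  show "monodromy_conifold \<in> carrier_mat 4 4" by (simp add: monodromy_conifold_def mat_of_rows_list_4_2)
  fix i :: nat assume i: "i < 4"
  let ?g = "\<lambda>z. \<Sum>j<4. monodromy_conifold $$ (i, j) * (fs ! j) z"
  define L where "L = [[1, 0, 0, 0], [0, 1, 0, 1], [0, 0, 1, 0], [0, 0, 0, 1 :: complex]]"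
  have M: "monodromy_conifold $$ (i, 0) = L ! i ! 0" "monodromy_conifold $$ (i, 1) = L ! i ! 1"
    "monodromy_conifold $$ (i, 2) = L ! i ! 2" "monodromy_conifold $$ (i, 3) = L ! i ! 3"
    using i by (simp_all add: monodromy_conifold_def mat_of_rows_list_4_2 L_def)
  have g: "?g z = L ! i ! 0 * (fs ! 0) z + L ! i ! 1 * (fs ! 1) z + L ! i ! 2 * (fs ! 2) z + L ! i ! 3 * (fs ! 3) z" for z
    unfolding sum4 M ..
  note cc = conifold_continuation[OF b \<gamma>(1) \<gamma>(2,3)[unfolded pathstart_def pathfinish_def] \<gamma>(4,5)]
  have Vh: "V 0 2 holomorphic_on slit_plane" "V 1 3 holomorphic_on slit_plane"
    by (rule V_holomorphic_slit_plane; simp)+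
  have zero: "(\<lambda>_. 0) holomorphic_on slit_plane" by simp
  consider "i = 0" | "i = 1" | "i = 2" | "i = 3" using i by linarith
  then show "continues_along \<gamma> (fs ! i) ?g"
  proof cases
    case 1
    show ?thesis
    proof (rule cc[OF _ zero])
      show "(\<lambda>z. - of_real pi / (2 * w) * V 0 2 z) holomorphic_on slit_plane" by (intro holomorphic_intros Vh)  simp
    qed (simp_all add: g[unfolded 1] L_def 1 fs_extension(1))
  next
    case 2
    show ?thesis
    proof (rule cc[OF h_holomorphic])
      show "(\<lambda>z. W z / w) holomorphic_on slit_plane" by (intro holomorphic_intros W_holomorphic) simp
      show "(fs ! i) z = h z + W z / w * Ln (1 - of_int C * z)" if "z \<in> slit_disc" for z
        unfolding 2 fs_eq(2) y0_decomposition[OF that] by simp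
      show "?g z = (fs ! i) z + w * (W z / w)" if "z \<in> slit_disc" for z
        unfolding g fs_extension(3)[OF that] by (simp add: 2 L_def)
    qed
  next
    case 3
    show ?thesis
    proof (rule cc[OF _ zero])
      show "(\<lambda>z. - of_int H3 * of_real pi ^ 2 / (2 * w ^ 2) * V 1 3 z) holomorphic_on slit_plane"
        by (intro holomorphic_intros Vh) simp
    qed (simp_all add: g[unfolded 3] L_def 3 fs_extension(2))
  next
    case 4
    show ?thesis
      by (rule cc[OF W_holomorphic zero]) (simp_all add: g[unfolded 4] L_def 4 fs_extension(3))
  qed
qed

end

section \<open>Integral matrices and the congruence subgroup\<close>

definition int_monodromy_zero :: "int \<Rightarrow> int \<Rightarrow> int mat" where
  "int_monodromy_zero H K = mat_of_rows_list 4 [[1, 1, 0, 0], [0, 1, 0, 0], [H, H, 1, 0], [0, - K, - 1, 1]]"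

definition int_monodromy_conifold :: "int mat" where
  "int_monodromy_conifold = mat_of_rows_list 4 [[1, 0, 0, 0], [0, 1, 0, 1], [0, 0, 1, 0], [0, 0, 0, 1]]"

lemma sum_atLeastLessThan_4: "(\<Sum>j\<in>{0..<4}. g j) = g 0 + g 1 + g 2 + g 3" for g :: "nat \<Rightarrow> int"
  by (simp add: eval_nat_numeral)

lemma mat4_eqI:
  assumes "M \<in> carrier_mat 4 4" "N \<in> carrier_mat 4 4"
    and "\<And>i j. i < 4 \<Longrightarrow> j < 4 \<Longrightarrow> M $$ (i, j) = N $$ (i, j)"
  shows "M = N"
  using assms by (intro eq_matI) auto

lemma int_monodromy_zero_Sp: "int_monodromy_zero H K \<in> Sp4Z"
proof -
  define P Q R S :: "int mat" where "P = mat_of_rows_list 2 [[1, 1], [0, 1]]" and "Q = mat_of_rows_list 2 [[0, 0], [0, 0]]"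
    and "R = mat_of_rows_list 2 [[H, H], [0, - K]]" and "S = mat_of_rows_list 2 [[1, 0], [- 1, 1]]"
  note d = P_def Q_def R_def S_def mat_of_rows_list_4_2
  have c: "P \<in> carrier_mat 2 2" "Q \<in> carrier_mat 2 2" "R \<in> carrier_mat 2 2" "S \<in> carrier_mat 2 2"
    by (simp_all add: d)
  let ?M = "four_block_mat P Q R S"
  let ?N = "four_block_mat (transpose_mat S) (- transpose_mat Q) (- transpose_mat R) (transpose_mat P)"
  have M: "?M = int_monodromy_zero H K"
    by (rule mat4_eqI) (auto simp: int_monodromy_zero_def d less4)
  have N: "?N = mat_of_rows_list 4 [[1, - 1, 0, 0], [0, 1, 0, 0], [- H, 0, 1, 0], [- H, K, 1, 1]]"
    by (rule mat4_eqI) (auto simp: d less4)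
  have "inverts_mat ?M ?N" "inverts_mat ?N ?M"
    unfolding inverts_mat_def M N int_monodromy_zero_def mat_of_rows_list_4_2
    by (rule mat4_eqI; (simp; fail)?; auto simp: scalar_prod_def less4 sum_atLeastLessThan_4)+
  then show ?thesis unfolding Sp4Z_def M[symmetric] mem_Collect_eq using c
    by (intro exI[of _ P] exI[of _ Q] exI[of _ R] exI[of _ S]) simp
qed

lemma int_monodromy_conifold_Sp: "int_monodromy_conifold \<in> Sp4Z"
proof -
  define P Q R S :: "int mat" where "P = mat_of_rows_list 2 [[1, 0], [0, 1]]" and "Q = mat_of_rows_list 2 [[0, 0], [0, 1]]"
    and "R = mat_of_rows_list 2 [[0, 0], [0, 0]]" and "S = mat_of_rows_list 2 [[1, 0], [0, 1]]"
  note d = P_def Q_def R_def S_def mat_of_rows_list_4_2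
  have c: "P \<in> carrier_mat 2 2" "Q \<in> carrier_mat 2 2" "R \<in> carrier_mat 2 2" "S \<in> carrier_mat 2 2"
    by (simp_all add: d)
  let ?M = "four_block_mat P Q R S"
  let ?N = "four_block_mat (transpose_mat S) (- transpose_mat Q) (- transpose_mat R) (transpose_mat P)"
  have M: "?M = int_monodromy_conifold"
    by (rule mat4_eqI) (auto simp: int_monodromy_conifold_def d less4)
  have N: "?N = mat_of_rows_list 4 [[1, 0, 0, 0], [0, 1, 0, - 1], [0, 0, 1, 0], [0, 0, 0, 1]]"
    by (rule mat4_eqI) (auto simp: d less4)
  have "inverts_mat ?M ?N" "inverts_mat ?N ?M"
    unfolding inverts_mat_def M N int_monodromy_conifold_def mat_of_rows_list_4_2
    by (rule mat4_eqI; (simp; fail)?; auto simp: scalar_prod_def less4 sum_atLeastLessThan_4)+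
  then show ?thesis unfolding Sp4Z_def M[symmetric] mem_Collect_eq using c
    by (intro exI[of _ P] exI[of _ Q] exI[of _ R] exI[of _ S]) simp
qed

lemma int_monodromy_conifold_Gamma: "int_monodromy_conifold \<in> Gamma_group d1 d2"
  unfolding Gamma_group_def cong_pattern_def using int_monodromy_conifold_Sp
  by (auto simp: int_monodromy_conifold_def mat_of_rows_list_4_2 less4)

text \<open>Divisibility of H is asked for by the third row in both patterns, and divisibility of K
  by the last row in the pattern modulo \<open>d2\<close>.\<close>

lemma int_monodromy_zero_Gamma:
  assumes "d1 dvd H" "d2 dvd H" "d2 dvd K"
  shows "int_monodromy_zero H K \<in> Gamma_group d1 d2"
  unfolding Gamma_group_def cong_pattern_def using int_monodromy_zero_Sp assms
  by (auto simp: int_monodromy_zero_def mat_of_rows_list_4_2 less4 cong_0_iff)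

lemma monodromy_zero_of_int:
  "monodromy_zero (of_int H) (of_int K) = map_mat of_int (int_monodromy_zero H K)"
  by (rule mat4_eqI) (auto simp: monodromy_zero_def int_monodromy_zero_def mat_of_rows_list_4_2 less4)

lemma monodromy_conifold_of_int: "monodromy_conifold = map_mat of_int int_monodromy_conifold"
  by (rule mat4_eqI) (auto simp: monodromy_conifold_def int_monodromy_conifold_def mat_of_rows_list_4_2 less4)

lemma cy_row_monodromy_zero_Gamma:
  assumes "(A, B, C, H3, c2H, c3, d1, d2) \<in> cy_table"
  shows "monodromy_zero (of_int H3) (of_int H3 / 6 + of_int c2H / 12) \<in> map_mat of_int ` Gamma_group d1 d2"
proof -
  \<comment> \<open>k = (2 H^3 + c2.H)/12 is an integer in every row, so this integer division is
    exact.\<close>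
  define K where "K = (2 * H3 + c2H) div 12"
  have "d1 dvd H3 \<and> d2 dvd H3 \<and> d2 dvd (2 * H3 + c2H) div 12 \<and> 12 * ((2 * H3 + c2H) div 12) = 2 * H3 + c2H"
    using assms by (rule cy_table_cases; simp)
  then have K: "d1 dvd H3" "d2 dvd H3" "d2 dvd K" "12 * K = 2 * H3 + c2H" by (simp_all add: K_def)
  have "12 * complex_of_int K = 2 * of_int H3 + of_int c2H"
    using arg_cong[OF K(4), of complex_of_int] by simp
  then have "complex_of_int H3 / 6 + of_int c2H / 12 = of_int K" by (simp add: field_simps)
  then show ?thesis
    using monodromy_zero_of_int[of H3 K] int_monodromy_zero_Gamma[OF K(1-3)] by auto
qed

theorem theorem2:
  fixes A B b :: real and C H3 c2H c3 d1 d2 :: int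
    and y0 y1 y2 y3 :: "complex \<Rightarrow> complex" and d k :: complex
  assumes row: "(A, B, C, H3, c2H, c3, d1, d2) \<in> cy_table"
    and frobenius: "frobenius_basis (picard_fuchs A B C) (1 / C) y0 y1 y2 y3"
    and base_point: "0 < b" "b < 1 / C"
    and d: "d = of_int H3"
    and k: "k = of_int H3 / 6 + of_int c2H / 12"
  shows "monodromy_matrix (picard_fuchs A B C) (circlepath 0 b)
           (ordered_basis H3 c2H c3 y0 y1 y2 y3) (monodromy_zero d k) \<and>
         (\<forall>\<gamma>. simple_path \<gamma> \<and> pathstart \<gamma> = of_real b \<and> pathfinish \<gamma> = of_real b \<and>
              path_image \<gamma> \<subseteq> - \<real>\<^sub>\<le>\<^sub>0 - {1 / of_int C} \<and>
              winding_number \<gamma> (1 / of_int C) = 1 \<longrightarrow>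
            monodromy_matrix (picard_fuchs A B C) \<gamma>
              (ordered_basis H3 c2H c3 y0 y1 y2 y3) monodromy_conifold) \<and>
         monodromy_zero d k \<in> map_mat of_int ` Gamma_group d1 d2 \<and>
         monodromy_conifold \<in> map_mat of_int ` Gamma_group d1 d2"
proof -
  interpret mirror_case A B C y0 y1 y2 y3 H3 c2H c3 d1 d2
  proof
    show "C > 0" using row by (rule cy_table_cases; simp)
  qed (use row frobenius in auto)
  show ?thesis
  proof (intro conjI allI impI)
    show "monodromy_matrix (picard_fuchs A B C) (circlepath 0 b) fs (monodromy_zero d k)"
      unfolding d k by (rule monodromy_at_zero) (use base_point in auto)
    show "monodromy_matrix (picard_fuchs A B C) \<gamma> fs monodromy_conifold"
      if "simple_path \<gamma> \<and> pathstart \<gamma> = of_real b \<and> pathfinish \<gamma> = of_real b \<and>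
        path_image \<gamma> \<subseteq> - \<real>\<^sub>\<le>\<^sub>0 - {1 / of_int C} \<and> winding_number \<gamma> (1 / of_int C) = 1" for \<gamma>
      using that base_point by (intro monodromy_at_conifold[of b]) (auto intro: simple_path_imp_path)
    show "monodromy_zero d k \<in> map_mat of_int ` Gamma_group d1 d2"
      unfolding d k by (rule cy_row_monodromy_zero_Gamma[OF row])
    show "monodromy_conifold \<in> map_mat of_int ` Gamma_group d1 d2"
      unfolding monodromy_conifold_of_int using int_monodromy_conifold_Gamma by blast
  qed
qed

end
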